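(* Let $\mathbb{K}$ be a field with $\operatorname{char}(\mathbb{K})=0$, let $G$ be a finite group acting on a nonempty set $E$, let $D=G\times E$ be the associated generalized digroup, and let $Q,W\in\mathsf{Rep}(D)$. Let $\mathcal{F}=\operatorname{Hom}_{B_E}(Q,-):\mathsf{Rep}(D)\to\mathbb{K}G\text{-}\mathsf{Mod}$ and let $R^q\mathcal{F}$ denote its right derived functors. Then there exists a first-quadrant spectral sequence $$E_2^{p,q}\cong H^p\bigl(G,R^q\mathcal{F}(W)\bigr)\Longrightarrow\operatorname{Ext}^{p+q}_{\mathsf{Rep}(D)}(Q,W),$$ where $\mathcal{F}(W)=\operatorname{Hom}_{B_E}(Q,W)$ is endowed with the left $G$-action $$(g\cdot f)(q)=\rho_g^W\bigl(f((\rho_g^Q)^{-1}(q))\bigr)\qquad(g\in G,\ f\in\operatorname{Hom}_{B_E}(Q,W),\ q\in Q).$$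
   Context: Let $G$ be a group with identity $1$ acting on the left on a nonempty set $E$, $(g,\alpha)\mapsto g\bullet\alpha$. The associated generalized digroup is $D=G\times E$ with operations $(g,\alpha)\vdash(h,\beta)=(gh,g\bullet\beta)$, $(g,\alpha)\dashv(h,\beta)=(gh,\alpha)$ and halo $\overline{E}=\{(1,\alpha)\mid\alpha\in E\}$. (Every generalized digroup is isomorphic to one of this form.) A representation of $D$ over $\mathbb{K}$ is a triple $(V,\lambda,\rho)$ where $V$ is a $\mathbb{K}$-vector space and $\lambda:D\to\operatorname{End}(V)$, $\rho:D\to\operatorname{Aut}(V)$ are maps such that for all $x,y\in D$ and $e\in\overline{E}$: $\lambda_{x\dashv y}=\lambda_x\lambda_y$, $\rho_{x\vdash y}=\rho_x\rho_y$, $\rho_e=\mathrm{id}_V$, $\rho_x\lambda_y=\lambda_{x\vdash y}$, $\lambda_x\rho_y=\lambda_{x\dashv y}$. A morphism of representations is a $\mathbb{K}$-linear map commuting with all $\lambda_x$ and $\rho_x$. These form the category $\mathsf{Rep}(D)$, which is abelian with enough injectives. For any representation, $\rho_{(g,\alpha)}$ depends only on $g$, is written $\rho_g$, and $g\mapsto\rho_g$ is a representation of $G$. The halo algebra $B_E$ is the unital associative $\mathbb{K}$-algebra generated by symbols $\varepsilon_\alpha$ ($\alpha\in E$) subject to $\varepsilon_\alpha\varepsilon_\beta=\varepsilon_\alpha$ for all $\alpha,\beta\in E$. Every representation $(V,\lambda,\rho)$ of $D$ is a left $B_E$-module via $\varepsilon_\alpha\cdot v=\lambda_{(1,\alpha)}(v)$.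 The functor $\mathcal{F}$ sends $W$ to $\operatorname{Hom}_{B_E}(Q,W)$ with the stated $G$-action; it is left exact. *)

theory Defs
  imports "HOL-Algebra.Module" "HOL-Algebra.AbelCoset" "HOL-Algebra.Group_Action"
begin

section \<open>Linear algebra over a field\<close>

text \<open>
  Vector spaces are modules in the sense of HOL-Algebra (their \<open>mult\<close> and \<open>one\<close> fields
  carry no information) over a ring \<open>K\<close> with \<open>field K\<close>.
\<close>

definition char_zero :: "('k, 'a) ring_scheme \<Rightarrow> bool" where
  "char_zero K \<longleftrightarrow> (\<forall>n::nat. n \<noteq> 0 \<longrightarrow> [n] \<cdot>\<^bsub>K\<^esub> \<one>\<^bsub>K\<^esub> \<noteq> \<zero>\<^bsub>K\<^esub>)"

definition lin_maps ::
    "('k, 'a) ring_scheme \<Rightarrow> ('k, 'm, 'b) module_scheme \<Rightarrow> ('k, 'n, 'c) module_scheme \<Rightarrow> ('m \<Rightarrow> 'n) set"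
  where
  "lin_maps K M N = {f \<in> carrier M \<rightarrow> carrier N.
     (\<forall>x\<in>carrier M. \<forall>y\<in>carrier M. f (x \<oplus>\<^bsub>M\<^esub> y) = f x \<oplus>\<^bsub>N\<^esub> f y) \<and>
     (\<forall>a\<in>carrier K. \<forall>x\<in>carrier M. f (a \<odot>\<^bsub>M\<^esub> x) = a \<odot>\<^bsub>N\<^esub> f x)}"

definition lin_iso ::
    "('k, 'a) ring_scheme \<Rightarrow> ('k, 'm, 'b) module_scheme \<Rightarrow> ('k, 'n, 'c) module_scheme \<Rightarrow> bool"
  where
  "lin_iso K M N \<longleftrightarrow> (\<exists>f\<in>lin_maps K M N. bij_betw f (carrier M) (carrier N))"

text \<open>
  The subquotient \<open>Z / B\<close> for submodules \<open>B \<subseteq> Z\<close> of \<open>M\<close>. Scaling is not the plain image of a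
  coset, because \<open>\<zero>\<close> has to send every coset to \<open>B\<close>.
\<close>

definition subquot :: "('k, 'm, 'b) module_scheme \<Rightarrow> 'm set \<Rightarrow> 'm set \<Rightarrow> ('k, 'm set) module" where
  "subquot M Z B = \<lparr>
     carrier = {B +>\<^bsub>M\<^esub> x | x. x \<in> Z},
     mult = undefined, one = undefined,
     zero = B,
     add = (\<lambda>X Y. X <+>\<^bsub>M\<^esub> Y),
     smult = (\<lambda>a X. \<Union>x\<in>X. B +>\<^bsub>M\<^esub> (a \<odot>\<^bsub>M\<^esub> x))\<rparr>"

definition fun_module :: "'x set \<Rightarrow> ('x \<Rightarrow> 'm) set \<Rightarrow> ('k, 'm, 'b) module_scheme \<Rightarrow> ('k, 'x \<Rightarrow> 'm) module"
  where
  "fun_module A S M = \<lparr>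
     carrier = S,
     mult = undefined, one = undefined,
     zero = (\<lambda>x\<in>A. \<zero>\<^bsub>M\<^esub>),
     add = (\<lambda>f g. \<lambda>x\<in>A. f x \<oplus>\<^bsub>M\<^esub> g x),
     smult = (\<lambda>a f. \<lambda>x\<in>A. a \<odot>\<^bsub>M\<^esub> f x)\<rparr>"


section \<open>Cochain complexes and cohomology\<close>

definition cocycles ::
    "(nat \<Rightarrow> ('k, 'm, 'b) module_scheme) \<Rightarrow> (nat \<Rightarrow> 'm \<Rightarrow> 'm) \<Rightarrow> nat \<Rightarrow> 'm set" where
  "cocycles C d n = a_kernel (C n) (C (Suc n)) (d n)"

definition coboundaries ::
    "(nat \<Rightarrow> ('k, 'm, 'b) module_scheme) \<Rightarrow> (nat \<Rightarrow> 'm \<Rightarrow> 'm) \<Rightarrow> nat \<Rightarrow> 'm set" where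
  "coboundaries C d n = (case n of 0 \<Rightarrow> {\<zero>\<^bsub>C 0\<^esub>} | Suc m \<Rightarrow> d m ` carrier (C m))"

definition cohomology ::
    "(nat \<Rightarrow> ('k, 'm, 'b) module_scheme) \<Rightarrow> (nat \<Rightarrow> 'm \<Rightarrow> 'm) \<Rightarrow> nat \<Rightarrow> ('k, 'm set) module" where
  "cohomology C d n = subquot (C n) (cocycles C d n) (coboundaries C d n)"

text \<open>\<open>K\<close>-vector spaces with a linear \<open>G\<close>-action, i.e. modules over the group algebra.\<close>

record ('k, 'm, 'g) gmodule = "('k, 'm) module" +
  gact :: "'g \<Rightarrow> 'm \<Rightarrow> 'm"

text \<open>
  Cohomology of a complex of \<open>G\<close>-modules, with the induced action \<open>g \<cdot> (x + B) = g \<cdot> x + B\<close>;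
  as \<open>g \<cdot> B = B\<close>, this is the image of the coset.
\<close>

definition gcohomology ::
    "(nat \<Rightarrow> ('k, 'm, 'g) gmodule) \<Rightarrow> (nat \<Rightarrow> 'm \<Rightarrow> 'm) \<Rightarrow> nat \<Rightarrow> ('k, 'm set, 'g) gmodule" where
  "gcohomology C d n =
     module.extend (cohomology C d n) (gmodule.fields (\<lambda>g X. gact (C n) g ` X))"


section \<open>Group cohomology\<close>

text \<open>
  \<open>H\<^sup>n(G, M)\<close> via inhomogeneous cochains; \<open>G\<^sup>n\<close> is the set of lists of length \<open>n\<close> over \<open>G\<close>, and
  \<open>(d f)(g\<^sub>1,\<dots>,g\<^sub>n\<^sub>+\<^sub>1) = g\<^sub>1 f(g\<^sub>2,\<dots>,g\<^sub>n\<^sub>+\<^sub>1) + \<Sum>\<^sub>i (-1)\<^sup>i f(\<dots>,g\<^sub>ig\<^sub>i\<^sub>+\<^sub>1,\<dots>) + (-1)\<^sup>n\<^sup>+\<^sup>1 f(g\<^sub>1,\<dots>,g\<^sub>n)\<close>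
  with \<open>1 \<le> i \<le> n\<close>. List positions start at \<open>0\<close>, so \<open>g\<^sub>i\<close> is \<open>gs ! (i - 1)\<close>.
\<close>

definition group_tuples :: "('g, 'c) monoid_scheme \<Rightarrow> nat \<Rightarrow> 'g list set" where
  "group_tuples G n = {gs. length gs = n \<and> set gs \<subseteq> carrier G}"

definition alt_sign :: "('m, 'b) ring_scheme \<Rightarrow> nat \<Rightarrow> 'm \<Rightarrow> 'm" where
  "alt_sign M i x = (if even i then x else \<ominus>\<^bsub>M\<^esub> x)"

definition group_cochains ::
    "('g, 'c) monoid_scheme \<Rightarrow> ('k, 'm, 'g) gmodule \<Rightarrow> nat \<Rightarrow> ('k, 'g list \<Rightarrow> 'm) module" where
  "group_cochains G M n =
     fun_module (group_tuples G n) (group_tuples G n \<rightarrow>\<^sub>E carrier M) M"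

definition group_coboundary ::
    "('g, 'c) monoid_scheme \<Rightarrow> ('k, 'm, 'g) gmodule \<Rightarrow> nat \<Rightarrow> ('g list \<Rightarrow> 'm) \<Rightarrow> 'g list \<Rightarrow> 'm" where
  "group_coboundary G M n f = (\<lambda>gs\<in>group_tuples G (Suc n).
     gact M (hd gs) (f (tl gs))
     \<oplus>\<^bsub>M\<^esub> (\<Oplus>\<^bsub>M\<^esub>i\<in>{1..n}. alt_sign M i
           (f (take (i - 1) gs @ [gs ! (i - 1) \<otimes>\<^bsub>G\<^esub> gs ! i] @ drop (i + 1) gs)))
     \<oplus>\<^bsub>M\<^esub> alt_sign M (Suc n) (f (butlast gs)))"

definition group_cohomology ::
    "('g, 'c) monoid_scheme \<Rightarrow> ('k, 'm, 'g) gmodule \<Rightarrow> nat \<Rightarrow> ('k, ('g list \<Rightarrow> 'm) set) module" where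
  "group_cohomology G M n = cohomology (group_cochains G M) (group_coboundary G M) n"


section \<open>Generalized digroups and their representations\<close>

record 'd digroup = "'d partial_object" +
  vdash :: "'d \<Rightarrow> 'd \<Rightarrow> 'd" (infixl \<open>\<turnstile>\<index>\<close> 70)
  dashv :: "'d \<Rightarrow> 'd \<Rightarrow> 'd" (infixl \<open>\<stileturn>\<index>\<close> 70)
  halo :: "'d set"

definition action_digroup ::
    "('g, 'c) monoid_scheme \<Rightarrow> 'e set \<Rightarrow> ('g \<Rightarrow> 'e \<Rightarrow> 'e) \<Rightarrow> ('g \<times> 'e) digroup" where
  "action_digroup G E \<phi> = \<lparr>
     carrier = carrier G \<times> E,
     vdash = (\<lambda>(g, \<alpha>) (h, \<beta>). (g \<otimes>\<^bsub>G\<^esub> h, \<phi> g \<beta>)),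
     dashv = (\<lambda>(g, \<alpha>) (h, \<beta>). (g \<otimes>\<^bsub>G\<^esub> h, \<alpha>)),
     halo = {\<one>\<^bsub>G\<^esub>} \<times> E\<rparr>"

text \<open>
  The maps \<open>\<lambda>\<close> and \<open>\<rho>\<close> are the fields \<open>lact\<close> and \<open>ract\<close>. The objects of \<open>Rep(D)\<close> are the
  representations whose underlying set is contained in a fixed type \<open>'v\<close>; this type plays the role
  of a set-theoretic universe. Injectivity is tested against the objects of this category.
\<close>

record ('k, 'v, 'd) rep = "('k, 'v) module" +
  lact :: "'d \<Rightarrow> 'v \<Rightarrow> 'v"
  ract :: "'d \<Rightarrow> 'v \<Rightarrow> 'v"

locale digroup_rep = module K V
  for K :: "('k, 'a) ring_scheme" and D :: "'d digroup" (structure) and V :: "('k, 'v, 'd) rep" +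
  assumes lact_End: "x \<in> carrier D \<Longrightarrow> lact V x \<in> lin_maps K V V"
    and ract_End: "x \<in> carrier D \<Longrightarrow> ract V x \<in> lin_maps K V V"
    and ract_bij: "x \<in> carrier D \<Longrightarrow> bij_betw (ract V x) (carrier V) (carrier V)"
    and lact_dashv: "\<lbrakk>x \<in> carrier D; y \<in> carrier D; v \<in> carrier V\<rbrakk>
          \<Longrightarrow> lact V (x \<stileturn> y) v = lact V x (lact V y v)"
    and ract_vdash: "\<lbrakk>x \<in> carrier D; y \<in> carrier D; v \<in> carrier V\<rbrakk>
          \<Longrightarrow> ract V (x \<turnstile> y) v = ract V x (ract V y v)"
    and ract_halo: "\<lbrakk>e \<in> halo D; v \<in> carrier V\<rbrakk> \<Longrightarrow> ract V e v = v"
    and ract_lact: "\<lbrakk>x \<in> carrier D; y \<in> carrier D; v \<in> carrier V\<rbrakk>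
          \<Longrightarrow> ract V x (lact V y v) = lact V (x \<turnstile> y) v"
    and lact_ract: "\<lbrakk>x \<in> carrier D; y \<in> carrier D; v \<in> carrier V\<rbrakk>
          \<Longrightarrow> lact V x (ract V y v) = lact V (x \<stileturn> y) v"

definition rep_hom ::
    "('k, 'a) ring_scheme \<Rightarrow> 'd digroup \<Rightarrow> ('k, 'v, 'd) rep \<Rightarrow> ('k, 'w, 'd) rep \<Rightarrow> ('v \<Rightarrow> 'w) set" where
  "rep_hom K D V W = {f \<in> lin_maps K V W. \<forall>x\<in>carrier D. \<forall>v\<in>carrier V.
     f (lact V x v) = lact W x (f v) \<and> f (ract V x v) = ract W x (f v)}"

text \<open>Elements of Hom spaces are extensional, so that each morphism is represented once.\<close>

definition rep_Hom ::
    "('k, 'a) ring_scheme \<Rightarrow> 'd digroup \<Rightarrow> ('k, 'v, 'd) rep \<Rightarrow> ('k, 'w, 'd) rep \<Rightarrow> ('k, 'v \<Rightarrow> 'w) module"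
  where
  "rep_Hom K D V W = fun_module (carrier V) (rep_hom K D V W \<inter> extensional (carrier V)) W"

text \<open>A morphism of \<open>Rep(D)\<close> is a monomorphism iff it is injective.\<close>

definition injective_rep :: "('k, 'a) ring_scheme \<Rightarrow> 'd digroup \<Rightarrow> ('k, 'v, 'd) rep \<Rightarrow> bool" where
  "injective_rep K D I \<longleftrightarrow> digroup_rep K D I \<and>
     (\<forall>(A :: ('k, 'v, 'd) rep) (B :: ('k, 'v, 'd) rep). \<forall>i\<in>rep_hom K D A B. \<forall>f\<in>rep_hom K D A I.
        digroup_rep K D A \<longrightarrow> digroup_rep K D B \<longrightarrow> inj_on i (carrier A) \<longrightarrow>
        (\<exists>h\<in>rep_hom K D B I. \<forall>x\<in>carrier A. h (i x) = f x))"

text \<open>An exact sequence \<open>0 \<rightarrow> W \<rightarrow> I 0 \<rightarrow> I 1 \<rightarrow> \<dots>\<close> with augmentation \<open>\<eta>\<close> and differentials \<open>\<delta>\<close>.\<close>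

locale injective_resolution =
  fixes K :: "('k, 'a) ring_scheme" and D :: "'d digroup" and W :: "('k, 'v, 'd) rep"
    and I :: "nat \<Rightarrow> ('k, 'v, 'd) rep" and \<delta> :: "nat \<Rightarrow> 'v \<Rightarrow> 'v" and \<eta> :: "'v \<Rightarrow> 'v"
  assumes injective: "injective_rep K D (I n)"
    and diff_hom: "\<delta> n \<in> rep_hom K D (I n) (I (Suc n))"
    and aug_hom: "\<eta> \<in> rep_hom K D W (I 0)"
    and aug_inj: "inj_on \<eta> (carrier W)"
    and exact_aug: "\<eta> ` carrier W = a_kernel (I 0) (I 1) (\<delta> 0)"
    and exact: "\<delta> n ` carrier (I n) = a_kernel (I (Suc n)) (I (Suc (Suc n))) (\<delta> (Suc n))"

text \<open>
  \<open>Ext\<^sup>n(Q, W)\<close> as the \<open>n\<close>-th right derived functor of \<open>Hom\<^sub>D(Q, -)\<close> at \<open>W\<close>, computed from an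
  injective resolution \<open>(I, \<delta>)\<close> of \<open>W\<close>.
\<close>

definition rep_Ext ::
    "('k, 'a) ring_scheme \<Rightarrow> 'd digroup \<Rightarrow> ('k, 'q, 'd) rep \<Rightarrow>
     (nat \<Rightarrow> ('k, 'v, 'd) rep) \<Rightarrow> (nat \<Rightarrow> 'v \<Rightarrow> 'v) \<Rightarrow> nat \<Rightarrow> ('k, ('q \<Rightarrow> 'v) set) module" where
  "rep_Ext K D Q I \<delta> n =
     cohomology (\<lambda>m. rep_Hom K D Q (I m)) (\<lambda>m. compose (carrier Q) (\<delta> m)) n"


section \<open>The halo algebra\<close>

text \<open>
  The unital associative algebra \<open>B\<^sub>E\<close> is given by its presentation: terms in the generators
  \<open>\<epsilon>\<^sub>\<alpha>\<close> modulo the congruence generated by the laws of unital associative \<open>K\<close>-algebras and the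
  relations \<open>\<epsilon>\<^sub>\<alpha> \<epsilon>\<^sub>\<beta> = \<epsilon>\<^sub>\<alpha>\<close>. The term \<open>Scal c\<close> stands for \<open>c\<close> times the unit.
\<close>

datatype ('k, 'e) halo_term =
    Scal 'k
  | Eps 'e
  | Plus "('k, 'e) halo_term" "('k, 'e) halo_term"
  | Times "('k, 'e) halo_term" "('k, 'e) halo_term"

inductive_set halo_terms :: "('k, 'a) ring_scheme \<Rightarrow> 'e set \<Rightarrow> ('k, 'e) halo_term set"
  for K :: "('k, 'a) ring_scheme" and E :: "'e set" where
    "c \<in> carrier K \<Longrightarrow> Scal c \<in> halo_terms K E"
  | "\<alpha> \<in> E \<Longrightarrow> Eps \<alpha> \<in> halo_terms K E"
  | "\<lbrakk>s \<in> halo_terms K E; t \<in> halo_terms K E\<rbrakk> \<Longrightarrow> Plus s t \<in> halo_terms K E"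
  | "\<lbrakk>s \<in> halo_terms K E; t \<in> halo_terms K E\<rbrakk> \<Longrightarrow> Times s t \<in> halo_terms K E"

inductive halo_eq ::
    "('k, 'a) ring_scheme \<Rightarrow> 'e set \<Rightarrow> ('k, 'e) halo_term \<Rightarrow> ('k, 'e) halo_term \<Rightarrow> bool"
  for K :: "('k, 'a) ring_scheme" and E :: "'e set" where
    refl: "t \<in> halo_terms K E \<Longrightarrow> halo_eq K E t t"
  | sym: "halo_eq K E s t \<Longrightarrow> halo_eq K E t s"
  | trans: "\<lbrakk>halo_eq K E s t; halo_eq K E t u\<rbrakk> \<Longrightarrow> halo_eq K E s u"
  | Plus_cong: "\<lbrakk>halo_eq K E s s'; halo_eq K E t t'\<rbrakk> \<Longrightarrow> halo_eq K E (Plus s t) (Plus s' t')"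
  | Times_cong: "\<lbrakk>halo_eq K E s s'; halo_eq K E t t'\<rbrakk> \<Longrightarrow> halo_eq K E (Times s t) (Times s' t')"
  | Plus_assoc: "\<lbrakk>s \<in> halo_terms K E; t \<in> halo_terms K E; u \<in> halo_terms K E\<rbrakk>
      \<Longrightarrow> halo_eq K E (Plus (Plus s t) u) (Plus s (Plus t u))"
  | Plus_comm: "\<lbrakk>s \<in> halo_terms K E; t \<in> halo_terms K E\<rbrakk> \<Longrightarrow> halo_eq K E (Plus s t) (Plus t s)"
  | Plus_zero: "t \<in> halo_terms K E \<Longrightarrow> halo_eq K E (Plus (Scal \<zero>\<^bsub>K\<^esub>) t) t"
  | Plus_neg: "t \<in> halo_terms K E
      \<Longrightarrow> halo_eq K E (Plus (Times (Scal (\<ominus>\<^bsub>K\<^esub> \<one>\<^bsub>K\<^esub>)) t) t) (Scal \<zero>\<^bsub>K\<^esub>)"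
  | Times_assoc: "\<lbrakk>s \<in> halo_terms K E; t \<in> halo_terms K E; u \<in> halo_terms K E\<rbrakk>
      \<Longrightarrow> halo_eq K E (Times (Times s t) u) (Times s (Times t u))"
  | one_Times: "t \<in> halo_terms K E \<Longrightarrow> halo_eq K E (Times (Scal \<one>\<^bsub>K\<^esub>) t) t"
  | Times_one: "t \<in> halo_terms K E \<Longrightarrow> halo_eq K E (Times t (Scal \<one>\<^bsub>K\<^esub>)) t"
  | distrib_left: "\<lbrakk>s \<in> halo_terms K E; t \<in> halo_terms K E; u \<in> halo_terms K E\<rbrakk>
      \<Longrightarrow> halo_eq K E (Times s (Plus t u)) (Plus (Times s t) (Times s u))"
  | distrib_right: "\<lbrakk>s \<in> halo_terms K E; t \<in> halo_terms K E; u \<in> halo_terms K E\<rbrakk>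
      \<Longrightarrow> halo_eq K E (Times (Plus s t) u) (Plus (Times s u) (Times t u))"
  | Scal_add: "\<lbrakk>a \<in> carrier K; b \<in> carrier K\<rbrakk>
      \<Longrightarrow> halo_eq K E (Scal (a \<oplus>\<^bsub>K\<^esub> b)) (Plus (Scal a) (Scal b))"
  | Scal_mult: "\<lbrakk>a \<in> carrier K; b \<in> carrier K\<rbrakk>
      \<Longrightarrow> halo_eq K E (Scal (a \<otimes>\<^bsub>K\<^esub> b)) (Times (Scal a) (Scal b))"
  | Scal_central: "\<lbrakk>a \<in> carrier K; t \<in> halo_terms K E\<rbrakk>
      \<Longrightarrow> halo_eq K E (Times (Scal a) t) (Times t (Scal a))"
  | Eps_Eps: "\<lbrakk>\<alpha> \<in> E; \<beta> \<in> E\<rbrakk> \<Longrightarrow> halo_eq K E (Times (Eps \<alpha>) (Eps \<beta>)) (Eps \<alpha>)"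

definition halo_class ::
    "('k, 'a) ring_scheme \<Rightarrow> 'e set \<Rightarrow> ('k, 'e) halo_term \<Rightarrow> ('k, 'e) halo_term set" where
  "halo_class K E t = {s. halo_eq K E t s}"

definition halo_algebra ::
    "('k, 'a) ring_scheme \<Rightarrow> 'e set \<Rightarrow> ('k, ('k, 'e) halo_term set) module" where
  "halo_algebra K E = \<lparr>
     carrier = halo_class K E ` halo_terms K E,
     mult = (\<lambda>X Y. \<Union>s\<in>X. \<Union>t\<in>Y. halo_class K E (Times s t)),
     one = halo_class K E (Scal \<one>\<^bsub>K\<^esub>),
     zero = halo_class K E (Scal \<zero>\<^bsub>K\<^esub>),
     add = (\<lambda>X Y. \<Union>s\<in>X. \<Union>t\<in>Y. halo_class K E (Plus s t)),
     smult = (\<lambda>c X. \<Union>t\<in>X. halo_class K E (Times (Scal c) t))\<rparr>"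

primrec halo_term_act ::
    "('g, 'c) monoid_scheme \<Rightarrow> ('k, 'v, 'g \<times> 'e) rep \<Rightarrow> ('k, 'e) halo_term \<Rightarrow> 'v \<Rightarrow> 'v" where
  "halo_term_act G V (Scal c) v = c \<odot>\<^bsub>V\<^esub> v"
| "halo_term_act G V (Eps \<alpha>) v = lact V (\<one>\<^bsub>G\<^esub>, \<alpha>) v"
| "halo_term_act G V (Plus s t) v = halo_term_act G V s v \<oplus>\<^bsub>V\<^esub> halo_term_act G V t v"
| "halo_term_act G V (Times s t) v = halo_term_act G V s (halo_term_act G V t v)"

text \<open>
  The \<open>B\<^sub>E\<close>-module structure with \<open>\<epsilon>\<^sub>\<alpha> \<cdot> v = \<lambda>\<^bsub>(1,\<alpha>)\<^esub>(v)\<close>; for a representation \<open>V\<close> the value does not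
  depend on the chosen representative of the class.
\<close>

definition halo_act ::
    "('g, 'c) monoid_scheme \<Rightarrow> ('k, 'v, 'g \<times> 'e) rep \<Rightarrow> ('k, 'e) halo_term set \<Rightarrow> 'v \<Rightarrow> 'v" where
  "halo_act G V b v = halo_term_act G V (SOME t. t \<in> b) v"

definition halo_hom ::
    "('k, 'a) ring_scheme \<Rightarrow> ('g, 'c) monoid_scheme \<Rightarrow> 'e set \<Rightarrow>
     ('k, 'v, 'g \<times> 'e) rep \<Rightarrow> ('k, 'w, 'g \<times> 'e) rep \<Rightarrow> ('v \<Rightarrow> 'w) set" where
  "halo_hom K G E V W = {f \<in> carrier V \<rightarrow>\<^sub>E carrier W.
     (\<forall>x\<in>carrier V. \<forall>y\<in>carrier V. f (x \<oplus>\<^bsub>V\<^esub> y) = f x \<oplus>\<^bsub>W\<^esub> f y) \<and>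
     (\<forall>b\<in>carrier (halo_algebra K E). \<forall>x\<in>carrier V. f (halo_act G V b x) = halo_act G W b (f x))}"


section \<open>The functor \<open>Hom\<^bsub>B\<^esub>(Q, -)\<close> and its right derived functors\<close>

text \<open>\<open>\<rho>\<^bsub>(g,\<alpha>)\<^esub>\<close> does not depend on \<open>\<alpha> \<in> E\<close>.\<close>

definition rho :: "'e set \<Rightarrow> ('k, 'v, 'g \<times> 'e) rep \<Rightarrow> 'g \<Rightarrow> 'v \<Rightarrow> 'v" where
  "rho E V g = ract V (g, SOME \<alpha>. \<alpha> \<in> E)"

definition halo_Hom ::
    "('k, 'a) ring_scheme \<Rightarrow> ('g, 'c) monoid_scheme \<Rightarrow> 'e set \<Rightarrow>
     ('k, 'q, 'g \<times> 'e) rep \<Rightarrow> ('k, 'w, 'g \<times> 'e) rep \<Rightarrow> ('k, 'q \<Rightarrow> 'w, 'g) gmodule" where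
  "halo_Hom K G E Q W =
     module.extend (fun_module (carrier Q) (halo_hom K G E Q W) W)
       (gmodule.fields (\<lambda>g f. \<lambda>q\<in>carrier Q. rho E W g (f (inv_into (carrier Q) (rho E Q g) q))))"

text \<open>\<open>R\<^sup>n Hom\<^bsub>B\<^esub>(Q, -)\<close> at \<open>W\<close>, computed from an injective resolution \<open>(I, \<delta>)\<close> of \<open>W\<close> in \<open>Rep(D)\<close>.\<close>

definition derived_halo_Hom ::
    "('k, 'a) ring_scheme \<Rightarrow> ('g, 'c) monoid_scheme \<Rightarrow> 'e set \<Rightarrow> ('k, 'q, 'g \<times> 'e) rep \<Rightarrow>
     (nat \<Rightarrow> ('k, 'v, 'g \<times> 'e) rep) \<Rightarrow> (nat \<Rightarrow> 'v \<Rightarrow> 'v) \<Rightarrow> nat \<Rightarrow> ('k, ('q \<Rightarrow> 'v) set, 'g) gmodule"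
  where
  "derived_halo_Hom K G E Q I \<delta> n =
     gcohomology (\<lambda>m. halo_Hom K G E Q (I m)) (\<lambda>m. compose (carrier Q) (\<delta> m)) n"


section \<open>First-quadrant spectral sequences\<close>

locale first_quadrant_ss =
  fixes K :: "('k, 'a) ring_scheme"
    and E :: "nat \<Rightarrow> int \<Rightarrow> int \<Rightarrow> ('k, 'x) module"
    and d :: "nat \<Rightarrow> int \<Rightarrow> int \<Rightarrow> 'x \<Rightarrow> 'x"
  assumes page_module: "2 \<le> r \<Longrightarrow> module K (E r p q)"
    and first_quadrant: "\<lbrakk>2 \<le> r; p < 0 \<or> q < 0\<rbrakk> \<Longrightarrow> carrier (E r p q) = {\<zero>\<^bsub>E r p q\<^esub>}"
    and diff_linear: "2 \<le> r \<Longrightarrow> d r p q \<in> lin_maps K (E r p q) (E r (p + int r) (q - int r + 1))"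
    and diff_diff: "\<lbrakk>2 \<le> r; x \<in> carrier (E r p q)\<rbrakk>
      \<Longrightarrow> d r (p + int r) (q - int r + 1) (d r p q x)
          = \<zero>\<^bsub>E r (p + int r + int r) (q - int r + 1 - int r + 1)\<^esub>"
    and next_page: "2 \<le> r \<Longrightarrow> lin_iso K (E (Suc r) p q)
      (subquot (E r p q)
        (a_kernel (E r p q) (E r (p + int r) (q - int r + 1)) (d r p q))
        (d r (p - int r) (q + int r - 1) ` carrier (E r (p - int r) (q + int r - 1))))"

text \<open>
  Convergence to the graded object \<open>H\<close>: a finite decreasing filtration on each \<open>H n\<close> whose graded
  pieces are the terms \<open>E\<^sub>\<infinity>\<close>. In the first quadrant no non-zero differential enters or leaves
  position \<open>(p, q)\<close> on page \<open>r\<close> once \<open>r > p\<close> and \<open>r > q + 1\<close>, so \<open>E\<^sub>\<infinity>\<close> is \<open>E\<^sub>r\<close> for any such \<open>r\<close>.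
\<close>

definition ss_converges ::
    "('k, 'a) ring_scheme \<Rightarrow> (nat \<Rightarrow> int \<Rightarrow> int \<Rightarrow> ('k, 'x) module) \<Rightarrow>
     (nat \<Rightarrow> ('k, 'h) module) \<Rightarrow> bool" where
  "ss_converges K E H \<longleftrightarrow> (\<exists>F :: nat \<Rightarrow> nat \<Rightarrow> 'h set.
     (\<forall>n p. submodule (F n p) K (H n) \<and> F n (Suc p) \<subseteq> F n p) \<and>
     (\<forall>n. F n 0 = carrier (H n) \<and> F n (Suc n) = {\<zero>\<^bsub>H n\<^esub>}) \<and>
     (\<forall>p q r. max p (q + 1) < r \<longrightarrow>
        lin_iso K (E r (int p) (int q)) (subquot (H (p + q)) (F (p + q) p) (F (p + q) (Suc p)))))"

end

theory Submission
  imports Defs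
begin

text \<open>
  The idea is Maschke's averaging argument. As \<open>G\<close> is finite and \<open>K\<close> has characteristic \<open>0\<close>, the
  order of \<open>G\<close> is invertible in \<open>K\<close>, so elements of a module over \<open>K\<close> can be averaged over \<open>G\<close>. This has
  two consequences for a \<open>K\<close>-linear action of \<open>G\<close>.

  First, averaging a cocycle over its last argument exhibits it as a coboundary, so \<open>H\<^sup>p(G, M) = 0\<close> for
  \<open>p > 0\<close> (\<open>cocycle_is_coboundary\<close>). In the second page \<open>H\<^sup>p(G, R\<^sup>qF(W))\<close>, with
  \<open>F = Hom\<^bsub>B\<^esub>(Q, -)\<close>, only the column \<open>p = 0\<close> survives. The required spectral sequence is therefore the stationary one, all of whose pages equal the
  second page and all of whose differentials are zero; the filtration of \<open>Ext\<^sup>n\<close> has a single step.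
  Convergence amounts to isomorphisms \<open>H\<^sup>0(G, R\<^sup>qF(W)) \<cong> Ext\<^sup>q(Q, W)\<close>.

  Second, taking fixed points commutes with cohomology: \<open>H\<^sup>q(C\<^sup>G) \<cong> H\<^sup>q(C)\<^sup>G\<close> for every complex \<open>C\<close> with
  an equivariant differential (\<open>lin_iso_cohomology_fixed_points\<close>). This is applied to
  \<open>C = Hom\<^bsub>B\<^esub>(Q, I)\<close> for an injective resolution \<open>I\<close> of \<open>W\<close>. A \<open>B\<^sub>E\<close>-linear map is fixed by \<open>G\<close> exactly if
  it commutes with all \<open>\<rho>\<^sub>g\<close>, that is, if it is a morphism of representations
  (\<open>fixed_points_halo_Hom\<close>). Hence \<open>C\<^sup>G = Hom\<^sub>D(Q, I)\<close>, whose cohomology is \<open>Ext(Q, W)\<close>.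

  Finally, the derived functors and \<open>Ext\<close> are computed from two different resolutions \<open>I\<close> and \<open>J\<close>, so
  the comparison theorem for injective resolutions is needed as well (\<open>rep_Ext_independent\<close>).
\<close>

section \<open>Linear maps\<close>

lemma (in abelian_group) minus_eq_zero_iff:
  "\<lbrakk>x \<in> carrier G; y \<in> carrier G\<rbrakk> \<Longrightarrow> x \<ominus> y = \<zero> \<longleftrightarrow> x = y"
  by (metis a_minus_def r_neg minus_equality minus_minus a_inv_closed)

lemma (in abelian_group) minus_zero_right: "x \<in> carrier G \<Longrightarrow> x \<ominus> \<zero> = x"
  by (metis a_minus_def r_zero l_zero minus_equality zero_closed)

lemma lin_mapsI:
  assumes "\<And>x. x \<in> carrier M \<Longrightarrow> f x \<in> carrier N"
    and "\<And>x y. \<lbrakk>x \<in> carrier M; y \<in> carrier M\<rbrakk> \<Longrightarrow> f (x \<oplus>\<^bsub>M\<^esub> y) = f x \<oplus>\<^bsub>N\<^esub> f y"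
    and "\<And>a x. \<lbrakk>a \<in> carrier K; x \<in> carrier M\<rbrakk> \<Longrightarrow> f (a \<odot>\<^bsub>M\<^esub> x) = a \<odot>\<^bsub>N\<^esub> f x"
  shows "f \<in> lin_maps K M N"
  using assms by (auto simp: lin_maps_def)

lemma lin_maps_closed: "\<lbrakk>f \<in> lin_maps K M N; x \<in> carrier M\<rbrakk> \<Longrightarrow> f x \<in> carrier N"
  and lin_maps_add:
    "\<lbrakk>f \<in> lin_maps K M N; x \<in> carrier M; y \<in> carrier M\<rbrakk> \<Longrightarrow> f (x \<oplus>\<^bsub>M\<^esub> y) = f x \<oplus>\<^bsub>N\<^esub> f y"
  and lin_maps_smult:
    "\<lbrakk>f \<in> lin_maps K M N; a \<in> carrier K; x \<in> carrier M\<rbrakk> \<Longrightarrow> f (a \<odot>\<^bsub>M\<^esub> x) = a \<odot>\<^bsub>N\<^esub> f x"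
  by (auto simp: lin_maps_def)

lemma lin_maps_compose:
  assumes "f \<in> lin_maps K L M" "g \<in> lin_maps K M N"
  shows "(\<lambda>x. g (f x)) \<in> lin_maps K L N"
  using assms by (auto simp: lin_maps_def Pi_iff)

context
  fixes K :: "('k, 'a) ring_scheme" and M :: "('k, 'm, 'b) module_scheme"
    and N :: "('k, 'n, 'c) module_scheme" and f :: "'m \<Rightarrow> 'n"
  assumes f: "f \<in> lin_maps K M N" and M: "module K M" and N: "module K N"
begin

interpretation M: module K M by (rule M)
interpretation N: module K N by (rule N)

lemma lin_maps_zero: "f \<zero>\<^bsub>M\<^esub> = \<zero>\<^bsub>N\<^esub>"
  using lin_maps_smult[OF f, of "\<zero>\<^bsub>K\<^esub>" "\<zero>\<^bsub>M\<^esub>"] lin_maps_closed[OF f, of "\<zero>\<^bsub>M\<^esub>"]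
  by simp

lemma lin_maps_neg: "x \<in> carrier M \<Longrightarrow> f (\<ominus>\<^bsub>M\<^esub> x) = \<ominus>\<^bsub>N\<^esub> f x"
  using lin_maps_smult[OF f, of "\<ominus>\<^bsub>K\<^esub> \<one>\<^bsub>K\<^esub>" x] lin_maps_closed[OF f, of x]
  by (simp add: M.smult_l_minus N.smult_l_minus)

lemma lin_maps_minus:
  "\<lbrakk>x \<in> carrier M; y \<in> carrier M\<rbrakk> \<Longrightarrow> f (x \<ominus>\<^bsub>M\<^esub> y) = f x \<ominus>\<^bsub>N\<^esub> f y"
  by (simp add: a_minus_def lin_maps_add[OF f] lin_maps_neg)

lemma lin_maps_finsum:
  assumes "finite A" "h \<in> A \<rightarrow> carrier M"
  shows "f (\<Oplus>\<^bsub>M\<^esub>i\<in>A. h i) = (\<Oplus>\<^bsub>N\<^esub>i\<in>A. f (h i))"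
  using assms
proof (induction A rule: finite_induct)
  case empty
  then show ?case by (simp add: lin_maps_zero)
next
  case (insert i A)
  have "h \<in> A \<rightarrow> carrier M" "h i \<in> carrier M" "(\<lambda>i. f (h i)) \<in> A \<rightarrow> carrier N" "f (h i) \<in> carrier N"
    using insert.prems lin_maps_closed[OF f] by auto
  then show ?case
    using insert by (simp add: lin_maps_add[OF f])
qed

lemma mem_kernel_iff: "x \<in> a_kernel M N f \<longleftrightarrow> x \<in> carrier M \<and> f x = \<zero>\<^bsub>N\<^esub>"
  by (simp add: a_kernel_def')

lemma submodule_kernel: "submodule (a_kernel M N f) K M"
  by (rule M.submoduleI)
     (auto simp: mem_kernel_iff lin_maps_zero lin_maps_neg lin_maps_add[OF f] lin_maps_smult[OF f])

lemma submodule_image: "submodule (f ` carrier M) K N"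
proof (rule N.submoduleI)
  show "f ` carrier M \<subseteq> carrier N" using lin_maps_closed[OF f] by auto
  show "\<zero>\<^bsub>N\<^esub> \<in> f ` carrier M" using lin_maps_zero[symmetric] by (rule image_eqI) simp
  show "\<ominus>\<^bsub>N\<^esub> y \<in> f ` carrier M" if "y \<in> f ` carrier M" for y
    using that by (auto simp: lin_maps_neg[symmetric])
  show "y \<oplus>\<^bsub>N\<^esub> z \<in> f ` carrier M" if "y \<in> f ` carrier M" "z \<in> f ` carrier M" for y z
    using that by (auto simp: lin_maps_add[OF f, symmetric])
  show "a \<odot>\<^bsub>N\<^esub> y \<in> f ` carrier M" if "a \<in> carrier K" "y \<in> f ` carrier M" for a y
    using that by (auto simp: lin_maps_smult[OF f, symmetric])
qed

end

lemma lin_maps_pointwise_minus: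
  assumes f: "f \<in> lin_maps K M N" and g: "g \<in> lin_maps K M N" and N: "module K N"
  shows "(\<lambda>x. f x \<ominus>\<^bsub>N\<^esub> g x) \<in> lin_maps K M N"
proof -
  interpret module K N by (rule N)
  show ?thesis
    by (rule lin_mapsI)
       (auto simp: lin_maps_closed[OF f] lin_maps_closed[OF g] lin_maps_add[OF f] lin_maps_add[OF g]
          lin_maps_smult[OF f] lin_maps_smult[OF g] a_minus_def minus_add a_ac smult_r_distr smult_r_minus)
qed

lemma lin_maps_pointwise_add:
  assumes f: "f \<in> lin_maps K M N" and g: "g \<in> lin_maps K M N" and N: "module K N"
  shows "(\<lambda>x. f x \<oplus>\<^bsub>N\<^esub> g x) \<in> lin_maps K M N"
proof -
  interpret module K N by (rule N)
  show ?thesis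
    by (rule lin_mapsI)
       (auto simp: lin_maps_closed[OF f] lin_maps_closed[OF g] lin_maps_add[OF f] lin_maps_add[OF g]
          lin_maps_smult[OF f] lin_maps_smult[OF g] M.a_ac smult_r_distr)
qed

lemma lin_maps_pointwise_finsum:
  assumes f: "\<And>i. i \<in> A \<Longrightarrow> f i \<in> lin_maps K M N" and A: "finite A" and N: "module K N"
  shows "(\<lambda>x. \<Oplus>\<^bsub>N\<^esub>i\<in>A. f i x) \<in> lin_maps K M N"
proof -
  interpret module K N by (rule N)
  have c: "(\<lambda>i. f i x) \<in> A \<rightarrow> carrier N" if "x \<in> carrier M" for x
    using lin_maps_closed[OF f] that by auto
  show ?thesis
  proof (rule lin_mapsI)
    show "(\<Oplus>\<^bsub>N\<^esub>i\<in>A. f i x) \<in> carrier N" if "x \<in> carrier M" for x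
      using c[OF that] by (rule M.finsum_closed)
    show "(\<Oplus>\<^bsub>N\<^esub>i\<in>A. f i (x \<oplus>\<^bsub>M\<^esub> y)) = (\<Oplus>\<^bsub>N\<^esub>i\<in>A. f i x) \<oplus>\<^bsub>N\<^esub> (\<Oplus>\<^bsub>N\<^esub>i\<in>A. f i y)"
      if "x \<in> carrier M" "y \<in> carrier M" for x y
      unfolding M.finsum_addf[OF c[OF that(1)] c[OF that(2)], symmetric]
      using lin_maps_closed[OF f] that by (intro M.finsum_cong') (auto simp: lin_maps_add[OF f])
    show "(\<Oplus>\<^bsub>N\<^esub>i\<in>A. f i (a \<odot>\<^bsub>M\<^esub> x)) = a \<odot>\<^bsub>N\<^esub> (\<Oplus>\<^bsub>N\<^esub>i\<in>A. f i x)"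
      if "a \<in> carrier K" "x \<in> carrier M" for a x
      using c that A
      by (subst finsum_smult_ldistr) (auto intro!: M.finsum_cong' lin_maps_smult[OF f])
  qed
qed

lemma lin_maps_alt_sign:
  assumes f: "f \<in> lin_maps K M N" and "module K M" "module K N" "x \<in> carrier M"
  shows "f (alt_sign M i x) = alt_sign N i (f x)"
  using assms by (simp add: alt_sign_def lin_maps_neg)

context module
begin

lemma alt_sign_linear: "alt_sign M i \<in> lin_maps R M M"
  by (rule lin_mapsI) (auto simp: alt_sign_def M.minus_add M.a_comm smult_r_minus)

lemma alt_sign_closed: "x \<in> carrier M \<Longrightarrow> alt_sign M i x \<in> carrier M"
  by (simp add: alt_sign_def)

lemma alt_sign_involutive: "x \<in> carrier M \<Longrightarrow> alt_sign M i (alt_sign M i x) = x"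
  by (simp add: alt_sign_def)

end

section \<open>Submodules and subquotients\<close>

context module
begin

lemma submodule_zero: "submodule H R M \<Longrightarrow> \<zero>\<^bsub>M\<^esub> \<in> H"
  using submoduleE(2)[of H] submoduleE(3)[of H] submoduleE(5)[of H] submoduleE(1)[of H]
  by (metis M.r_neg ex_in_conv subsetD)

lemma submodule_minus: "\<lbrakk>submodule H R M; x \<in> H; y \<in> H\<rbrakk> \<Longrightarrow> x \<ominus>\<^bsub>M\<^esub> y \<in> H"
  unfolding a_minus_def by (intro submoduleE(5) submoduleE(3))

lemma submodule_finsum:
  assumes H: "submodule H R M" and "finite A" "h \<in> A \<rightarrow> H"
  shows "(\<Oplus>\<^bsub>M\<^esub>i\<in>A. h i) \<in> H"
  using assms(2,3)
proof (induction A rule: finite_induct)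
  case empty
  then show ?case by (simp add: submodule_zero[OF H])
next
  case (insert i A)
  then have "h \<in> A \<rightarrow> carrier M" "h i \<in> carrier M"
    using submoduleE(1)[OF H] by auto
  then show ?case
    using insert submoduleE(5)[OF H] by simp
qed

lemma trivial_submodule: "submodule {\<zero>\<^bsub>M\<^esub>} R M"
  by (rule submoduleI) auto

lemma finsum_const_smult:
  assumes "finite A" "x \<in> carrier M"
  shows "(\<Oplus>\<^bsub>M\<^esub>i\<in>A. x) = ([card A] \<cdot> \<one>) \<odot>\<^bsub>M\<^esub> x"
  using assms(1)
proof (induction A rule: finite_induct)
  case empty
  then show ?case using assms(2) by simp
next
  case (insert i A)
  then show ?case
    using assms(2) by (simp add: smult_l_distr M.a_comm)
qed

lemma abelian_subgroup_submodule: "submodule B R M \<Longrightarrow> abelian_subgroup B M"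
  by (rule abelian_subgroupI3)
     (auto simp: additive_subgroup_def submodule.axioms M.abelian_group_axioms)

lemma coset_eq_iff:
  assumes B: "submodule B R M" and x: "x \<in> carrier M" and y: "y \<in> carrier M"
  shows "B +>\<^bsub>M\<^esub> x = B +>\<^bsub>M\<^esub> y \<longleftrightarrow> x \<ominus>\<^bsub>M\<^esub> y \<in> B"
proof -
  interpret B: abelian_subgroup B M by (rule abelian_subgroup_submodule[OF B])
  have "x \<ominus>\<^bsub>M\<^esub> y \<in> B \<longleftrightarrow> x \<in> B +>\<^bsub>M\<^esub> y"
    using B.a_rcos_module[of y x] x y by (simp add: a_minus_def)
  also have "\<dots> \<longleftrightarrow> B +>\<^bsub>M\<^esub> x = B +>\<^bsub>M\<^esub> y"
    using B.a_repr_independence'[of x y] B.a_rcos_self[of x] x y by metis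
  finally show ?thesis by simp
qed

lemma mem_coset_iff:
  assumes B: "submodule B R M" and x: "x \<in> carrier M"
  shows "y \<in> B +>\<^bsub>M\<^esub> x \<longleftrightarrow> y \<in> carrier M \<and> y \<ominus>\<^bsub>M\<^esub> x \<in> B"
proof -
  interpret B: abelian_subgroup B M by (rule abelian_subgroup_submodule[OF B])
  show ?thesis
    using B.a_rcos_module[of x y] x B.a_elemrcos_carrier[of x y]
    by (auto simp: a_minus_def)
qed

lemma coset_eq_zero_iff:
  assumes B: "submodule B R M" and x: "x \<in> carrier M"
  shows "B +>\<^bsub>M\<^esub> x = B \<longleftrightarrow> x \<in> B"
proof -
  have "B +>\<^bsub>M\<^esub> \<zero>\<^bsub>M\<^esub> = B"
    using submoduleE(1)[OF B] by (rule M.a_coset_add_zero)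
  with coset_eq_iff[OF B x M.zero_closed] x show ?thesis by (simp add: M.minus_zero_right)
qed

lemma coset_add:
  assumes B: "submodule B R M" and "x \<in> carrier M" "y \<in> carrier M"
  shows "(B +>\<^bsub>M\<^esub> x) <+>\<^bsub>M\<^esub> (B +>\<^bsub>M\<^esub> y) = B +>\<^bsub>M\<^esub> (x \<oplus>\<^bsub>M\<^esub> y)"
  using abelian_subgroup.a_rcos_sum[OF abelian_subgroup_submodule[OF B]] assms by simp

lemma coset_smult:
  assumes B: "submodule B R M" and a: "a \<in> carrier R" and x: "x \<in> carrier M"
  shows "(\<Union>y\<in>B +>\<^bsub>M\<^esub> x. B +>\<^bsub>M\<^esub> (a \<odot>\<^bsub>M\<^esub> y)) = B +>\<^bsub>M\<^esub> (a \<odot>\<^bsub>M\<^esub> x)"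
proof -
  have "B +>\<^bsub>M\<^esub> (a \<odot>\<^bsub>M\<^esub> y) = B +>\<^bsub>M\<^esub> (a \<odot>\<^bsub>M\<^esub> x)" if "y \<in> B +>\<^bsub>M\<^esub> x" for y
  proof -
    from that have y: "y \<in> carrier M" "y \<ominus>\<^bsub>M\<^esub> x \<in> B"
      by (simp_all add: mem_coset_iff[OF B x])
    then have "a \<odot>\<^bsub>M\<^esub> (y \<ominus>\<^bsub>M\<^esub> x) \<in> B"
      using submoduleE(4)[OF B] a by blast
    then show ?thesis
      using a x y by (simp add: coset_eq_iff[OF B] a_minus_def smult_r_distr smult_r_minus)
  qed
  moreover have "x \<in> B +>\<^bsub>M\<^esub> x"
    using x submodule_zero[OF B] by (simp add: mem_coset_iff[OF B x] a_minus_def M.r_neg)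
  ultimately show ?thesis by blast
qed

lemma subquot_simps:
  shows "carrier (subquot M Z B) = (\<lambda>x. B +>\<^bsub>M\<^esub> x) ` Z"
    and "\<zero>\<^bsub>subquot M Z B\<^esub> = B"
    and "\<lbrakk>submodule B R M; x \<in> carrier M; y \<in> carrier M\<rbrakk>
      \<Longrightarrow> (B +>\<^bsub>M\<^esub> x) \<oplus>\<^bsub>subquot M Z B\<^esub> (B +>\<^bsub>M\<^esub> y) = B +>\<^bsub>M\<^esub> (x \<oplus>\<^bsub>M\<^esub> y)"
    and "\<lbrakk>submodule B R M; a \<in> carrier R; x \<in> carrier M\<rbrakk>
      \<Longrightarrow> a \<odot>\<^bsub>subquot M Z B\<^esub> (B +>\<^bsub>M\<^esub> x) = B +>\<^bsub>M\<^esub> (a \<odot>\<^bsub>M\<^esub> x)"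
  by (auto simp: subquot_def coset_add coset_smult)

text \<open>
  For arbitrary submodules \<open>B\<close> and \<open>Z\<close>, the cosets of \<open>B\<close> with a representative in \<open>Z\<close> form the module
  \<open>(Z + B) / B\<close>.
\<close>

lemma module_subquot:
  assumes Z: "submodule Z R M" and B: "submodule B R M"
  shows "module R (subquot M Z B)"
proof -
  let ?S = "subquot M Z B"
  have Zc: "x \<in> carrier M" if "x \<in> Z" for x using that submoduleE(1)[OF Z] by auto
  note s = subquot_simps(1,2) subquot_simps(3,4)[OF B]
  have zero: "B = B +>\<^bsub>M\<^esub> \<zero>\<^bsub>M\<^esub>"
    using coset_eq_zero_iff[OF B M.zero_closed] submodule_zero[OF B] by simp
  show ?thesis
  proof (intro moduleI abelian_groupI)
    show "cring R" by (rule R.cring_axioms)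
    show "\<zero>\<^bsub>?S\<^esub> \<in> carrier ?S"
      unfolding s using submodule_zero[OF Z] zero by (rule rev_image_eqI)
    fix X assume "X \<in> carrier ?S"
    then obtain x where x: "X = B +>\<^bsub>M\<^esub> x" "x \<in> Z" by (auto simp: s)
    show "\<zero>\<^bsub>?S\<^esub> \<oplus>\<^bsub>?S\<^esub> X = X"
      using s(3)[of "\<zero>\<^bsub>M\<^esub>" x] x(2) Zc zero by (simp add: s(2) x(1))
    show "\<one> \<odot>\<^bsub>?S\<^esub> X = X"
      using x Zc by (simp add: s(4))
    show "\<exists>Y\<in>carrier ?S. Y \<oplus>\<^bsub>?S\<^esub> X = \<zero>\<^bsub>?S\<^esub>"
    proof
      show "B +>\<^bsub>M\<^esub> (\<ominus>\<^bsub>M\<^esub> x) \<in> carrier ?S"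
        using submoduleE(3)[OF Z x(2)] by (auto simp: s)
      show "(B +>\<^bsub>M\<^esub> (\<ominus>\<^bsub>M\<^esub> x)) \<oplus>\<^bsub>?S\<^esub> X = \<zero>\<^bsub>?S\<^esub>"
        using x Zc zero by (simp add: s(2,3) M.l_neg)
    qed
    fix a assume a: "a \<in> carrier R"
    show "a \<odot>\<^bsub>?S\<^esub> X \<in> carrier ?S"
      using x a Zc submoduleE(4)[OF Z] by (simp add: s(4)) (simp add: s(1))
    { fix b assume b: "b \<in> carrier R"
      show "(a \<oplus> b) \<odot>\<^bsub>?S\<^esub> X = a \<odot>\<^bsub>?S\<^esub> X \<oplus>\<^bsub>?S\<^esub> b \<odot>\<^bsub>?S\<^esub> X"
        using x a b Zc by (simp add: s(3,4) smult_l_distr)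
      show "(a \<otimes> b) \<odot>\<^bsub>?S\<^esub> X = a \<odot>\<^bsub>?S\<^esub> (b \<odot>\<^bsub>?S\<^esub> X)"
        using x a b Zc by (simp add: s(4) smult_assoc1) }
    fix Y assume "Y \<in> carrier ?S"
    then obtain y where y: "Y = B +>\<^bsub>M\<^esub> y" "y \<in> Z" by (auto simp: s)
    show "a \<odot>\<^bsub>?S\<^esub> (X \<oplus>\<^bsub>?S\<^esub> Y) = a \<odot>\<^bsub>?S\<^esub> X \<oplus>\<^bsub>?S\<^esub> a \<odot>\<^bsub>?S\<^esub> Y"
      using x y a Zc by (simp add: s(3,4) smult_r_distr)
  next
    fix X Y assume "X \<in> carrier ?S" "Y \<in> carrier ?S"
    then obtain x y where x: "X = B +>\<^bsub>M\<^esub> x" "x \<in> Z" and y: "Y = B +>\<^bsub>M\<^esub> y" "y \<in> Z"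
      by (auto simp: s)
    show "X \<oplus>\<^bsub>?S\<^esub> Y \<in> carrier ?S"
      using x y Zc submoduleE(5)[OF Z] by (simp add: s(3)) (simp add: s(1))
    show "X \<oplus>\<^bsub>?S\<^esub> Y = Y \<oplus>\<^bsub>?S\<^esub> X"
      using x y Zc by (simp add: s(3) M.a_comm)
    fix W assume "W \<in> carrier ?S"
    then obtain w where w: "W = B +>\<^bsub>M\<^esub> w" "w \<in> Z" by (auto simp: s)
    show "X \<oplus>\<^bsub>?S\<^esub> Y \<oplus>\<^bsub>?S\<^esub> W = X \<oplus>\<^bsub>?S\<^esub> (Y \<oplus>\<^bsub>?S\<^esub> W)"
      using x y w Zc by (simp add: s(3) M.a_assoc)
  qed
qed

end

lemma module_same_operations:
  assumes M: "module K M" and carrier: "carrier N = carrier M" and zero: "\<zero>\<^bsub>N\<^esub> = \<zero>\<^bsub>M\<^esub>"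
    and add: "\<And>x y. x \<oplus>\<^bsub>N\<^esub> y = x \<oplus>\<^bsub>M\<^esub> y" and smult: "\<And>a x. a \<odot>\<^bsub>N\<^esub> x = a \<odot>\<^bsub>M\<^esub> x"
  shows "module K N"
proof -
  interpret module K M by (rule M)
  have "\<exists>y\<in>carrier M. y \<oplus>\<^bsub>M\<^esub> x = \<zero>\<^bsub>M\<^esub>" if "x \<in> carrier M" for x
    using that M.l_neg by blast
  then show ?thesis
    by (intro moduleI abelian_groupI)
       (simp_all add: carrier zero add smult R.cring_axioms M.a_ac smult_l_distr smult_r_distr smult_assoc1)
qed

section \<open>Cohomology of a complex of modules\<close>

lemma
  assumes C: "\<And>n. module K (C n)" and d: "\<And>n. d n \<in> lin_maps K (C n) (C (Suc n))"
  shows submodule_cocycles: "submodule (cocycles C d n) K (C n)"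
    and submodule_coboundaries: "submodule (coboundaries C d n) K (C n)"
    and module_cohomology: "module K (cohomology C d n)"
proof -
  show Z: "submodule (cocycles C d n) K (C n)"
    unfolding cocycles_def by (intro submodule_kernel d C)
  show B: "submodule (coboundaries C d n) K (C n)"
    by (cases n)
       (simp_all add: coboundaries_def submodule_image[OF d C C] module.trivial_submodule[OF C])
  show "module K (cohomology C d n)"
    unfolding cohomology_def by (rule module.module_subquot[OF C Z B])
qed

section \<open>Isomorphisms\<close>

lemma lin_iso_refl: "lin_iso K M M"
  unfolding lin_iso_def by (rule bexI[of _ "\<lambda>x. x"]) (auto simp: lin_maps_def bij_betw_def)

lemma lin_iso_trans:
  assumes "lin_iso K L M" "lin_iso K M N"
  shows "lin_iso K L N"
proof -
  obtain f g where "f \<in> lin_maps K L M" "bij_betw f (carrier L) (carrier M)"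
    "g \<in> lin_maps K M N" "bij_betw g (carrier M) (carrier N)"
    using assms by (auto simp: lin_iso_def)
  then show ?thesis
    using lin_maps_compose[of f K L M g N] bij_betw_trans[of f "carrier L" "carrier M" g "carrier N"]
    by (auto simp: lin_iso_def comp_def)
qed

lemma lin_iso_sym:
  assumes M: "module K M" and iso: "lin_iso K M N"
  shows "lin_iso K N M"
proof -
  interpret module K M by (rule M)
  obtain f where f: "f \<in> lin_maps K M N" and bij: "bij_betw f (carrier M) (carrier N)"
    using iso by (auto simp: lin_iso_def)
  let ?g = "inv_into (carrier M) f"
  have fg: "f (?g y) = y" and g: "?g y \<in> carrier M" if "y \<in> carrier N" for y
    using bij that by (auto simp: bij_betw_def f_inv_into_f inv_into_into)
  have gf: "?g y = x" if "x \<in> carrier M" "f x = y" for x y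
    using bij that by (auto simp: bij_betw_def inv_into_f_f)
  have "?g \<in> lin_maps K N M"
    by (rule lin_mapsI) (auto intro!: gf simp: g fg lin_maps_add[OF f] lin_maps_smult[OF f])
  then show ?thesis
    using bij_betw_inv_into[OF bij] by (auto simp: lin_iso_def)
qed

lemma lin_iso_trivial:
  assumes "module K M" "module K N" "carrier M = {\<zero>\<^bsub>M\<^esub>}" "carrier N = {\<zero>\<^bsub>N\<^esub>}"
  shows "lin_iso K M N"
proof -
  interpret M: module K M by fact
  interpret N: module K N by fact
  have "(\<lambda>_. \<zero>\<^bsub>N\<^esub>) \<in> lin_maps K M N" by (rule lin_mapsI) auto
  then show ?thesis using assms(3,4) by (auto simp: lin_iso_def bij_betw_def)
qed

text \<open>
  The first isomorphism theorem, phrased for a map on representatives: \<open>\<Phi>\<close> is required to be linear on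
  \<open>Z\<close> alone, because the maps used later, such as \<open>x \<mapsto> B + x\<close>, land in a subquotient only there.
\<close>

lemma lin_iso_subquot:
  assumes M: "module K M" and Z: "submodule Z K M" and B: "submodule B K M"
    and N: "module K N"
    and onto: "\<Phi> ` Z = carrier N"
    and add: "\<And>x y. \<lbrakk>x \<in> Z; y \<in> Z\<rbrakk> \<Longrightarrow> \<Phi> (x \<oplus>\<^bsub>M\<^esub> y) = \<Phi> x \<oplus>\<^bsub>N\<^esub> \<Phi> y"
    and smult: "\<And>a x. \<lbrakk>a \<in> carrier K; x \<in> Z\<rbrakk> \<Longrightarrow> \<Phi> (a \<odot>\<^bsub>M\<^esub> x) = a \<odot>\<^bsub>N\<^esub> \<Phi> x"
    and ker: "\<And>x. x \<in> Z \<Longrightarrow> \<Phi> x = \<zero>\<^bsub>N\<^esub> \<longleftrightarrow> x \<in> B"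
  shows "lin_iso K (subquot M Z B) N"
proof -
  interpret M: module K M by (rule M)
  interpret N: module K N by (rule N)
  note Zs = M.submoduleE[OF Z]
  have Zc: "x \<in> carrier M" if "x \<in> Z" for x using that Zs(1) by auto
  have \<Phi>c: "\<Phi> x \<in> carrier N" if "x \<in> Z" for x using onto that by auto
  have neg: "\<Phi> (\<ominus>\<^bsub>M\<^esub> x) = \<ominus>\<^bsub>N\<^esub> \<Phi> x" if "x \<in> Z" for x
    using smult[of "\<ominus>\<^bsub>K\<^esub> \<one>\<^bsub>K\<^esub>" x] that Zc \<Phi>c by (simp add: M.smult_l_minus N.smult_l_minus)
  have eq: "\<Phi> x = \<Phi> y \<longleftrightarrow> B +>\<^bsub>M\<^esub> x = B +>\<^bsub>M\<^esub> y" if "x \<in> Z" "y \<in> Z" for x y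
  proof -
    have "\<Phi> (x \<ominus>\<^bsub>M\<^esub> y) = \<Phi> x \<ominus>\<^bsub>N\<^esub> \<Phi> y"
      using that Zs(3) by (simp add: a_minus_def add neg)
    then show ?thesis
      using ker[of "x \<ominus>\<^bsub>M\<^esub> y"] that Zc \<Phi>c M.submodule_minus[OF Z that]
      by (simp add: M.coset_eq_iff[OF B] N.M.minus_eq_zero_iff)
  qed
  define F where "F X = \<Phi> (SOME x. x \<in> Z \<and> X = B +>\<^bsub>M\<^esub> x)" for X
  have F: "F (B +>\<^bsub>M\<^esub> x) = \<Phi> x" if "x \<in> Z" for x
  proof -
    let ?x' = "SOME x'. x' \<in> Z \<and> B +>\<^bsub>M\<^esub> x = B +>\<^bsub>M\<^esub> x'"
    have "?x' \<in> Z \<and> B +>\<^bsub>M\<^esub> x = B +>\<^bsub>M\<^esub> ?x'"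
      by (rule someI[of _ x]) (use that in simp)
    then show ?thesis using eq that unfolding F_def by metis
  qed
  note s = M.subquot_simps(1) M.subquot_simps(3,4)[OF B]
  have "F \<in> lin_maps K (subquot M Z B) N"
    using Zs(4,5) by (intro lin_mapsI) (auto simp: s F Zc \<Phi>c add smult)
  moreover have "bij_betw F (carrier (subquot M Z B)) (carrier N)"
    using onto by (auto simp: bij_betw_def inj_on_def s F eq image_image cong: image_cong)
  ultimately show ?thesis unfolding lin_iso_def by blast
qed

lemma lin_iso_subquot_carrier:
  assumes "module K M"
  shows "lin_iso K (subquot M (carrier M) {\<zero>\<^bsub>M\<^esub>}) M"
  using assms module.carrier_is_submodule module.trivial_submodule
  by (intro lin_iso_subquot[where \<Phi> = "\<lambda>x. x"]) auto

text \<open>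
  Maps in both directions that are mutually inverse up to elements of \<open>B\<close> and \<open>B'\<close> are what two
  homotopy inverse chain maps provide on cocycles.
\<close>

lemma lin_iso_subquots:
  assumes M: "module K M" and Z: "submodule Z K M" and B: "submodule B K M"
    and M': "module K M'" and Z': "submodule Z' K M'" and B': "submodule B' K M'"
    and F: "F \<in> lin_maps K M M'" and G: "G \<in> lin_maps K M' M"
    and FZ: "F ` Z \<subseteq> Z'" and FB: "F ` B \<subseteq> B'" and GZ: "G ` Z' \<subseteq> Z" and GB: "G ` B' \<subseteq> B"
    and GF: "\<And>z. z \<in> Z \<Longrightarrow> G (F z) \<ominus>\<^bsub>M\<^esub> z \<in> B"
    and FG: "\<And>z. z \<in> Z' \<Longrightarrow> F (G z) \<ominus>\<^bsub>M'\<^esub> z \<in> B'"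
  shows "lin_iso K (subquot M Z B) (subquot M' Z' B')"
proof -
  interpret M: module K M by (rule M)
  interpret M': module K M' by (rule M')
  have Zc: "x \<in> carrier M" if "x \<in> Z" for x using that M.submoduleE(1)[OF Z] by auto
  have Zc': "x \<in> carrier M'" if "x \<in> Z'" for x using that M'.submoduleE(1)[OF Z'] by auto
  note Fc = lin_maps_closed[OF F]
  note s = M'.subquot_simps(1,2) M'.subquot_simps(3,4)[OF B']
  show ?thesis
  proof (rule lin_iso_subquot[OF M Z B M'.module_subquot[OF Z' B'],
        where \<Phi> = "\<lambda>x. B' +>\<^bsub>M'\<^esub> F x"])
    have "B' +>\<^bsub>M'\<^esub> z \<in> (\<lambda>x. B' +>\<^bsub>M'\<^esub> F x) ` Z" if z: "z \<in> Z'" for z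
    proof (rule rev_image_eqI)
      show "G z \<in> Z" using GZ z by auto
      then show "B' +>\<^bsub>M'\<^esub> z = B' +>\<^bsub>M'\<^esub> F (G z)"
        using FG[OF z] z Zc Zc' Fc by (metis M'.coset_eq_iff[OF B'])
    qed
    then show "(\<lambda>x. B' +>\<^bsub>M'\<^esub> F x) ` Z = carrier (subquot M' Z' B')"
      using FZ by (auto simp: s)
    show "B' +>\<^bsub>M'\<^esub> F x = \<zero>\<^bsub>subquot M' Z' B'\<^esub> \<longleftrightarrow> x \<in> B" if x: "x \<in> Z" for x
    proof -
      have "x \<in> B" if "F x \<in> B'"
      proof -
        have GFx: "G (F x) \<in> B" using GB that by auto
        have "G (F x) \<ominus>\<^bsub>M\<^esub> (G (F x) \<ominus>\<^bsub>M\<^esub> x) = x"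
          using Zc[OF x] subsetD[OF M.submoduleE(1)[OF B] GFx]
          by (simp add: a_minus_def M.M.minus_add M.M.r_neg2)
        then show ?thesis using M.submodule_minus[OF B GFx GF[OF x]] by simp
      qed
      then show ?thesis
        using FB Zc[OF x] Fc by (auto simp: s M'.coset_eq_zero_iff[OF B'])
    qed
  qed (auto simp: s Zc Fc lin_maps_add[OF F] lin_maps_smult[OF F])
qed

section \<open>Modules of functions\<close>

lemma fun_module_simps [simp]:
  "carrier (fun_module A S M) = S"
  "\<zero>\<^bsub>fun_module A S M\<^esub> = (\<lambda>x\<in>A. \<zero>\<^bsub>M\<^esub>)"
  "f \<oplus>\<^bsub>fun_module A S M\<^esub> g = (\<lambda>x\<in>A. f x \<oplus>\<^bsub>M\<^esub> g x)"
  "a \<odot>\<^bsub>fun_module A S M\<^esub> f = (\<lambda>x\<in>A. a \<odot>\<^bsub>M\<^esub> f x)"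
  by (simp_all add: fun_module_def)

lemma module_fun_module:
  assumes M: "module K M" and S: "S \<subseteq> A \<rightarrow>\<^sub>E carrier M"
    and zero: "(\<lambda>x\<in>A. \<zero>\<^bsub>M\<^esub>) \<in> S"
    and add: "\<And>f g. \<lbrakk>f \<in> S; g \<in> S\<rbrakk> \<Longrightarrow> (\<lambda>x\<in>A. f x \<oplus>\<^bsub>M\<^esub> g x) \<in> S"
    and smult: "\<And>a f. \<lbrakk>a \<in> carrier K; f \<in> S\<rbrakk> \<Longrightarrow> (\<lambda>x\<in>A. a \<odot>\<^bsub>M\<^esub> f x) \<in> S"
  shows "module K (fun_module A S M)"
proof -
  interpret module K M by (rule M)
  have c: "f x \<in> carrier M" if "f \<in> S" "x \<in> A" for f x using S that by auto
  have ext: "f x = undefined" if "f \<in> S" "x \<notin> A" for f x using S that by auto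
  show ?thesis
  proof (intro moduleI abelian_groupI)
    show "cring K" by (rule R.cring_axioms)
    fix f assume f: "f \<in> carrier (fun_module A S M)"
    show "\<exists>g\<in>carrier (fun_module A S M). g \<oplus>\<^bsub>fun_module A S M\<^esub> f = \<zero>\<^bsub>fun_module A S M\<^esub>"
    proof
      show "(\<lambda>x\<in>A. (\<ominus>\<^bsub>K\<^esub> \<one>\<^bsub>K\<^esub>) \<odot>\<^bsub>M\<^esub> f x) \<in> carrier (fun_module A S M)"
        using f smult by simp
      show "(\<lambda>x\<in>A. (\<ominus>\<^bsub>K\<^esub> \<one>\<^bsub>K\<^esub>) \<odot>\<^bsub>M\<^esub> f x) \<oplus>\<^bsub>fun_module A S M\<^esub> f = \<zero>\<^bsub>fun_module A S M\<^esub>"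
        using f c by (auto simp: smult_l_minus M.l_neg)
    qed
  qed (auto simp: zero add smult c ext fun_eq_iff M.a_ac smult_l_distr smult_r_distr
      smult_assoc1)
qed

lemma eval_linear: "\<lbrakk>S \<subseteq> A \<rightarrow>\<^sub>E carrier M; x \<in> A\<rbrakk> \<Longrightarrow> (\<lambda>f. f x) \<in> lin_maps K (fun_module A S M) M"
  by (rule lin_mapsI) auto

lemma lin_maps_fun_moduleI:
  assumes "\<And>n. n \<in> carrier N \<Longrightarrow> F n \<in> S" and S: "S \<subseteq> A \<rightarrow>\<^sub>E carrier M" and N: "module K N"
    and lin: "\<And>x. x \<in> A \<Longrightarrow> (\<lambda>n. F n x) \<in> lin_maps K N M"
  shows "F \<in> lin_maps K N (fun_module A S M)"
proof -
  interpret module K N by (rule N)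
  have ext: "F n x = undefined" if "n \<in> carrier N" "x \<notin> A" for n x
    using assms(1)[OF that(1)] S that(2) by auto
  show ?thesis
    by (rule lin_mapsI)
       (auto simp: assms(1) ext fun_eq_iff lin_maps_add[OF lin] lin_maps_smult[OF lin])
qed

section \<open>Means over a finite set in characteristic zero\<close>

definition mean ::
    "('k, 'a) ring_scheme \<Rightarrow> ('k, 'm, 'b) module_scheme \<Rightarrow> 'i set \<Rightarrow> ('i \<Rightarrow> 'm) \<Rightarrow> 'm" where
  "mean K M A h = inv\<^bsub>K\<^esub> ([card A] \<cdot>\<^bsub>K\<^esub> \<one>\<^bsub>K\<^esub>) \<odot>\<^bsub>M\<^esub> (\<Oplus>\<^bsub>M\<^esub>i\<in>A. h i)"

locale finite_index =
  fixes K :: "('k, 'a) ring_scheme" and A :: "'i set"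
  assumes field: "field K" and char_zero: "char_zero K" and fin: "finite A" and ne: "A \<noteq> {}"
begin

lemma card_inverse:
  "inv\<^bsub>K\<^esub> ([card A] \<cdot>\<^bsub>K\<^esub> \<one>\<^bsub>K\<^esub>) \<in> carrier K"
  "inv\<^bsub>K\<^esub> ([card A] \<cdot>\<^bsub>K\<^esub> \<one>\<^bsub>K\<^esub>) \<otimes>\<^bsub>K\<^esub> ([card A] \<cdot>\<^bsub>K\<^esub> \<one>\<^bsub>K\<^esub>) = \<one>\<^bsub>K\<^esub>"
proof -
  interpret field K by (rule field)
  have "card A \<noteq> 0" using fin ne by simp
  then have "[card A] \<cdot>\<^bsub>K\<^esub> \<one>\<^bsub>K\<^esub> \<in> Units K"
    using char_zero by (auto simp: char_zero_def field_Units)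
  then show "inv\<^bsub>K\<^esub> ([card A] \<cdot>\<^bsub>K\<^esub> \<one>\<^bsub>K\<^esub>) \<in> carrier K"
    "inv\<^bsub>K\<^esub> ([card A] \<cdot>\<^bsub>K\<^esub> \<one>\<^bsub>K\<^esub>) \<otimes>\<^bsub>K\<^esub> ([card A] \<cdot>\<^bsub>K\<^esub> \<one>\<^bsub>K\<^esub>) = \<one>\<^bsub>K\<^esub>"
    by (auto simp: Units_inv_closed Units_l_inv)
qed

lemma lin_maps_mean:
  assumes "f \<in> lin_maps K M N" "module K M" "module K N" "h \<in> A \<rightarrow> carrier M"
  shows "f (mean K M A h) = mean K N A (\<lambda>i. f (h i))"
proof -
  interpret module K M by fact
  show ?thesis
    using assms card_inverse M.finsum_closed[of h A] fin
    by (simp add: mean_def lin_maps_smult lin_maps_finsum)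
qed

context
  fixes M :: "('k, 'm, 'b) module_scheme"
  assumes M: "module K M"
begin

interpretation module K M by (rule M)

lemma mean_closed: "h \<in> A \<rightarrow> carrier M \<Longrightarrow> mean K M A h \<in> carrier M"
  unfolding mean_def by (intro smult_closed card_inverse M.finsum_closed)

lemma mean_cong:
  "\<lbrakk>\<And>i. i \<in> A \<Longrightarrow> h i = h' i; h' \<in> A \<rightarrow> carrier M\<rbrakk> \<Longrightarrow> mean K M A h = mean K M A h'"
  by (auto simp: mean_def intro!: arg_cong[where f = "\<lambda>x. _ \<odot>\<^bsub>M\<^esub> x"] M.finsum_cong')

lemma mean_const:
  assumes "x \<in> carrier M"
  shows "mean K M A (\<lambda>_. x) = x"
  using card_inverse assms fin by (simp add: mean_def finsum_const_smult smult_assoc1[symmetric])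

lemma mean_add:
  assumes "h \<in> A \<rightarrow> carrier M" "h' \<in> A \<rightarrow> carrier M"
  shows "mean K M A (\<lambda>i. h i \<oplus>\<^bsub>M\<^esub> h' i) = mean K M A h \<oplus>\<^bsub>M\<^esub> mean K M A h'"
  using assms card_inverse by (simp add: mean_def M.finsum_addf smult_r_distr)

lemma mean_neg:
  assumes "h \<in> A \<rightarrow> carrier M"
  shows "mean K M A (\<lambda>i. \<ominus>\<^bsub>M\<^esub> h i) = \<ominus>\<^bsub>M\<^esub> mean K M A h"
proof -
  have "(\<lambda>x. \<ominus>\<^bsub>M\<^esub> x) \<in> lin_maps K M M"
    by (rule lin_mapsI) (auto simp: M.minus_add M.a_comm smult_r_minus)
  then show ?thesis
    using lin_maps_mean[OF _ M M assms] by simp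
qed

lemma mean_minus:
  assumes "h \<in> A \<rightarrow> carrier M" "h' \<in> A \<rightarrow> carrier M"
  shows "mean K M A (\<lambda>i. h i \<ominus>\<^bsub>M\<^esub> h' i) = mean K M A h \<ominus>\<^bsub>M\<^esub> mean K M A h'"
  using assms mean_add[of h "\<lambda>i. \<ominus>\<^bsub>M\<^esub> h' i"] mean_neg[of h'] by (simp add: a_minus_def Pi_iff)

lemma mean_in_submodule:
  assumes B: "submodule B K M" and h: "h \<in> A \<rightarrow> B"
  shows "mean K M A h \<in> B"
  unfolding mean_def using submodule_finsum[OF B fin h] submoduleE(4)[OF B] card_inverse(1) by blast

lemma mean_minus_in_submodule:
  assumes B: "submodule B K M" and "h \<in> A \<rightarrow> carrier M" "x \<in> carrier M"
    and "\<And>i. i \<in> A \<Longrightarrow> h i \<ominus>\<^bsub>M\<^esub> x \<in> B"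
  shows "mean K M A h \<ominus>\<^bsub>M\<^esub> x \<in> B"
proof -
  have "mean K M A (\<lambda>i. h i \<ominus>\<^bsub>M\<^esub> x) \<in> B"
    using assms by (intro mean_in_submodule) auto
  then show ?thesis
    using assms mean_minus[of h "\<lambda>_. x"] mean_const by simp
qed

lemma mean_reindex:
  assumes \<sigma>: "bij_betw \<sigma> A A" and h: "h \<in> A \<rightarrow> carrier M"
  shows "mean K M A (\<lambda>i. h (\<sigma> i)) = mean K M A h"
  using M.finsum_reindex[of h \<sigma> A] assms by (simp add: mean_def bij_betw_def)

end

end

section \<open>Group cohomology of finite groups in characteristic zero\<close>

locale linear_action = module K M + G: group G
  for K :: "('k, 'a) ring_scheme" and G :: "('g, 'c) monoid_scheme" and M :: "('k, 'm, 'g) gmodule" +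
  assumes gact_linear: "g \<in> carrier G \<Longrightarrow> gact M g \<in> lin_maps K M M"
    and gact_one: "x \<in> carrier M \<Longrightarrow> gact M \<one>\<^bsub>G\<^esub> x = x"
    and gact_mult: "\<lbrakk>g \<in> carrier G; h \<in> carrier G; x \<in> carrier M\<rbrakk>
      \<Longrightarrow> gact M (g \<otimes>\<^bsub>G\<^esub> h) x = gact M g (gact M h x)"
begin

abbreviation C where "C \<equiv> group_cochains G M"
abbreviation d where "d \<equiv> group_coboundary G M"

lemma module_group_cochains: "module K (C n)"
  unfolding group_cochains_def by (rule module_fun_module) (auto intro: module_axioms)

lemma eval_cochain_linear:
  "gs \<in> group_tuples G n \<Longrightarrow> (\<lambda>f. f gs) \<in> lin_maps K (C n) M"
  unfolding group_cochains_def by (rule eval_linear) auto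

lemma group_tuples_faces:
  assumes gs: "gs \<in> group_tuples G (Suc n)"
  shows "hd gs \<in> carrier G" "tl gs \<in> group_tuples G n" "butlast gs \<in> group_tuples G n"
    "last gs \<in> carrier G"
    "i \<in> {1..n} \<Longrightarrow> take (i - 1) gs @ [gs ! (i - 1) \<otimes>\<^bsub>G\<^esub> gs ! i] @ drop (i + 1) gs \<in> group_tuples G n"
proof -
  have ne: "gs \<noteq> []" and len: "length gs = Suc n" and sub: "set gs \<subseteq> carrier G"
    using gs by (auto simp: group_tuples_def)
  show "hd gs \<in> carrier G" "last gs \<in> carrier G" using ne sub by auto
  show "tl gs \<in> group_tuples G n"
    using len sub by (cases gs) (auto simp: group_tuples_def)
  show "butlast gs \<in> group_tuples G n"
    using len sub by (auto simp: group_tuples_def dest: in_set_butlastD)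
  assume i: "i \<in> {1..n}"
  then have "gs ! (i - 1) \<in> carrier G" "gs ! i \<in> carrier G"
    using len sub by (auto simp: subset_iff)
  then show "take (i - 1) gs @ [gs ! (i - 1) \<otimes>\<^bsub>G\<^esub> gs ! i] @ drop (i + 1) gs \<in> group_tuples G n"
    using i len sub by (auto simp: group_tuples_def dest!: in_set_takeD in_set_dropD)
qed

lemma group_coboundary_linear: "d n \<in> lin_maps K (C n) (C (Suc n))"
proof -
  have lin: "(\<lambda>f. d n f gs) \<in> lin_maps K (C n) M" if gs: "gs \<in> group_tuples G (Suc n)" for gs
  proof -
    note faces = group_tuples_faces[OF gs]
    have eq: "d n f gs =
     gact M (hd gs) (f (tl gs))
     \<oplus>\<^bsub>M\<^esub> (\<Oplus>\<^bsub>M\<^esub>i\<in>{1..n}. alt_sign M i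
           (f (take (i - 1) gs @ [gs ! (i - 1) \<otimes>\<^bsub>G\<^esub> gs ! i] @ drop (i + 1) gs)))
     \<oplus>\<^bsub>M\<^esub> alt_sign M (Suc n) (f (butlast gs))" for f
      using gs by (simp add: group_coboundary_def)
    show ?thesis
      unfolding eq
      by (intro lin_maps_pointwise_add lin_maps_pointwise_finsum module_axioms finite_atLeastAtMost
          lin_maps_compose[OF _ gact_linear] lin_maps_compose[OF _ alt_sign_linear]
          eval_cochain_linear faces)
  qed
  show ?thesis
    unfolding group_cochains_def[of G M "Suc n"]
  proof (rule lin_maps_fun_moduleI[OF _ subset_refl module_group_cochains lin])
    show "d n f \<in> group_tuples G (Suc n) \<rightarrow>\<^sub>E carrier M" if "f \<in> carrier (C n)" for f
    proof (rule PiE_I)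
      show "d n f gs \<in> carrier M" if "gs \<in> group_tuples G (Suc n)" for gs
        using lin_maps_closed[OF lin[OF that] \<open>f \<in> carrier (C n)\<close>] .
    qed (simp add: group_coboundary_def)
  qed
qed

lemmas group_complex = module_group_cochains group_coboundary_linear

lemma module_group_cohomology: "module K (group_cohomology G M n)"
  unfolding group_cohomology_def by (intro module_cohomology group_complex)

lemma alt_sign_Suc: "x \<in> carrier M \<Longrightarrow> alt_sign M (Suc i) x = \<ominus>\<^bsub>M\<^esub> alt_sign M i x"
  by (simp add: alt_sign_def)

text \<open>
  The cocycle condition at \<open>(g\<^sub>1,\<dots>,g\<^sub>n\<^sub>+\<^sub>1,g)\<close>, read as a formula for the coboundary of the cochain
  obtained by fixing the last argument \<open>g\<close>.
\<close>

lemma coboundary_of_fixed_last_argument: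
  assumes f: "f \<in> cocycles C d (Suc n)"
    and gs: "gs \<in> group_tuples G (Suc n)" and g: "g \<in> carrier G"
  shows "d n (\<lambda>hs\<in>group_tuples G n. f (hs @ [g])) gs =
    alt_sign M (Suc n) (f gs) \<oplus>\<^bsub>M\<^esub>
    (alt_sign M (Suc n) (f (butlast gs @ [g])) \<ominus>\<^bsub>M\<^esub>
     alt_sign M (Suc n) (f (butlast gs @ [last gs \<otimes>\<^bsub>G\<^esub> g])))"
proof -
  note faces = group_tuples_faces[OF gs]
  have ne: "gs \<noteq> []" and len: "length gs = Suc n" using gs by (auto simp: group_tuples_def)
  have fc: "f hs \<in> carrier M" if "hs \<in> group_tuples G (Suc n)" for hs
    using f that by (auto simp: cocycles_def group_cochains_def a_kernel_def')
  have snoc: "hs @ [h] \<in> group_tuples G (Suc m)" if "hs \<in> group_tuples G m" "h \<in> carrier G" for hs h m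
    using that by (auto simp: group_tuples_def)
  define A where "A = gact M (hd gs) (f (tl gs @ [g]))"
  define T where "T i = alt_sign M i
    (f (take (i - 1) gs @ [gs ! (i - 1) \<otimes>\<^bsub>G\<^esub> gs ! i] @ drop (i + 1) gs @ [g]))" for i
  define P where "P = alt_sign M (Suc n) (f (butlast gs @ [g]))"
  define P' where "P' = alt_sign M (Suc n) (f (butlast gs @ [last gs \<otimes>\<^bsub>G\<^esub> g]))"
  define Z where "Z = alt_sign M (Suc n) (f gs)"
  have c: "A \<in> carrier M" "P \<in> carrier M" "P' \<in> carrier M" "Z \<in> carrier M"
    using faces g by (auto simp: A_def P_def P'_def Z_def intro!: lin_maps_closed[OF gact_linear]
        alt_sign_closed fc snoc gs)
  have Tc: "T i \<in> carrier M" if "i \<in> {1..n}" for i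
    using snoc[OF faces(5)[OF that] g] by (simp add: T_def alt_sign_closed fc)
  then have Sc: "(\<Oplus>\<^bsub>M\<^esub>i\<in>{1..n}. T i) \<in> carrier M" by (intro M.finsum_closed) auto
  have 1: "d n (\<lambda>hs\<in>group_tuples G n. f (hs @ [g])) gs = A \<oplus>\<^bsub>M\<^esub> (\<Oplus>\<^bsub>M\<^esub>i\<in>{1..n}. T i) \<oplus>\<^bsub>M\<^esub> P"
  proof -
    have "(\<Oplus>\<^bsub>M\<^esub>i\<in>{1..n}. alt_sign M i ((\<lambda>hs\<in>group_tuples G n. f (hs @ [g]))
        (take (i - 1) gs @ [gs ! (i - 1) \<otimes>\<^bsub>G\<^esub> gs ! i] @ drop (i + 1) gs))) = (\<Oplus>\<^bsub>M\<^esub>i\<in>{1..n}. T i)"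
      using Tc faces(5) by (intro M.finsum_cong') (auto simp: T_def)
    then show ?thesis
      using gs faces by (simp add: group_coboundary_def A_def P_def)
  qed
  have "d (Suc n) f (gs @ [g]) = \<zero>\<^bsub>M\<^esub>"
    using f snoc[OF gs g] by (simp add: cocycles_def a_kernel_def' group_cochains_def)
  moreover have "d (Suc n) f (gs @ [g]) = A \<oplus>\<^bsub>M\<^esub> (P' \<oplus>\<^bsub>M\<^esub> (\<Oplus>\<^bsub>M\<^esub>i\<in>{1..n}. T i)) \<oplus>\<^bsub>M\<^esub> \<ominus>\<^bsub>M\<^esub> Z"
  proof -
    let ?t = "\<lambda>i. alt_sign M i (f (take (i - 1) (gs @ [g]) @
        [(gs @ [g]) ! (i - 1) \<otimes>\<^bsub>G\<^esub> (gs @ [g]) ! i] @ drop (i + 1) (gs @ [g])))"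
    \<comment> \<open>The inner face \<open>n + 1\<close> merges the last entry of \<open>gs\<close> with \<open>g\<close>; the others leave \<open>g\<close> alone.\<close>
    have last: "?t (Suc n) = P'"
      using len ne by (simp add: P'_def nth_append last_conv_nth butlast_conv_take)
    have init: "?t i = T i" if "i \<in> {1..n}" for i
    proof -
      have "i - Suc 0 < Suc n" "i < Suc n" using that by auto
      then show ?thesis using len that by (simp add: T_def nth_append)
    qed
    have "(\<Oplus>\<^bsub>M\<^esub>i\<in>{1..Suc n}. ?t i) = ?t (Suc n) \<oplus>\<^bsub>M\<^esub> (\<Oplus>\<^bsub>M\<^esub>i\<in>{1..n}. ?t i)"
    proof -
      have "{1..Suc n} = insert (Suc n) {1..n}" by auto
      then show ?thesis
        by (simp only:) (rule M.finsum_insert; use init last Tc c in simp)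
    qed
    also have "\<dots> = P' \<oplus>\<^bsub>M\<^esub> (\<Oplus>\<^bsub>M\<^esub>i\<in>{1..n}. T i)"
      unfolding last using init Tc by (intro arg_cong[where f = "\<lambda>x. P' \<oplus>\<^bsub>M\<^esub> x"] M.finsum_cong') auto
    finally show ?thesis
      using snoc[OF gs g] ne fc[OF gs]
      by (simp add: group_coboundary_def A_def Z_def alt_sign_Suc)
  qed
  ultimately have 2: "A \<oplus>\<^bsub>M\<^esub> (P' \<oplus>\<^bsub>M\<^esub> (\<Oplus>\<^bsub>M\<^esub>i\<in>{1..n}. T i)) \<oplus>\<^bsub>M\<^esub> \<ominus>\<^bsub>M\<^esub> Z = \<zero>\<^bsub>M\<^esub>" by simp
  have "A \<oplus>\<^bsub>M\<^esub> (\<Oplus>\<^bsub>M\<^esub>i\<in>{1..n}. T i) \<oplus>\<^bsub>M\<^esub> P' = Z"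
    using M.minus_eq_zero_iff[of "A \<oplus>\<^bsub>M\<^esub> (P' \<oplus>\<^bsub>M\<^esub> (\<Oplus>\<^bsub>M\<^esub>i\<in>{1..n}. T i))" Z] 2 c Sc
    by (simp add: a_minus_def M.a_ac)
  moreover have "P' \<oplus>\<^bsub>M\<^esub> (P \<ominus>\<^bsub>M\<^esub> P') = P"
    using M.a_lcomm[of P' P "\<ominus>\<^bsub>M\<^esub> P'"] c by (simp add: a_minus_def M.r_neg)
  ultimately have "Z \<oplus>\<^bsub>M\<^esub> (P \<ominus>\<^bsub>M\<^esub> P') = A \<oplus>\<^bsub>M\<^esub> (\<Oplus>\<^bsub>M\<^esub>i\<in>{1..n}. T i) \<oplus>\<^bsub>M\<^esub> P"
    using c Sc M.a_assoc[of "A \<oplus>\<^bsub>M\<^esub> (\<Oplus>\<^bsub>M\<^esub>i\<in>{1..n}. T i)" P' "P \<ominus>\<^bsub>M\<^esub> P'"] by simp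
  then show ?thesis
    unfolding 1 P_def[symmetric] P'_def[symmetric] Z_def[symmetric] by simp
qed

end

locale finite_linear_action = linear_action K G M + finite_index K "carrier G"
  for K :: "('k, 'a) ring_scheme" and G :: "('g, 'c) monoid_scheme" and M :: "('k, 'm, 'g) gmodule"
begin

lemma bij_left_mult: "h \<in> carrier G \<Longrightarrow> bij_betw (\<lambda>g. h \<otimes>\<^bsub>G\<^esub> g) (carrier G) (carrier G)"
  by (rule bij_betw_byWitness[where f' = "\<lambda>g. inv\<^bsub>G\<^esub> h \<otimes>\<^bsub>G\<^esub> g"]) (auto simp: G.m_assoc[symmetric])

text \<open>
  Let \<open>u\<close> be the mean of the cochains obtained by fixing the last argument of \<open>f\<close>. In the formula for
  their coboundaries the two terms that still contain \<open>g\<close> have the same mean, because left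
  multiplication by \<open>g\<^sub>n\<^sub>+\<^sub>1\<close> permutes \<open>G\<close>. So \<open>d u = (-1)\<^sup>n\<^sup>+\<^sup>1 f\<close>.
\<close>

lemma cocycle_is_coboundary:
  assumes f: "f \<in> cocycles C d (Suc n)"
  shows "f \<in> coboundaries C d (Suc n)"
proof -
  define fix_last where "fix_last g = (\<lambda>hs\<in>group_tuples G n. f (hs @ [g]))" for g
  define u where "u = mean K (C n) (carrier G) fix_last"
  let ?s = "alt_sign (C n) (Suc n)"
  have fE: "f \<in> group_tuples G (Suc n) \<rightarrow>\<^sub>E carrier M"
    using f by (auto simp: cocycles_def group_cochains_def a_kernel_def')
  then have fc: "f hs \<in> carrier M" if "hs \<in> group_tuples G (Suc n)" for hs using that by auto
  have snoc: "hs @ [h] \<in> group_tuples G (Suc m)" if "hs \<in> group_tuples G m" "h \<in> carrier G" for hs h m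
    using that by (auto simp: group_tuples_def)
  have fix_last: "fix_last \<in> carrier G \<rightarrow> carrier (C n)"
    by (auto simp: fix_last_def group_cochains_def intro!: fc snoc)
  have u: "u \<in> carrier (C n)"
    unfolding u_def by (rule mean_closed[OF module_group_cochains fix_last])
  have du: "d n u gs = alt_sign M (Suc n) (f gs)" if gs: "gs \<in> group_tuples G (Suc n)" for gs
  proof -
    note faces = group_tuples_faces[OF gs]
    let ?p = "\<lambda>g. alt_sign M (Suc n) (f (butlast gs @ [g]))"
    have p: "?p \<in> carrier G \<rightarrow> carrier M"
      by (auto intro!: alt_sign_closed fc snoc faces)
    then have p': "(\<lambda>g. ?p (last gs \<otimes>\<^bsub>G\<^esub> g)) \<in> carrier G \<rightarrow> carrier M"
      using faces(4) by auto
    have q: "(\<lambda>g. ?p g \<ominus>\<^bsub>M\<^esub> ?p (last gs \<otimes>\<^bsub>G\<^esub> g)) \<in> carrier G \<rightarrow> carrier M"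
      using funcset_mem[OF p] funcset_mem[OF p'] by (intro funcsetI M.minus_closed)
    have z: "alt_sign M (Suc n) (f gs) \<in> carrier M"
      by (rule alt_sign_closed[OF fc[OF gs]])
    have "(\<lambda>f. d n f gs) \<in> lin_maps K (C n) M"
      by (rule lin_maps_compose[OF group_coboundary_linear eval_cochain_linear[OF gs]])
    then have "d n u gs = mean K M (carrier G) (\<lambda>g. d n (fix_last g) gs)"
      unfolding u_def by (rule lin_maps_mean[OF _ module_group_cochains module_axioms fix_last])
    also have "\<dots> = mean K M (carrier G)
        (\<lambda>g. alt_sign M (Suc n) (f gs) \<oplus>\<^bsub>M\<^esub> (?p g \<ominus>\<^bsub>M\<^esub> ?p (last gs \<otimes>\<^bsub>G\<^esub> g)))"
      using q coboundary_of_fixed_last_argument[OF f gs]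
      by (intro mean_cong[OF module_axioms]) (auto simp: fix_last_def intro!: M.a_closed z)
    also have "\<dots> = alt_sign M (Suc n) (f gs) \<oplus>\<^bsub>M\<^esub>
        mean K M (carrier G) (\<lambda>g. ?p g \<ominus>\<^bsub>M\<^esub> ?p (last gs \<otimes>\<^bsub>G\<^esub> g))"
      using mean_add[OF module_axioms _ q, of "\<lambda>_. alt_sign M (Suc n) (f gs)"]
        mean_const[OF module_axioms z] z by simp
    also have "mean K M (carrier G) (\<lambda>g. ?p g \<ominus>\<^bsub>M\<^esub> ?p (last gs \<otimes>\<^bsub>G\<^esub> g)) =
        mean K M (carrier G) ?p \<ominus>\<^bsub>M\<^esub> mean K M (carrier G) (\<lambda>g. ?p (last gs \<otimes>\<^bsub>G\<^esub> g))"
      by (rule mean_minus[OF module_axioms p p'])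
    also have "mean K M (carrier G) (\<lambda>g. ?p (last gs \<otimes>\<^bsub>G\<^esub> g)) = mean K M (carrier G) ?p"
      by (rule mean_reindex[OF module_axioms bij_left_mult[OF faces(4)] p])
    finally show ?thesis
      using mean_closed[OF module_axioms p]
      by (simp add: a_minus_def M.r_neg alt_sign_closed fc gs)
  qed
  interpret Cn: module K "C n" by (rule module_group_cochains)
  have su: "?s u \<in> carrier (C n)" by (rule Cn.alt_sign_closed[OF u])
  have "d n (?s u) = f"
  proof (rule PiE_ext)
    show "d n (?s u) \<in> group_tuples G (Suc n) \<rightarrow>\<^sub>E carrier M"
      using lin_maps_closed[OF group_coboundary_linear su] by (simp add: group_cochains_def)
    show "f \<in> group_tuples G (Suc n) \<rightarrow>\<^sub>E carrier M" by (rule fE)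
    fix gs assume gs: "gs \<in> group_tuples G (Suc n)"
    have "d n (?s u) gs = alt_sign M (Suc n) (d n u gs)"
      using lin_maps_alt_sign[OF lin_maps_compose[OF group_coboundary_linear
            eval_cochain_linear[OF gs]] module_group_cochains module_axioms u] .
    then show "d n (?s u) gs = f gs"
      by (simp add: du gs fc alt_sign_involutive)
  qed
  then show ?thesis
    using su by (auto simp: coboundaries_def)
qed

lemma group_cohomology_Suc_trivial:
  "carrier (group_cohomology G M (Suc n)) = {\<zero>\<^bsub>group_cohomology G M (Suc n)\<^esub>}"
proof -
  interpret Cn: module K "C (Suc n)" by (rule module_group_cochains)
  let ?B = "coboundaries C d (Suc n)" and ?Z = "cocycles C d (Suc n)"
  have B: "submodule ?B K (C (Suc n))" by (intro submodule_coboundaries group_complex)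
  have Z: "submodule ?Z K (C (Suc n))" by (intro submodule_cocycles group_complex)
  have "?B +>\<^bsub>C (Suc n)\<^esub> f = ?B" if "f \<in> ?Z" for f
    using cocycle_is_coboundary[OF that] Cn.submoduleE(1)[OF B] Cn.coset_eq_zero_iff[OF B] by auto
  then show ?thesis
    using Cn.submodule_zero[OF Z]
    by (auto simp: group_cohomology_def cohomology_def Cn.subquot_simps(1,2))
qed

end

definition fixed_points :: "('g, 'c) monoid_scheme \<Rightarrow> ('k, 'm, 'g) gmodule \<Rightarrow> 'm set" where
  "fixed_points G M = {x \<in> carrier M. \<forall>g\<in>carrier G. gact M g x = x}"

context linear_action
begin

lemma submodule_fixed_points: "submodule (fixed_points G M) K M"
  by (rule submoduleI)
     (auto simp: fixed_points_def lin_maps_zero[OF gact_linear module_axioms module_axioms]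
        lin_maps_neg[OF gact_linear module_axioms module_axioms]
        lin_maps_add[OF gact_linear] lin_maps_smult[OF gact_linear])

lemma cocycles_0_iff:
  "f \<in> cocycles C d 0 \<longleftrightarrow> f \<in> carrier (C 0) \<and> f [] \<in> fixed_points G M"
proof -
  have "(d 0 f = \<zero>\<^bsub>C 1\<^esub>) \<longleftrightarrow> f [] \<in> fixed_points G M" if f: "f \<in> carrier (C 0)"
  proof -
    have c: "f [] \<in> carrier M"
      using f by (auto simp: group_cochains_def group_tuples_def)
    have t: "gs \<in> group_tuples G 1 \<longleftrightarrow> (\<exists>g\<in>carrier G. gs = [g])" for gs
      by (auto simp: group_tuples_def length_Suc_conv)
    have "d 0 f [g] = gact M g (f []) \<ominus>\<^bsub>M\<^esub> f []" if g: "g \<in> carrier G" for g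
      using c lin_maps_closed[OF gact_linear[OF g] c] g t[of "[g]"]
      by (simp add: group_coboundary_def alt_sign_def a_minus_def)
    moreover have "gact M g (f []) \<ominus>\<^bsub>M\<^esub> f [] = \<zero>\<^bsub>M\<^esub> \<longleftrightarrow> gact M g (f []) = f []"
      if "g \<in> carrier G" for g
      using c lin_maps_closed[OF gact_linear[OF that] c] by (rule M.minus_eq_zero_iff[rotated])
    moreover have "d 0 f = \<zero>\<^bsub>C 1\<^esub> \<longleftrightarrow> (\<forall>g\<in>carrier G. d 0 f [g] = \<zero>\<^bsub>M\<^esub>)"
      using t by (auto simp: group_cochains_def fun_eq_iff group_coboundary_def restrict_def)
    ultimately show ?thesis using c by (simp add: fixed_points_def)
  qed
  then show ?thesis by (auto simp: cocycles_def a_kernel_def')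
qed

text \<open>
  \<open>H\<^sup>0(G, M) = M\<^sup>G\<close>: a \<open>0\<close>-cochain is determined by its value at the empty tuple, and the only
  \<open>0\<close>-coboundary is zero.
\<close>

lemma lin_iso_group_cohomology_0:
  "lin_iso K (group_cohomology G M 0) (M\<lparr>carrier := fixed_points G M\<rparr>)"
  unfolding group_cohomology_def cohomology_def
proof (rule lin_iso_subquot[where \<Phi> = "\<lambda>f. f []"])
  show "module K (C 0)" by (rule module_group_cochains)
  show "submodule (cocycles C d 0) K (C 0)" "submodule (coboundaries C d 0) K (C 0)"
    by (intro submodule_cocycles submodule_coboundaries group_complex)+
  show "module K (M\<lparr>carrier := fixed_points G M\<rparr>)"
    by (rule submodule.submodule_is_module[OF submodule_fixed_points module_axioms])
  have t: "group_tuples G 0 = {[]}" by (auto simp: group_tuples_def)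
  have "x \<in> (\<lambda>f. f []) ` cocycles C d 0" if "x \<in> fixed_points G M" for x
    using that by (intro rev_image_eqI[of "\<lambda>gs\<in>{[]}. x"])
      (auto simp: cocycles_0_iff group_cochains_def t fixed_points_def)
  then show "(\<lambda>f. f []) ` cocycles C d 0 = carrier (M\<lparr>carrier := fixed_points G M\<rparr>)"
    by (auto simp: cocycles_0_iff)
  show "f [] = \<zero>\<^bsub>M\<lparr>carrier := fixed_points G M\<rparr>\<^esub> \<longleftrightarrow> f \<in> coboundaries C d 0"
    if "f \<in> cocycles C d 0" for f
    using that by (auto simp: cocycles_0_iff coboundaries_def group_cochains_def t fun_eq_iff PiE_iff
        extensional_def)
qed (auto simp: group_cochains_def group_tuples_def)

end

lemma (in finite_linear_action) mean_gact_invariant: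
  assumes x: "x \<in> carrier M"
  shows "mean K M (carrier G) (\<lambda>g. gact M g x) \<in> fixed_points G M"
proof -
  have c: "(\<lambda>g. gact M g x) \<in> carrier G \<rightarrow> carrier M"
    using lin_maps_closed[OF gact_linear x] by auto
  have "gact M h (mean K M (carrier G) (\<lambda>g. gact M g x)) = mean K M (carrier G) (\<lambda>g. gact M g x)"
    if h: "h \<in> carrier G" for h
  proof -
    have "gact M h (mean K M (carrier G) (\<lambda>g. gact M g x)) =
        mean K M (carrier G) (\<lambda>g. gact M h (gact M g x))"
      by (rule lin_maps_mean[OF gact_linear[OF h] module_axioms module_axioms c])
    also have "\<dots> = mean K M (carrier G) (\<lambda>g. gact M (h \<otimes>\<^bsub>G\<^esub> g) x)"
      using c h by (intro mean_cong[OF module_axioms]) (auto simp: gact_mult x)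
    also have "\<dots> = mean K M (carrier G) (\<lambda>g. gact M g x)"
      by (rule mean_reindex[OF module_axioms bij_left_mult[OF h] c])
    finally show ?thesis .
  qed
  then show ?thesis
    using mean_closed[OF module_axioms c] by (auto simp: fixed_points_def)
qed

section \<open>Fixed points of the cohomology of an equivariant complex\<close>

locale equivariant_complex =
  fixes K :: "('k, 'a) ring_scheme" and G :: "('g, 'c) monoid_scheme"
    and C :: "nat \<Rightarrow> ('k, 'm, 'g) gmodule" and d :: "nat \<Rightarrow> 'm \<Rightarrow> 'm"
  assumes finite_action: "finite_linear_action K G (C n)"
    and diff_linear: "d n \<in> lin_maps K (C n) (C (Suc n))"
    and diff_equivariant: "\<lbrakk>g \<in> carrier G; x \<in> carrier (C n)\<rbrakk>
      \<Longrightarrow> d n (gact (C n) g x) = gact (C (Suc n)) g (d n x)"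
begin

sublocale Cn: finite_linear_action K G "C n" for n by (rule finite_action)

lemma complex_module: "module K (C n)" by (rule Cn.module_axioms)

lemmas sub_cocycles = submodule_cocycles[of K C d, OF complex_module diff_linear]
lemmas sub_coboundaries = submodule_coboundaries[of K C d, OF complex_module diff_linear]

lemma gact_closed: "\<lbrakk>g \<in> carrier G; x \<in> carrier (C n)\<rbrakk> \<Longrightarrow> gact (C n) g x \<in> carrier (C n)"
  by (rule lin_maps_closed[OF Cn.gact_linear])

lemma gact_coboundary:
  assumes g: "g \<in> carrier G" and x: "x \<in> coboundaries C d n"
  shows "gact (C n) g x \<in> coboundaries C d n"
proof (cases n)
  case 0
  then show ?thesis
    using x lin_maps_zero[OF Cn.gact_linear[OF g] complex_module complex_module]
    by (simp add: coboundaries_def)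
next
  case (Suc m)
  then show ?thesis
    using x g by (auto simp: coboundaries_def diff_equivariant[symmetric] gact_closed)
qed

lemma gact_cocycle:
  assumes g: "g \<in> carrier G" and x: "x \<in> cocycles C d n"
  shows "gact (C n) g x \<in> cocycles C d n"
  using g x lin_maps_zero[OF Cn.gact_linear[OF g] complex_module complex_module]
  by (simp add: cocycles_def a_kernel_def' diff_equivariant gact_closed)

lemma gact_coset:
  assumes g: "g \<in> carrier G" and x: "x \<in> carrier (C n)"
  shows "gact (C n) g ` (coboundaries C d n +>\<^bsub>C n\<^esub> x) = coboundaries C d n +>\<^bsub>C n\<^esub> gact (C n) g x"
    (is "_ ` (?B +>\<^bsub>_\<^esub> x) = _")
proof -
  have sub: "gact (C n) h y \<in> ?B +>\<^bsub>C n\<^esub> gact (C n) h z"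
    if "h \<in> carrier G" "z \<in> carrier (C n)" "y \<in> ?B +>\<^bsub>C n\<^esub> z" for h y z
    using that gact_coboundary[OF that(1), where n = n and x = "y \<ominus>\<^bsub>C n\<^esub> z"]
      lin_maps_minus[OF Cn.gact_linear[OF that(1)] complex_module complex_module, of y n z]
    by (simp add: Cn.mem_coset_iff[OF sub_coboundaries] gact_closed)
  have inverse: "gact (C n) g (gact (C n) (inv\<^bsub>G\<^esub> g) y) = y"
    "gact (C n) (inv\<^bsub>G\<^esub> g) (gact (C n) g y) = y" if "y \<in> carrier (C n)" for y
    using g that by (simp_all add: Cn.gact_mult[symmetric] Cn.gact_one)
  have "y \<in> gact (C n) g ` (?B +>\<^bsub>C n\<^esub> x)" if y: "y \<in> ?B +>\<^bsub>C n\<^esub> gact (C n) g x" for y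
  proof (rule rev_image_eqI)
    show "gact (C n) (inv\<^bsub>G\<^esub> g) y \<in> ?B +>\<^bsub>C n\<^esub> x"
      using sub[OF _ _ y, of "inv\<^bsub>G\<^esub> g"] g x by (simp add: inverse gact_closed)
    have "y \<in> carrier (C n)"
      using y g x by (simp add: Cn.mem_coset_iff[OF sub_coboundaries] gact_closed)
    then show "y = gact (C n) g (gact (C n) (inv\<^bsub>G\<^esub> g) y)" by (simp add: inverse)
  qed
  then show ?thesis using sub[OF g x] by auto
qed

lemma gcohomology_simps:
  "carrier (gcohomology C d n) = (\<lambda>x. coboundaries C d n +>\<^bsub>C n\<^esub> x) ` cocycles C d n"
  "\<zero>\<^bsub>gcohomology C d n\<^esub> = coboundaries C d n"
  "X \<oplus>\<^bsub>gcohomology C d n\<^esub> Y = X \<oplus>\<^bsub>cohomology C d n\<^esub> Y"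
  "a \<odot>\<^bsub>gcohomology C d n\<^esub> X = a \<odot>\<^bsub>cohomology C d n\<^esub> X"
  "gact (gcohomology C d n) g X = gact (C n) g ` X"
  by (simp_all add: gcohomology_def module.defs gmodule.defs cohomology_def Cn.subquot_simps(1,2))

lemma module_gcohomology: "module K (gcohomology C d n)"
  by (rule module_same_operations[OF module_cohomology[of K C d, OF complex_module diff_linear]])
     (simp_all add: gcohomology_simps cohomology_def Cn.subquot_simps(1,2))

lemma gcohomology_action: "finite_linear_action K G (gcohomology C d n)"
proof -
  let ?H = "gcohomology C d n" and ?B = "coboundaries C d n" and ?Z = "cocycles C d n"
  have Zc: "x \<in> carrier (C n)" if "x \<in> ?Z" for x
    using that Cn.submoduleE(1)[OF sub_cocycles] by auto
  note s = gcohomology_simps Cn.subquot_simps(3,4)[OF sub_coboundaries]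
    Cn.submoduleE(4,5)[OF sub_cocycles] gact_closed gact_cocycle gact_coset Zc
  have "gact ?H g \<in> lin_maps K ?H ?H" if g: "g \<in> carrier G" for g
  proof (rule lin_mapsI)
    fix X assume "X \<in> carrier ?H"
    then obtain x where x: "x \<in> ?Z" "X = ?B +>\<^bsub>C n\<^esub> x" by (auto simp: s)
    show "gact ?H g X \<in> carrier ?H" using x g by (simp add: s)
    { fix Y assume "Y \<in> carrier ?H"
      then obtain y where y: "y \<in> ?Z" "Y = ?B +>\<^bsub>C n\<^esub> y" by (auto simp: s)
      show "gact ?H g (X \<oplus>\<^bsub>?H\<^esub> Y) = gact ?H g X \<oplus>\<^bsub>?H\<^esub> gact ?H g Y"
        using x y g by (simp add: s cohomology_def lin_maps_add[OF Cn.gact_linear]) }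
    fix a assume "a \<in> carrier K"
    then show "gact ?H g (a \<odot>\<^bsub>?H\<^esub> X) = a \<odot>\<^bsub>?H\<^esub> gact ?H g X"
      using x g by (simp add: s cohomology_def lin_maps_smult[OF Cn.gact_linear])
  qed
  moreover have "gact ?H \<one>\<^bsub>G\<^esub> X = X"
    "\<lbrakk>g \<in> carrier G; h \<in> carrier G\<rbrakk> \<Longrightarrow> gact ?H (g \<otimes>\<^bsub>G\<^esub> h) X = gact ?H g (gact ?H h X)"
    if X: "X \<in> carrier ?H" for X g h
  proof -
    obtain x where x: "x \<in> ?Z" "X = ?B +>\<^bsub>C n\<^esub> x" using X by (auto simp: s(1))
    show "gact ?H \<one>\<^bsub>G\<^esub> X = X"
      using x by (simp add: s(5) gact_coset Zc Cn.gact_one)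
    show "gact ?H (g \<otimes>\<^bsub>G\<^esub> h) X = gact ?H g (gact ?H h X)"
      if "g \<in> carrier G" "h \<in> carrier G"
      using x that by (simp add: s(5) gact_coset Zc Cn.gact_mult gact_closed)
  qed
  ultimately have "linear_action K G ?H"
    by (intro linear_action.intro linear_action_axioms.intro module_gcohomology Cn.G.group_axioms)
  then show ?thesis
    by (intro finite_linear_action.intro Cn.finite_index_axioms)
qed

text \<open>
  If the class of a cocycle \<open>x\<close> is fixed by \<open>G\<close>, then \<open>g x - x\<close> is a coboundary for every \<open>g\<close>, so the mean
  of the orbit of \<open>x\<close> is a fixed cocycle in the same class. If a fixed cocycle is the coboundary of \<open>y\<close>,
  then it is also the coboundary of the mean of the orbit of \<open>y\<close>, which is fixed. The family \<open>N\<close> is the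
  subcomplex of fixed points, given as separate records so that it can be instantiated with
  the morphism spaces of representations.
\<close>

lemma lin_iso_cohomology_fixed_points:
  fixes N :: "nat \<Rightarrow> ('k, 'm, 'b) module_scheme"
  assumes N: "\<And>n. module K (N n)"
    and carrier: "\<And>n. carrier (N n) = fixed_points G (C n)"
    and zero: "\<And>n. \<zero>\<^bsub>N n\<^esub> = \<zero>\<^bsub>C n\<^esub>"
    and add: "\<And>n x y. x \<oplus>\<^bsub>N n\<^esub> y = x \<oplus>\<^bsub>C n\<^esub> y"
    and smult: "\<And>n a x. a \<odot>\<^bsub>N n\<^esub> x = a \<odot>\<^bsub>C n\<^esub> x"
  shows "lin_iso K (cohomology N d n) (group_cohomology G (gcohomology C d n) 0)"
proof -
  let ?H = "gcohomology C d n" and ?B = "coboundaries C d n" and ?Z = "cocycles C d n"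
  interpret H: finite_linear_action K G ?H by (rule gcohomology_action)
  let ?I = "?H\<lparr>carrier := fixed_points G ?H\<rparr>"
  let ?m = "\<lambda>n x. mean K (C n) (carrier G) (\<lambda>g. gact (C n) g x)"
  have I: "module K ?I"
    by (rule submodule.submodule_is_module[OF H.submodule_fixed_points H.module_axioms])
  have inv_c: "x \<in> carrier (C n)" and inv_g: "g \<in> carrier G \<Longrightarrow> gact (C n) g x = x"
    if "x \<in> carrier (N n)" for n x g
    using that by (auto simp: carrier fixed_points_def)
  have dN: "d m \<in> lin_maps K (N m) (N (Suc m))" for m
    by (rule lin_mapsI)
       (auto simp: carrier fixed_points_def add smult diff_equivariant[symmetric]
          lin_maps_closed[OF diff_linear] lin_maps_add[OF diff_linear] lin_maps_smult[OF diff_linear])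
  have ZN: "x \<in> cocycles N d n \<longleftrightarrow> x \<in> carrier (N n) \<and> x \<in> ?Z" for x
    using inv_c by (auto simp: cocycles_def a_kernel_def' zero)
  have orbit: "(\<lambda>g. gact (C m) g x) \<in> carrier G \<rightarrow> carrier (C m)" if "x \<in> carrier (C m)" for m x
    using that gact_closed by auto
  have m_inv: "?m m x \<in> carrier (N m)" if "x \<in> carrier (C m)" for m x
    using Cn.mean_gact_invariant[OF that] by (simp add: carrier)
  have fixed: "?m m x = x" if "x \<in> carrier (N m)" for m x
    using that Cn.mean_const[OF complex_module inv_c[OF that]]
      Cn.mean_cong[OF complex_module, of "\<lambda>g. gact (C m) g x" "\<lambda>_. x" m] inv_c[OF that]
    by (simp add: inv_g)
  have d_mean: "d m (?m m x) = ?m (Suc m) (d m x)" if x: "x \<in> carrier (C m)" for m x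
  proof -
    have "d m (?m m x) = mean K (C (Suc m)) (carrier G) (\<lambda>g. d m (gact (C m) g x))"
      by (rule Cn.lin_maps_mean[OF diff_linear complex_module complex_module orbit[OF x]])
    also have "\<dots> = ?m (Suc m) (d m x)"
      using orbit[OF lin_maps_closed[OF diff_linear x]]
      by (intro Cn.mean_cong[OF complex_module]) (auto simp: diff_equivariant x)
    finally show ?thesis .
  qed
  have BN: "x \<in> coboundaries N d n \<longleftrightarrow> x \<in> ?B" if x: "x \<in> carrier (N n)" for x
  proof (cases n)
    case 0
    then show ?thesis by (simp add: coboundaries_def zero)
  next
    case (Suc m)
    have "x \<in> d m ` carrier (N m)" if y: "y \<in> carrier (C m)" "x = d m y" for y
      using d_mean[OF y(1)] fixed[of x "Suc m"] x y m_inv[OF y(1)] Suc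
      by (intro rev_image_eqI[of "?m m y"]) auto
    then show ?thesis
      using inv_c by (auto simp: coboundaries_def Suc)
  qed
  have "lin_iso K (cohomology N d n) ?I"
    unfolding cohomology_def
  proof (rule lin_iso_subquot[OF N _ _ I, where \<Phi> = "\<lambda>x. ?B +>\<^bsub>C n\<^esub> x"])
    show "submodule (cocycles N d n) K (N n)" "submodule (coboundaries N d n) K (N n)"
      by (intro submodule_cocycles submodule_coboundaries N dN)+
    have "X \<in> (\<lambda>x. ?B +>\<^bsub>C n\<^esub> x) ` cocycles N d n" if X: "X \<in> fixed_points G ?H" for X
    proof -
      obtain x where x: "x \<in> ?Z" "X = ?B +>\<^bsub>C n\<^esub> x"
        using X by (auto simp: fixed_points_def gcohomology_simps)
      have xc: "x \<in> carrier (C n)" using x(1) Cn.submoduleE(1)[OF sub_cocycles] by auto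
      have "gact (C n) g x \<ominus>\<^bsub>C n\<^esub> x \<in> ?B" if g: "g \<in> carrier G" for g
        using X g xc
        by (auto simp: fixed_points_def gcohomology_simps(5) x(2) gact_coset gact_closed
            Cn.coset_eq_iff[OF sub_coboundaries])
      then have "?m n x \<ominus>\<^bsub>C n\<^esub> x \<in> ?B"
        by (intro Cn.mean_minus_in_submodule[OF complex_module sub_coboundaries orbit] xc)
      then have "X = ?B +>\<^bsub>C n\<^esub> ?m n x"
        using Cn.coset_eq_iff[OF sub_coboundaries inv_c[OF m_inv[OF xc]] xc] x(2) by simp
      moreover have "?m n x \<in> ?Z"
        using x(1) gact_cocycle by (intro Cn.mean_in_submodule[OF complex_module sub_cocycles]) auto
      ultimately show ?thesis
        using m_inv[OF xc] ZN by blast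
    qed
    moreover have "?B +>\<^bsub>C n\<^esub> x \<in> fixed_points G ?H" if "x \<in> cocycles N d n" for x
      using that ZN by (auto simp: fixed_points_def gcohomology_simps gact_coset inv_g inv_c)
    ultimately show "(\<lambda>x. ?B +>\<^bsub>C n\<^esub> x) ` cocycles N d n = carrier ?I" by auto
    show "?B +>\<^bsub>C n\<^esub> x = \<zero>\<^bsub>?I\<^esub> \<longleftrightarrow> x \<in> coboundaries N d n" if "x \<in> cocycles N d n" for x
      using that ZN BN inv_c by (simp add: gcohomology_simps Cn.coset_eq_zero_iff[OF sub_coboundaries])
  qed (use ZN inv_c in \<open>auto simp: gcohomology_simps add smult cohomology_def
      Cn.subquot_simps(3,4)[OF sub_coboundaries]\<close>)
  moreover have "lin_iso K ?I (group_cohomology G ?H 0)"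
    by (rule lin_iso_sym[OF H.module_group_cohomology H.lin_iso_group_cohomology_0])
  ultimately show ?thesis by (rule lin_iso_trans)
qed

end

section \<open>Representations of the digroup of a group action\<close>

lemma rep_homD:
  assumes "f \<in> rep_hom K D V W"
  shows "f \<in> lin_maps K V W"
    and "\<lbrakk>x \<in> carrier D; v \<in> carrier V\<rbrakk> \<Longrightarrow> f (lact V x v) = lact W x (f v)"
    and "\<lbrakk>x \<in> carrier D; v \<in> carrier V\<rbrakk> \<Longrightarrow> f (ract V x v) = ract W x (f v)"
  using assms by (auto simp: rep_hom_def)

locale digroup_of_action = group_action G E \<phi>
  for G :: "('g, 'c) monoid_scheme" and E :: "'e set" and \<phi> :: "'g \<Rightarrow> 'e \<Rightarrow> 'e" +
  assumes nonempty: "E \<noteq> {}"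
begin

sublocale G: group G
  using group_hom by (rule group_hom.axioms(1))

abbreviation D where "D \<equiv> action_digroup G E \<phi>"

lemma D_simps:
  "x \<in> carrier D \<longleftrightarrow> fst x \<in> carrier G \<and> snd x \<in> E"
  "x \<in> halo D \<longleftrightarrow> fst x = \<one>\<^bsub>G\<^esub> \<and> snd x \<in> E"
  "(g, \<alpha>) \<turnstile>\<^bsub>D\<^esub> (h, \<beta>) = (g \<otimes>\<^bsub>G\<^esub> h, \<phi> g \<beta>)"
  "(g, \<alpha>) \<stileturn>\<^bsub>D\<^esub> (h, \<beta>) = (g \<otimes>\<^bsub>G\<^esub> h, \<alpha>)"
  by (simp_all add: action_digroup_def mem_Times_iff)

lemma act_closed: "\<lbrakk>g \<in> carrier G; \<alpha> \<in> E\<rbrakk> \<Longrightarrow> \<phi> g \<alpha> \<in> E"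
  using element_image by blast

lemma act_inverse: "\<lbrakk>g \<in> carrier G; \<alpha> \<in> E\<rbrakk> \<Longrightarrow> \<phi> g (\<phi> (inv\<^bsub>G\<^esub> g) \<alpha>) = \<alpha>"
  using composition_rule[of \<alpha> g "inv\<^bsub>G\<^esub> g"] id_eq_one by (metis G.inv_closed G.r_inv restrict_apply')

context
  fixes K :: "('k, 'a) ring_scheme" and V :: "('k, 'v, 'g \<times> 'e) rep"
  assumes V: "digroup_rep K D V"
begin

interpretation V: digroup_rep K D V by (rule V)

lemma rep_module: "module K V" by (rule V.module_axioms)

text \<open>
  From \<open>(g, \<alpha>) \<turnstile> (1, \<gamma>) = (g, g \<bullet> \<gamma>)\<close> and \<open>\<rho>\<^bsub>(1,\<gamma>)\<^esub> = id\<close> it follows that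
  \<open>\<rho>\<^bsub>(g,\<alpha>)\<^esub> = \<rho>\<^bsub>(g, g \<bullet> \<gamma>)\<^esub>\<close>, and \<open>g \<bullet> \<gamma>\<close> takes every value in \<open>E\<close>.
\<close>

lemma ract_eq_rho:
  assumes g: "g \<in> carrier G" and \<alpha>: "\<alpha> \<in> E" and v: "v \<in> carrier V"
  shows "ract V (g, \<alpha>) v = rho E V g v"
proof -
  have indep: "ract V (g, \<beta>) v = ract V (g, \<alpha>) v" if "\<alpha> \<in> E" "\<beta> \<in> E" for \<alpha> \<beta>
  proof -
    obtain \<gamma> where \<gamma>: "\<gamma> \<in> E" "\<phi> g \<gamma> = \<beta>"
      using bij_prop1[OF g \<open>\<beta> \<in> E\<close>] by blast
    then show ?thesis
      using V.ract_vdash[of "(g, \<alpha>)" "(\<one>\<^bsub>G\<^esub>, \<gamma>)" v] V.ract_halo[of "(\<one>\<^bsub>G\<^esub>, \<gamma>)" v] g v that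
      by (simp add: D_simps)
  qed
  have "(SOME \<alpha>. \<alpha> \<in> E) \<in> E" using nonempty by (simp add: some_in_eq)
  then show ?thesis unfolding rho_def using indep \<alpha> by blast
qed

lemma rho_linear: "g \<in> carrier G \<Longrightarrow> rho E V g \<in> lin_maps K V V"
  using nonempty by (auto simp: rho_def D_simps some_in_eq intro: V.ract_End)

lemma rho_closed: "\<lbrakk>g \<in> carrier G; v \<in> carrier V\<rbrakk> \<Longrightarrow> rho E V g v \<in> carrier V"
  by (rule lin_maps_closed[OF rho_linear])

lemma rho_one: "v \<in> carrier V \<Longrightarrow> rho E V \<one>\<^bsub>G\<^esub> v = v"
  using nonempty by (auto simp: rho_def D_simps some_in_eq intro: V.ract_halo)

lemma rho_mult:
  assumes "g \<in> carrier G" "h \<in> carrier G" "v \<in> carrier V"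
  shows "rho E V (g \<otimes>\<^bsub>G\<^esub> h) v = rho E V g (rho E V h v)"
proof -
  obtain \<alpha> where "\<alpha> \<in> E" using nonempty by auto
  then show ?thesis
    using V.ract_vdash[of "(g, \<alpha>)" "(h, \<alpha>)" v] assms
    by (simp add: D_simps ract_eq_rho rho_closed act_closed)
qed

lemma rho_inverse:
  assumes "g \<in> carrier G" "v \<in> carrier V"
  shows "rho E V g (rho E V (inv\<^bsub>G\<^esub> g) v) = v" "rho E V (inv\<^bsub>G\<^esub> g) (rho E V g v) = v"
  using assms by (simp_all add: rho_mult[symmetric] rho_one)

lemma inv_into_rho:
  assumes "g \<in> carrier G" "v \<in> carrier V"
  shows "inv_into (carrier V) (rho E V g) v = rho E V (inv\<^bsub>G\<^esub> g) v"
proof (rule inv_into_f_eq)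
  show "inj_on (rho E V g) (carrier V)"
    by (rule inj_on_inverseI[of _ "rho E V (inv\<^bsub>G\<^esub> g)"]) (simp add: rho_inverse assms)
qed (use assms in \<open>simp_all add: rho_inverse rho_closed\<close>)

lemma lact_linear: "\<lbrakk>g \<in> carrier G; \<alpha> \<in> E\<rbrakk> \<Longrightarrow> lact V (g, \<alpha>) \<in> lin_maps K V V"
  by (rule V.lact_End) (simp add: D_simps)

lemma lact_closed: "\<lbrakk>g \<in> carrier G; \<alpha> \<in> E; v \<in> carrier V\<rbrakk> \<Longrightarrow> lact V (g, \<alpha>) v \<in> carrier V"
  by (rule lin_maps_closed[OF lact_linear])

lemma rho_lact:
  assumes "g \<in> carrier G" "h \<in> carrier G" "\<alpha> \<in> E" "v \<in> carrier V"
  shows "rho E V g (lact V (h, \<alpha>) v) = lact V (g \<otimes>\<^bsub>G\<^esub> h, \<phi> g \<alpha>) v"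
  using V.ract_lact[of "(g, \<alpha>)" "(h, \<alpha>)" v] assms
  by (simp add: D_simps ract_eq_rho lact_closed)

lemma lact_rho:
  assumes "g \<in> carrier G" "h \<in> carrier G" "\<alpha> \<in> E" "v \<in> carrier V"
  shows "lact V (g, \<alpha>) (rho E V h v) = lact V (g \<otimes>\<^bsub>G\<^esub> h, \<alpha>) v"
  using V.lact_ract[of "(g, \<alpha>)" "(h, \<alpha>)" v] assms by (simp add: D_simps ract_eq_rho)

text \<open>
  Conjugation by \<open>\<rho>\<^sub>g\<close> permutes the operators \<open>\<epsilon>\<^sub>\<alpha>\<close>; this is why \<open>G\<close> acts on \<open>Hom\<^bsub>B\<^esub>(Q, V)\<close>.
\<close>

lemma rho_halo:
  assumes "g \<in> carrier G" "\<alpha> \<in> E" "v \<in> carrier V"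
  shows "rho E V g (lact V (\<one>\<^bsub>G\<^esub>, \<alpha>) v) = lact V (\<one>\<^bsub>G\<^esub>, \<phi> g \<alpha>) (rho E V g v)"
  using assms by (simp add: rho_lact lact_rho act_closed)

text \<open>The operators of a representation satisfy the defining relations of \<open>B\<^sub>E\<close>.\<close>

lemma halo_term_act_linear:
  "t \<in> halo_terms K E \<Longrightarrow> halo_term_act G V t \<in> lin_maps K V V"
proof (induction rule: halo_terms.induct)
  case (1 c)
  then show ?case
    by (intro lin_mapsI) (auto simp: V.smult_r_distr V.smult_assoc1[symmetric] V.R.m_comm)
next
  case (2 \<alpha>)
  have "halo_term_act G V (Eps \<alpha> :: ('k, 'e) halo_term) = lact V (\<one>\<^bsub>G\<^esub>, \<alpha>)" by auto
  then show ?case using lact_linear[OF G.one_closed \<open>\<alpha> \<in> E\<close>] by metis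
next
  case (3 s t)
  have "halo_term_act G V (Plus s t) = (\<lambda>v. halo_term_act G V s v \<oplus>\<^bsub>V\<^esub> halo_term_act G V t v)" by auto
  then show ?case using lin_maps_pointwise_add[OF 3(3,4) rep_module] by metis
next
  case (4 s t)
  have "halo_term_act G V (Times s t) = (\<lambda>v. halo_term_act G V s (halo_term_act G V t v))" by auto
  then show ?case using lin_maps_compose[OF 4(4,3)] by metis
qed

lemma halo_eq_sound:
  assumes "halo_eq K E s t"
  shows "\<forall>v\<in>carrier V. halo_term_act G V s v \<in> carrier V \<and> halo_term_act G V s v = halo_term_act G V t v"
proof -
  note lin = halo_term_act_linear
  note c = lin_maps_closed[OF lin]
  show ?thesis
    using assms
  proof (induction rule: halo_eq.induct)
    case (Plus_cong s s' t t')
    then show ?case by (metis V.M.a_closed halo_term_act.simps(3))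
  next
    case (Times_cong s s' t t')
    then show ?case by (metis halo_term_act.simps(4))
  next
    case (Plus_neg t)
    then show ?case by (auto simp: c V.smult_l_minus V.M.l_neg)
  next
    case (distrib_left s t u)
    then show ?case by (auto simp: c lin_maps_add[OF lin])
  next
    case (Scal_central a t)
    then show ?case by (auto simp: c lin_maps_smult[OF lin])
  next
    case (Eps_Eps \<alpha> \<beta>)
    have "lact V (\<one>\<^bsub>G\<^esub>, \<alpha>) (lact V (\<one>\<^bsub>G\<^esub>, \<beta>) v) = lact V (\<one>\<^bsub>G\<^esub>, \<alpha>) v"
      if "v \<in> carrier V" for v
      using V.lact_dashv[of "(\<one>\<^bsub>G\<^esub>, \<alpha>)" "(\<one>\<^bsub>G\<^esub>, \<beta>)" v, symmetric] Eps_Eps that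
      by (simp add: D_simps)
    then show ?case using Eps_Eps by (simp add: lact_closed)
  qed (auto simp: c V.M.a_ac V.smult_l_distr V.smult_assoc1)
qed

lemma halo_act_class:
  assumes t: "t \<in> halo_terms K E" and v: "v \<in> carrier V"
  shows "halo_act G V (halo_class K E t) v = halo_term_act G V t v"
proof -
  have "(SOME s. s \<in> halo_class K E t) \<in> halo_class K E t"
    by (rule someI[of _ t]) (simp add: halo_class_def halo_eq.refl[OF t])
  then show ?thesis
    using halo_eq_sound v by (simp add: halo_act_def halo_class_def)
qed

end

context
  fixes K :: "('k, 'a) ring_scheme" and V :: "('k, 'v, 'g \<times> 'e) rep" and W :: "('k, 'w, 'g \<times> 'e) rep"
  assumes V: "digroup_rep K D V" and W: "digroup_rep K D W"
begin

interpretation V: digroup_rep K D V by (rule V)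
interpretation W: digroup_rep K D W by (rule W)

text \<open>
  Linearity over \<open>B\<^sub>E\<close> need only be tested on generators: the constants \<open>Scal c\<close> give linearity over \<open>K\<close>,
  and the \<open>\<epsilon>\<^sub>\<alpha>\<close> give the remaining condition.
\<close>

lemma halo_hom_iff:
  "f \<in> halo_hom K G E V W \<longleftrightarrow> f \<in> lin_maps K V W \<and> f \<in> extensional (carrier V) \<and>
     (\<forall>\<alpha>\<in>E. \<forall>v\<in>carrier V. f (lact V (\<one>\<^bsub>G\<^esub>, \<alpha>) v) = lact W (\<one>\<^bsub>G\<^esub>, \<alpha>) (f v))"
    (is "?L \<longleftrightarrow> ?R")
proof
  assume f: ?L
  then have c: "f v \<in> carrier W" if "v \<in> carrier V" for v
    using that by (auto simp: halo_hom_def)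
  have terms: "f (halo_term_act G V t v) = halo_term_act G W t (f v)"
    if "t \<in> halo_terms K E" "v \<in> carrier V" for t v
  proof -
    have "f (halo_act G V (halo_class K E t) v) = halo_act G W (halo_class K E t) (f v)"
      using f that by (auto simp: halo_hom_def halo_algebra_def)
    then show ?thesis
      using halo_act_class[OF V that] halo_act_class[OF W that(1) c[OF that(2)]] by simp
  qed
  have "f \<in> lin_maps K V W"
    using f c terms[OF halo_terms.intros(1)] by (auto simp: halo_hom_def intro!: lin_mapsI)
  then show ?R
    using f terms[OF halo_terms.intros(2)] by (auto simp: halo_hom_def PiE_def)
next
  assume R: ?R
  then have lin: "f \<in> lin_maps K V W" by blast
  note fc = lin_maps_closed[OF lin]
  have terms: "\<forall>v\<in>carrier V. f (halo_term_act G V t v) = halo_term_act G W t (f v)"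
    if "t \<in> halo_terms K E" for t
    using that
  proof (induction rule: halo_terms.induct)
    case (3 s t)
    then show ?case
      using lin_maps_closed[OF halo_term_act_linear[OF V 3(1)]]
        lin_maps_closed[OF halo_term_act_linear[OF V 3(2)]]
      by (auto simp: lin_maps_add[OF lin])
  next
    case (4 s t)
    then show ?case
      using lin_maps_closed[OF halo_term_act_linear[OF V 4(2)]] by auto
  qed (use R in \<open>auto simp: lin_maps_smult[OF lin]\<close>)
  show ?L
    using R terms by (auto simp: halo_hom_def halo_algebra_def PiE_def fc lin_maps_add[OF lin]
        halo_act_class[OF V] halo_act_class[OF W])
qed

lemma halo_hom_subset: "halo_hom K G E V W \<subseteq> carrier V \<rightarrow>\<^sub>E carrier W"
  by (auto simp: halo_hom_def)

text \<open>Because \<open>\<lambda>\<^bsub>(g,\<alpha>)\<^esub> = \<lambda>\<^bsub>(1,\<alpha>)\<^esub> \<rho>\<^sub>g\<close>, a \<open>B\<^sub>E\<close>-linear map that commutes with all \<open>\<rho>\<^sub>g\<close> is a morphism.\<close>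

lemma rep_hom_iff_halo_hom:
  "f \<in> rep_hom K D V W \<inter> extensional (carrier V) \<longleftrightarrow>
   f \<in> halo_hom K G E V W \<and> (\<forall>g\<in>carrier G. \<forall>v\<in>carrier V. f (rho E V g v) = rho E W g (f v))"
    (is "?L \<longleftrightarrow> ?R")
proof
  assume L: ?L
  then have f: "f \<in> rep_hom K D V W" by simp
  have "f (rho E V g v) = rho E W g (f v)" if "g \<in> carrier G" "v \<in> carrier V" for g v
    using rep_homD(3)[OF f, of "(g, SOME \<alpha>. \<alpha> \<in> E)" v] that nonempty
    by (simp add: rho_def D_simps some_in_eq)
  then show ?R
    using L rep_homD[OF f] by (auto simp: halo_hom_iff D_simps)
next
  assume R: ?R
  then have lin: "f \<in> lin_maps K V W" by (simp add: halo_hom_iff)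
  note fc = lin_maps_closed[OF lin]
  have "f (ract V (g, \<alpha>) v) = ract W (g, \<alpha>) (f v)"
    and "f (lact V (g, \<alpha>) v) = lact W (g, \<alpha>) (f v)"
    if "g \<in> carrier G" "\<alpha> \<in> E" "v \<in> carrier V" for g \<alpha> v
  proof -
    show "f (ract V (g, \<alpha>) v) = ract W (g, \<alpha>) (f v)"
      using R that fc by (simp add: ract_eq_rho[OF V] ract_eq_rho[OF W])
    have "f (lact V (\<one>\<^bsub>G\<^esub>, \<alpha>) (rho E V g v)) = lact W (\<one>\<^bsub>G\<^esub>, \<alpha>) (rho E W g (f v))"
      using R that by (simp add: halo_hom_iff rho_closed[OF V])
    then show "f (lact V (g, \<alpha>) v) = lact W (g, \<alpha>) (f v)"
      using that fc by (simp add: lact_rho[OF V] lact_rho[OF W])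
  qed
  then show ?L
    using R lin by (auto simp: rep_hom_def halo_hom_iff D_simps)
qed

lemma halo_Hom_simps:
  "carrier (halo_Hom K G E V W) = halo_hom K G E V W"
  "\<zero>\<^bsub>halo_Hom K G E V W\<^esub> = (\<lambda>v\<in>carrier V. \<zero>\<^bsub>W\<^esub>)"
  "f \<oplus>\<^bsub>halo_Hom K G E V W\<^esub> f' = (\<lambda>v\<in>carrier V. f v \<oplus>\<^bsub>W\<^esub> f' v)"
  "a \<odot>\<^bsub>halo_Hom K G E V W\<^esub> f = (\<lambda>v\<in>carrier V. a \<odot>\<^bsub>W\<^esub> f v)"
  "gact (halo_Hom K G E V W) g f =
     (\<lambda>v\<in>carrier V. rho E W g (f (inv_into (carrier V) (rho E V g) v)))"
  by (simp_all add: halo_Hom_def module.defs gmodule.defs)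

lemma halo_hom_restrict:
  assumes "f \<in> lin_maps K V W"
    and "\<And>\<alpha> v. \<lbrakk>\<alpha> \<in> E; v \<in> carrier V\<rbrakk> \<Longrightarrow> f (lact V (\<one>\<^bsub>G\<^esub>, \<alpha>) v) = lact W (\<one>\<^bsub>G\<^esub>, \<alpha>) (f v)"
  shows "restrict f (carrier V) \<in> halo_hom K G E V W"
  using assms by (auto simp: halo_hom_iff lin_maps_def lact_closed[OF V])

lemma halo_homD:
  assumes "f \<in> halo_hom K G E V W"
  shows "f \<in> lin_maps K V W"
    and "\<lbrakk>\<alpha> \<in> E; v \<in> carrier V\<rbrakk> \<Longrightarrow> f (lact V (\<one>\<^bsub>G\<^esub>, \<alpha>) v) = lact W (\<one>\<^bsub>G\<^esub>, \<alpha>) (f v)"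
    and "v \<in> carrier V \<Longrightarrow> f v \<in> carrier W"
  using assms by (auto simp: halo_hom_iff intro: lin_maps_closed)

lemma halo_hom_closed:
  shows "(\<lambda>v\<in>carrier V. \<zero>\<^bsub>W\<^esub>) \<in> halo_hom K G E V W"
    and "\<lbrakk>f \<in> halo_hom K G E V W; f' \<in> halo_hom K G E V W\<rbrakk>
      \<Longrightarrow> (\<lambda>v\<in>carrier V. f v \<oplus>\<^bsub>W\<^esub> f' v) \<in> halo_hom K G E V W"
    and "\<lbrakk>a \<in> carrier K; f \<in> halo_hom K G E V W\<rbrakk>
      \<Longrightarrow> (\<lambda>v\<in>carrier V. a \<odot>\<^bsub>W\<^esub> f v) \<in> halo_hom K G E V W"
proof -
  note lactW = lact_linear[OF W G.one_closed]
  show "(\<lambda>v\<in>carrier V. \<zero>\<^bsub>W\<^esub>) \<in> halo_hom K G E V W"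
    by (rule halo_hom_restrict)
       (auto intro!: lin_mapsI simp: lin_maps_zero[OF lactW W.module_axioms W.module_axioms])
  show "(\<lambda>v\<in>carrier V. f v \<oplus>\<^bsub>W\<^esub> f' v) \<in> halo_hom K G E V W"
    if f: "f \<in> halo_hom K G E V W" and f': "f' \<in> halo_hom K G E V W"
    using lin_maps_pointwise_add[OF halo_homD(1)[OF f] halo_homD(1)[OF f'] W.module_axioms]
    by (rule halo_hom_restrict)
       (simp add: lin_maps_add[OF lactW] halo_homD(2,3)[OF f] halo_homD(2,3)[OF f'])
  show "(\<lambda>v\<in>carrier V. a \<odot>\<^bsub>W\<^esub> f v) \<in> halo_hom K G E V W"
    if a: "a \<in> carrier K" and f: "f \<in> halo_hom K G E V W"
  proof (rule halo_hom_restrict)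
    show "(\<lambda>v. a \<odot>\<^bsub>W\<^esub> f v) \<in> lin_maps K V W"
      using lin_maps_compose[OF halo_homD(1)[OF f] halo_term_act_linear[OF W halo_terms.intros(1)[OF a]]]
      by simp
  qed (simp add: a lin_maps_smult[OF lactW] halo_homD(2,3)[OF f])
qed

lemma module_halo_Hom: "module K (halo_Hom K G E V W)"
proof -
  have "module K (fun_module (carrier V) (halo_hom K G E V W) W)"
    by (rule module_fun_module[OF W.module_axioms halo_hom_subset]) (auto intro: halo_hom_closed)
  then show ?thesis
    by (rule module_same_operations) (simp_all add: halo_Hom_simps)
qed

lemma gact_halo_Hom:
  assumes "g \<in> carrier G" "v \<in> carrier V"
  shows "gact (halo_Hom K G E V W) g f v = rho E W g (f (rho E V (inv\<^bsub>G\<^esub> g) v))"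
  using assms by (simp add: halo_Hom_simps inv_into_rho[OF V])

lemma gact_halo_hom:
  assumes g: "g \<in> carrier G" and f: "f \<in> halo_hom K G E V W"
  shows "gact (halo_Hom K G E V W) g f \<in> halo_hom K G E V W"
proof -
  let ?h = "\<lambda>v. rho E W g (f (rho E V (inv\<^bsub>G\<^esub> g) v))"
  have "restrict ?h (carrier V) \<in> halo_hom K G E V W"
  proof (rule halo_hom_restrict)
    show "?h \<in> lin_maps K V W"
      by (rule lin_maps_compose[OF lin_maps_compose[OF rho_linear[OF V G.inv_closed[OF g]]
              halo_homD(1)[OF f]] rho_linear[OF W g]])
    show "?h (lact V (\<one>\<^bsub>G\<^esub>, \<alpha>) v) = lact W (\<one>\<^bsub>G\<^esub>, \<alpha>) (?h v)" if "\<alpha> \<in> E" "v \<in> carrier V" for \<alpha> v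
      using g that
      by (simp add: rho_halo[OF V] rho_halo[OF W] act_closed rho_closed[OF V] halo_homD(2,3)[OF f]
          act_inverse)
  qed
  moreover have "gact (halo_Hom K G E V W) g f = restrict ?h (carrier V)"
    using g by (auto simp: halo_Hom_simps inv_into_rho[OF V])
  ultimately show ?thesis by simp
qed

lemma halo_Hom_action: "linear_action K G (halo_Hom K G E V W)"
proof (intro linear_action.intro linear_action_axioms.intro module_halo_Hom G.group_axioms)
  fix g assume g: "g \<in> carrier G"
  have c: "f (rho E V (inv\<^bsub>G\<^esub> g) v) \<in> carrier W" if "f \<in> halo_hom K G E V W" "v \<in> carrier V" for f v
    using that g by (intro halo_homD(3)[OF that(1)] rho_closed[OF V]) auto
  show "gact (halo_Hom K G E V W) g \<in> lin_maps K (halo_Hom K G E V W) (halo_Hom K G E V W)"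
    using g gact_halo_hom[OF g]
    by (intro lin_mapsI)
       (auto simp: halo_Hom_simps inv_into_rho[OF V] rho_closed[OF V] fun_eq_iff c
          lin_maps_add[OF rho_linear[OF W g]] lin_maps_smult[OF rho_linear[OF W g]])
next
  fix f assume "f \<in> carrier (halo_Hom K G E V W)"
  then have f: "f \<in> halo_hom K G E V W" by (simp add: halo_Hom_simps)
  then have ext: "f v = undefined" if "v \<notin> carrier V" for v
    using that by (auto simp: halo_hom_def)
  show "gact (halo_Hom K G E V W) \<one>\<^bsub>G\<^esub> f = f"
    by (auto simp: halo_Hom_simps inv_into_rho[OF V] rho_one[OF V] rho_one[OF W] fun_eq_iff ext
        halo_homD(3)[OF f])
  fix g h assume g: "g \<in> carrier G" and h: "h \<in> carrier G"
  then show "gact (halo_Hom K G E V W) (g \<otimes>\<^bsub>G\<^esub> h) f =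
      gact (halo_Hom K G E V W) g (gact (halo_Hom K G E V W) h f)"
    by (auto simp: halo_Hom_simps inv_into_rho[OF V] rho_mult[OF V] rho_mult[OF W] fun_eq_iff
        halo_homD(3)[OF f] rho_closed[OF V] G.inv_mult_group)
qed

text \<open>
  \<open>Hom\<^bsub>B\<^esub>(V, W)\<^sup>G = Hom\<^sub>D(V, W)\<close>, because \<open>g \<cdot> f = f\<close> says that \<open>f\<close> commutes with \<open>\<rho>\<^sub>g\<close>.
\<close>

lemma fixed_points_halo_Hom:
  "fixed_points G (halo_Hom K G E V W) = rep_hom K D V W \<inter> extensional (carrier V)"
proof -
  have "(gact (halo_Hom K G E V W) g f = f) \<longleftrightarrow>
      (\<forall>v\<in>carrier V. f (rho E V g v) = rho E W g (f v))"
    if f: "f \<in> halo_hom K G E V W" and g: "g \<in> carrier G" for f g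
  proof
    assume eq: "gact (halo_Hom K G E V W) g f = f"
    show "\<forall>v\<in>carrier V. f (rho E V g v) = rho E W g (f v)"
      using gact_halo_Hom[OF g, of "rho E V g v" f for v] eq g
      by (auto simp: rho_closed[OF V] rho_inverse[OF V])
  next
    assume eq: "\<forall>v\<in>carrier V. f (rho E V g v) = rho E W g (f v)"
    have "f v = undefined" if "v \<notin> carrier V" for v
      using f that by (auto simp: halo_hom_def)
    moreover have "rho E W g (f (rho E V (inv\<^bsub>G\<^esub> g) v)) = f v" if "v \<in> carrier V" for v
      using eq that g by (simp add: rho_closed[OF V] rho_inverse[OF V] flip: bspec[OF eq])
    ultimately show "gact (halo_Hom K G E V W) g f = f"
      using g by (auto simp: halo_Hom_simps inv_into_rho[OF V] fun_eq_iff)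
  qed
  then have "f \<in> fixed_points G (halo_Hom K G E V W) \<longleftrightarrow>
      f \<in> halo_hom K G E V W \<and> (\<forall>g\<in>carrier G. \<forall>v\<in>carrier V. f (rho E V g v) = rho E W g (f v))" for f
    unfolding fixed_points_def halo_Hom_simps(1) by auto
  then show ?thesis
    using rep_hom_iff_halo_hom by blast
qed

end

end

section \<open>Morphisms of representations\<close>

lemma rep_homI:
  assumes "f \<in> lin_maps K V W"
    and "\<And>x v. \<lbrakk>x \<in> carrier D; v \<in> carrier V\<rbrakk> \<Longrightarrow> f (lact V x v) = lact W x (f v)"
    and "\<And>x v. \<lbrakk>x \<in> carrier D; v \<in> carrier V\<rbrakk> \<Longrightarrow> f (ract V x v) = ract W x (f v)"
  shows "f \<in> rep_hom K D V W"
  using assms by (auto simp: rep_hom_def)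

lemma rep_hom_in: "\<lbrakk>f \<in> rep_hom K D V W; v \<in> carrier V\<rbrakk> \<Longrightarrow> f v \<in> carrier W"
  by (rule lin_maps_closed[OF rep_homD(1)])

lemma rep_hom_compose:
  assumes f: "f \<in> rep_hom K D U V" and g: "g \<in> rep_hom K D V W"
  shows "(\<lambda>x. g (f x)) \<in> rep_hom K D U W"
  using lin_maps_compose[OF rep_homD(1)[OF f] rep_homD(1)[OF g]]
  by (rule rep_homI) (simp_all add: rep_homD(2,3)[OF f] rep_homD(2,3)[OF g] rep_hom_in[OF f])

lemma rep_hom_id: "(\<lambda>x. x) \<in> rep_hom K D V V"
  by (auto simp: rep_hom_def lin_maps_def)

context
  fixes K :: "('k, 'a) ring_scheme" and D :: "'d digroup"
    and V :: "('k, 'v, 'd) rep" and W :: "('k, 'w, 'd) rep"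
  assumes V: "digroup_rep K D V" and W: "digroup_rep K D W"
begin

interpretation V: digroup_rep K D V by (rule V)
interpretation W: digroup_rep K D W by (rule W)

lemma rep_hom_zero: "(\<lambda>_. \<zero>\<^bsub>W\<^esub>) \<in> rep_hom K D V W"
  by (rule rep_homI)
     (auto intro!: lin_mapsI simp: lin_maps_zero[OF W.lact_End W.module_axioms W.module_axioms]
        lin_maps_zero[OF W.ract_End W.module_axioms W.module_axioms])

lemma rep_hom_add:
  assumes f: "f \<in> rep_hom K D V W" and g: "g \<in> rep_hom K D V W"
  shows "(\<lambda>x. f x \<oplus>\<^bsub>W\<^esub> g x) \<in> rep_hom K D V W"
  using lin_maps_pointwise_add[OF rep_homD(1)[OF f] rep_homD(1)[OF g] W.module_axioms]
  by (rule rep_homI)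
     (simp_all add: rep_homD(2,3)[OF f] rep_homD(2,3)[OF g] rep_hom_in[OF f] rep_hom_in[OF g]
        lin_maps_add[OF W.lact_End] lin_maps_add[OF W.ract_End])

lemma rep_hom_minus:
  assumes f: "f \<in> rep_hom K D V W" and g: "g \<in> rep_hom K D V W"
  shows "(\<lambda>x. f x \<ominus>\<^bsub>W\<^esub> g x) \<in> rep_hom K D V W"
  using lin_maps_pointwise_minus[OF rep_homD(1)[OF f] rep_homD(1)[OF g] W.module_axioms]
  by (rule rep_homI)
     (simp_all add: rep_homD(2,3)[OF f] rep_homD(2,3)[OF g] rep_hom_in[OF f] rep_hom_in[OF g]
        lin_maps_minus[OF W.lact_End W.module_axioms W.module_axioms]
        lin_maps_minus[OF W.ract_End W.module_axioms W.module_axioms])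

lemma rep_hom_smult:
  assumes a: "a \<in> carrier K" and f: "f \<in> rep_hom K D V W"
  shows "(\<lambda>x. a \<odot>\<^bsub>W\<^esub> f x) \<in> rep_hom K D V W"
proof (rule rep_homI)
  show "(\<lambda>x. a \<odot>\<^bsub>W\<^esub> f x) \<in> lin_maps K V W"
    using a by (intro lin_mapsI)
      (auto simp: rep_hom_in[OF f] lin_maps_add[OF rep_homD(1)[OF f]] W.smult_r_distr
        lin_maps_smult[OF rep_homD(1)[OF f]] W.smult_assoc1[symmetric] V.R.m_comm)
qed (simp_all add: a rep_homD(2,3)[OF f] rep_hom_in[OF f]
      lin_maps_smult[OF W.lact_End] lin_maps_smult[OF W.ract_End])

lemma rep_hom_restrict:
  assumes "f \<in> rep_hom K D V W"
  shows "restrict f (carrier V) \<in> rep_hom K D V W \<inter> extensional (carrier V)"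
  using assms lin_maps_closed[OF V.lact_End] lin_maps_closed[OF V.ract_End]
  by (auto simp: rep_hom_def lin_maps_def)

lemma rep_Hom_subset:
  "rep_hom K D V W \<inter> extensional (carrier V) \<subseteq> carrier V \<rightarrow>\<^sub>E carrier W"
  using rep_hom_in by (auto simp: PiE_def)

lemma module_rep_Hom: "module K (rep_Hom K D V W)"
  unfolding rep_Hom_def
  by (rule module_fun_module[OF W.module_axioms rep_Hom_subset])
     (auto intro!: rep_hom_restrict[THEN IntD1] rep_hom_zero rep_hom_add rep_hom_smult)

lemma eval_rep_Hom: "v \<in> carrier V \<Longrightarrow> (\<lambda>f. f v) \<in> lin_maps K (rep_Hom K D V W) W"
  unfolding rep_Hom_def by (rule eval_linear[OF rep_Hom_subset])

lemma rep_Hom_minus: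
  assumes "f \<in> carrier (rep_Hom K D V W)" "g \<in> carrier (rep_Hom K D V W)" "v \<in> carrier V"
  shows "(f \<ominus>\<^bsub>rep_Hom K D V W\<^esub> g) v = f v \<ominus>\<^bsub>W\<^esub> g v"
  using lin_maps_minus[OF eval_rep_Hom[OF assms(3)] module_rep_Hom W.module_axioms assms(1,2)] .

lemma digroup_rep_image:
  assumes u: "u \<in> rep_hom K D V W"
  shows "digroup_rep K D (W\<lparr>carrier := u ` carrier V\<rparr>)"
proof -
  let ?U = "W\<lparr>carrier := u ` carrier V\<rparr>"
  have m: "module K ?U"
    by (rule submodule.submodule_is_module[OF
          submodule_image[OF rep_homD(1)[OF u] V.module_axioms W.module_axioms] W.module_axioms])
  have l: "lact W x (u v) \<in> u ` carrier V" and r: "ract W x (u v) \<in> u ` carrier V"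
    if "x \<in> carrier D" "v \<in> carrier V" for x v
    using that lin_maps_closed[OF V.lact_End] lin_maps_closed[OF V.ract_End]
    by (auto simp: rep_homD(2,3)[OF u, symmetric])
  note uc = rep_hom_in[OF u]
  show ?thesis
  proof (intro digroup_rep.intro digroup_rep_axioms.intro m)
    fix x assume x: "x \<in> carrier D"
    show "lact ?U x \<in> lin_maps K ?U ?U"
      using x l by (intro lin_mapsI)
        (auto simp: uc lin_maps_add[OF W.lact_End] lin_maps_smult[OF W.lact_End])
    show "ract ?U x \<in> lin_maps K ?U ?U"
      using x r by (intro lin_mapsI)
        (auto simp: uc lin_maps_add[OF W.ract_End] lin_maps_smult[OF W.ract_End])
    have "inj_on (ract W x) (u ` carrier V)"
      using W.ract_bij[OF x] uc by (auto simp: bij_betw_def intro: inj_on_subset)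
    moreover have "u v \<in> ract W x ` u ` carrier V" if "v \<in> carrier V" for v
    proof -
      from that V.ract_bij[OF x] obtain v' where v': "v' \<in> carrier V" "v = ract V x v'"
        by (auto simp: bij_betw_def)
      then show ?thesis by (simp add: rep_homD(3)[OF u x])
    qed
    ultimately show "bij_betw (ract ?U x) (carrier ?U) (carrier ?U)"
      using r[OF x] by (auto simp: bij_betw_def)
  qed (auto simp: uc W.lact_dashv W.ract_vdash W.ract_halo W.ract_lact W.lact_ract)
qed

end

lemma compose_rep_Hom:
  assumes Q: "digroup_rep K D Q" and V: "digroup_rep K D V" and W: "digroup_rep K D W"
    and f: "f \<in> rep_hom K D V W"
  shows "compose (carrier Q) f \<in> lin_maps K (rep_Hom K D Q V) (rep_Hom K D Q W)"
  unfolding rep_Hom_def[of K D Q W]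
proof (rule lin_maps_fun_moduleI[OF _ rep_Hom_subset[OF Q W] module_rep_Hom[OF Q V]])
  show "compose (carrier Q) f c \<in> rep_hom K D Q W \<inter> extensional (carrier Q)"
    if "c \<in> carrier (rep_Hom K D Q V)" for c
    using rep_hom_restrict[OF Q W rep_hom_compose[OF _ f, of c Q]] that
    by (simp add: rep_Hom_def compose_def)
  show "(\<lambda>c. compose (carrier Q) f c q) \<in> lin_maps K (rep_Hom K D Q V) W" if "q \<in> carrier Q" for q
    using lin_maps_compose[OF eval_rep_Hom[OF Q V that] rep_homD(1)[OF f]] that
    by (simp add: compose_def)
qed

text \<open>
  The extension property of an injective object, in the form in which it is used below: \<open>v\<close> factors
  through \<open>u\<close> as soon as it vanishes on the kernel of \<open>u\<close>. The map to be extended lives on the image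
  of \<open>u\<close>, so that no quotient representation has to be formed.
\<close>

lemma injective_factor:
  fixes A B J :: "('k, 'v, 'd) rep"
  assumes A: "digroup_rep K D A" and B: "digroup_rep K D B" and J: "injective_rep K D J"
    and u: "u \<in> rep_hom K D A B" and v: "v \<in> rep_hom K D A J"
    and ker: "\<And>x. \<lbrakk>x \<in> carrier A; u x = \<zero>\<^bsub>B\<^esub>\<rbrakk> \<Longrightarrow> v x = \<zero>\<^bsub>J\<^esub>"
  shows "\<exists>h\<in>rep_hom K D B J. \<forall>x\<in>carrier A. h (u x) = v x"
proof -
  have Jrep: "digroup_rep K D J" using J by (simp add: injective_rep_def)
  interpret A: digroup_rep K D A by (rule A)
  interpret B: digroup_rep K D B by (rule B)
  interpret J: digroup_rep K D J by (rule Jrep)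
  let ?U = "B\<lparr>carrier := u ` carrier A\<rparr>"
  define f where "f y = v (inv_into (carrier A) u y)" for y
  have f: "f (u x) = v x" if x: "x \<in> carrier A" for x
  proof -
    let ?x' = "inv_into (carrier A) u (u x)"
    have x': "?x' \<in> carrier A" "u ?x' = u x"
      using x by (auto intro: inv_into_into f_inv_into_f)
    then have "u (?x' \<ominus>\<^bsub>A\<^esub> x) = \<zero>\<^bsub>B\<^esub>"
      using x rep_hom_in[OF u x]
      by (simp add: lin_maps_minus[OF rep_homD(1)[OF u] A.module_axioms B.module_axioms]
          B.M.minus_eq_zero_iff)
    then have "v ?x' \<ominus>\<^bsub>J\<^esub> v x = \<zero>\<^bsub>J\<^esub>"
      using ker[of "?x' \<ominus>\<^bsub>A\<^esub> x"] x x'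
      by (simp add: lin_maps_minus[OF rep_homD(1)[OF v] A.module_axioms J.module_axioms])
    then show ?thesis
      using x x' rep_hom_in[OF v] by (simp add: J.M.minus_eq_zero_iff f_def)
  qed
  have fU: "f \<in> rep_hom K D ?U J"
  proof (intro rep_homI lin_mapsI)
    fix y assume "y \<in> carrier ?U"
    then obtain a where a: "a \<in> carrier A" "y = u a" by auto
    show "f y \<in> carrier J" using a by (simp add: f rep_hom_in[OF v])
    { fix z assume "z \<in> carrier ?U"
      then obtain b where b: "b \<in> carrier A" "z = u b" by auto
      have "f (u (a \<oplus>\<^bsub>A\<^esub> b)) = f (u a) \<oplus>\<^bsub>J\<^esub> f (u b)"
        using a(1) b(1) by (simp only: f A.M.a_closed lin_maps_add[OF rep_homD(1)[OF v]])
      then show "f (y \<oplus>\<^bsub>?U\<^esub> z) = f y \<oplus>\<^bsub>J\<^esub> f z"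
        using a b by (simp add: lin_maps_add[OF rep_homD(1)[OF u]]) }
    { fix c assume c: "c \<in> carrier K"
      have "f (u (c \<odot>\<^bsub>A\<^esub> a)) = c \<odot>\<^bsub>J\<^esub> f (u a)"
        using a(1) c by (simp only: f A.smult_closed lin_maps_smult[OF rep_homD(1)[OF v]])
      then show "f (c \<odot>\<^bsub>?U\<^esub> y) = c \<odot>\<^bsub>J\<^esub> f y"
        using a c by (simp add: lin_maps_smult[OF rep_homD(1)[OF u]]) }
    fix x assume x: "x \<in> carrier D"
    have "f (u (lact A x a)) = lact J x (f (u a))" "f (u (ract A x a)) = ract J x (f (u a))"
      using a(1) x lin_maps_closed[OF A.lact_End[OF x] a(1)] lin_maps_closed[OF A.ract_End[OF x] a(1)]
      by (simp_all only: f rep_homD(2,3)[OF v])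
    then show "f (lact ?U x y) = lact J x (f y)" "f (ract ?U x y) = ract J x (f y)"
      using a x by (simp_all add: rep_homD(2,3)[OF u])
  qed
  have "(\<lambda>y. y) \<in> rep_hom K D ?U B"
    using rep_hom_in[OF u] by (auto intro!: rep_homI lin_mapsI)
  with J digroup_rep_image[OF A B u] B fU
  obtain h where "h \<in> rep_hom K D B J" "\<forall>y\<in>carrier ?U. h y = f y"
    unfolding injective_rep_def by (metis inj_on_id2)
  then show ?thesis using f by auto
qed

section \<open>Comparison of injective resolutions\<close>

text \<open>
  A resolution is treated as one exact sequence \<open>0 \<rightarrow> A 0 \<rightarrow> A 1 \<rightarrow> \<dots>\<close> that starts with the resolved
  object; the augmentation is the map \<open>u 0\<close>. Chain maps and homotopies can then be built by a single
  recursion.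
\<close>

locale acyclic_rep_complex =
  fixes K :: "('k, 'a) ring_scheme" and D :: "'d digroup"
    and A :: "nat \<Rightarrow> ('k, 'v, 'd) rep" and u :: "nat \<Rightarrow> 'v \<Rightarrow> 'v"
  assumes rep: "digroup_rep K D (A n)"
    and hom: "u n \<in> rep_hom K D (A n) (A (Suc n))"
    and mono: "\<lbrakk>x \<in> carrier (A 0); u 0 x = \<zero>\<^bsub>A 1\<^esub>\<rbrakk> \<Longrightarrow> x = \<zero>\<^bsub>A 0\<^esub>"
    and acyclic: "u n ` carrier (A n) = {x \<in> carrier (A (Suc n)). u (Suc n) x = \<zero>\<^bsub>A (Suc (Suc n))\<^esub>}"
begin

lemma module: "module K (A n)"
  by (rule digroup_rep.axioms(1)[OF rep])

lemma u_closed: "x \<in> carrier (A n) \<Longrightarrow> u n x \<in> carrier (A (Suc n))"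
  by (rule rep_hom_in[OF hom])

lemma u_u: "x \<in> carrier (A n) \<Longrightarrow> u (Suc n) (u n x) = \<zero>\<^bsub>A (Suc (Suc n))\<^esub>"
  using acyclic[of n] by auto

lemma kernelE:
  assumes "x \<in> carrier (A (Suc n))" "u (Suc n) x = \<zero>\<^bsub>A (Suc (Suc n))\<^esub>"
  obtains y where "y \<in> carrier (A n)" "x = u n y"
  using acyclic[of n] assms by auto

end

locale injective_rep_complex = acyclic_rep_complex K D B w
  for K :: "('k, 'a) ring_scheme" and D :: "'d digroup"
    and B :: "nat \<Rightarrow> ('k, 'v, 'd) rep" and w :: "nat \<Rightarrow> 'v \<Rightarrow> 'v" +
  assumes injective: "injective_rep K D (B (Suc n))"

definition rep_chain_map where
  "rep_chain_map K D A u B w f \<longleftrightarrow>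
     (\<forall>n. f n \<in> rep_hom K D (A n) (B n) \<and> (\<forall>x\<in>carrier (A n). f (Suc n) (u n x) = w n (f n x)))"

locale comparison = A: acyclic_rep_complex K D A u + B: injective_rep_complex K D B w
  for K :: "('k, 'a) ring_scheme" and D :: "'d digroup"
    and A :: "nat \<Rightarrow> ('k, 'v, 'd) rep" and u and B :: "nat \<Rightarrow> ('k, 'v, 'd) rep" and w
begin

lemma zero_hom: "f \<in> rep_hom K D (A m) (B n) \<Longrightarrow> f \<zero>\<^bsub>A m\<^esub> = \<zero>\<^bsub>B n\<^esub>"
  by (rule lin_maps_zero[OF rep_homD(1) A.module B.module])

text \<open>
  Given \<open>f n\<close>, the map \<open>w n \<circ> f n\<close> vanishes on the kernel of \<open>u n\<close>, which is the image of the preceding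
  differential, and so factors through \<open>u n\<close> by injectivity of \<open>B (n + 1)\<close>. The recursion carries this
  vanishing along as its invariant.
\<close>

lemma extend_chain_map:
  assumes \<phi>: "\<phi> \<in> rep_hom K D (A 0) (B 0)"
  shows "\<exists>f. f 0 = \<phi> \<and> rep_chain_map K D A u B w f"
proof -
  let ?P = "\<lambda>n f. f \<in> rep_hom K D (A n) (B n) \<and> (n = 0 \<longrightarrow> f = \<phi>) \<and>
    (\<forall>x\<in>carrier (A n). u n x = \<zero>\<^bsub>A (Suc n)\<^esub> \<longrightarrow> w n (f x) = \<zero>\<^bsub>B (Suc n)\<^esub>)"
  let ?R = "\<lambda>n f f'. \<forall>x\<in>carrier (A n). f' (u n x) = w n (f x)"
  have "\<exists>f. \<forall>n. ?P n (f n) \<and> ?R n (f n) (f (Suc n))"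
  proof (rule dependent_nat_choice)
    have "w 0 (\<phi> x) = \<zero>\<^bsub>B 1\<^esub>" if "x \<in> carrier (A 0)" "u 0 x = \<zero>\<^bsub>A 1\<^esub>" for x
      using A.mono[OF that] zero_hom[OF \<phi>] lin_maps_zero[OF rep_homD(1)[OF B.hom] B.module B.module, of 0]
      by simp
    then show "\<exists>f. ?P 0 f" using \<phi> by auto
  next
    fix f n assume P: "?P n f"
    have "(\<lambda>x. w n (f x)) \<in> rep_hom K D (A n) (B (Suc n))"
      using P B.hom by (blast intro: rep_hom_compose)
    then obtain f' where f': "f' \<in> rep_hom K D (A (Suc n)) (B (Suc n))"
      "\<forall>x\<in>carrier (A n). f' (u n x) = w n (f x)"
      using injective_factor[OF A.rep A.rep B.injective A.hom, of "\<lambda>x. w n (f x)" n n] P by blast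
    have "w (Suc n) (f' x) = \<zero>\<^bsub>B (Suc (Suc n))\<^esub>"
      if x: "x \<in> carrier (A (Suc n))" "u (Suc n) x = \<zero>\<^bsub>A (Suc (Suc n))\<^esub>" for x
    proof -
      from x obtain y where "y \<in> carrier (A n)" "x = u n y" by (rule A.kernelE)
      then show ?thesis using f'(2) P B.u_u rep_hom_in by fastforce
    qed
    with f' show "\<exists>f'. ?P (Suc n) f' \<and> ?R n f f'" by blast
  qed
  then show ?thesis unfolding rep_chain_map_def by blast
qed

text \<open>
  The map \<open>s (n + 1)\<close> is obtained by factoring \<open>f (n + 1) - w n \<circ> s n\<close> through \<open>u (n + 1)\<close>; the invariant of
  the recursion is again that the map to be factored vanishes on the kernel. Starting with \<open>s 0 = 0\<close> makes
  the homotopy restrict to the complexes without their augmentations, where \<open>Ext\<close> is computed.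
\<close>

lemma null_homotopy:
  assumes f: "rep_chain_map K D A u B w f" and f0: "\<And>x. x \<in> carrier (A 0) \<Longrightarrow> f 0 x = \<zero>\<^bsub>B 0\<^esub>"
  shows "\<exists>s. (\<forall>n. s n \<in> rep_hom K D (A (Suc n)) (B n)) \<and>
    (\<forall>x\<in>carrier (A 1). s 0 x = \<zero>\<^bsub>B 0\<^esub>) \<and>
    (\<forall>n. \<forall>x\<in>carrier (A (Suc n)).
       s (Suc n) (u (Suc n) x) = f (Suc n) x \<ominus>\<^bsub>B (Suc n)\<^esub> w n (s n x))"
proof -
  have fh: "f n \<in> rep_hom K D (A n) (B n)"
    and fu: "x \<in> carrier (A n) \<Longrightarrow> f (Suc n) (u n x) = w n (f n x)" for n x
    using f by (auto simp: rep_chain_map_def)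
  let ?P = "\<lambda>n s. s \<in> rep_hom K D (A (Suc n)) (B n) \<and> (n = 0 \<longrightarrow> (\<forall>x\<in>carrier (A 1). s x = \<zero>\<^bsub>B 0\<^esub>)) \<and>
    (\<forall>x\<in>carrier (A (Suc n)). u (Suc n) x = \<zero>\<^bsub>A (Suc (Suc n))\<^esub> \<longrightarrow>
       f (Suc n) x \<ominus>\<^bsub>B (Suc n)\<^esub> w n (s x) = \<zero>\<^bsub>B (Suc n)\<^esub>)"
  let ?R = "\<lambda>n s s'. \<forall>x\<in>carrier (A (Suc n)).
    s' (u (Suc n) x) = f (Suc n) x \<ominus>\<^bsub>B (Suc n)\<^esub> w n (s x)"
  have "\<exists>s. \<forall>n. ?P n (s n) \<and> ?R n (s n) (s (Suc n))"
  proof (rule dependent_nat_choice)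
    have w0: "w 0 \<zero>\<^bsub>B 0\<^esub> = \<zero>\<^bsub>B 1\<^esub>"
      using lin_maps_zero[OF rep_homD(1)[OF B.hom] B.module B.module, of 0] by simp
    interpret B1: module K "B (Suc 0)" by (rule B.module)
    have "f 1 x \<ominus>\<^bsub>B 1\<^esub> w 0 \<zero>\<^bsub>B 0\<^esub> = \<zero>\<^bsub>B 1\<^esub>"
      if x: "x \<in> carrier (A 1)" "u 1 x = \<zero>\<^bsub>A (Suc 1)\<^esub>" for x
    proof -
      from x obtain y where y: "y \<in> carrier (A 0)" "x = u 0 y"
        using A.kernelE[of x 0] by auto
      then have "f 1 x = \<zero>\<^bsub>B 1\<^esub>" using fu[OF y(1)] f0 w0 by simp
      then show ?thesis using w0 by (simp add: B1.M.minus_zero_right)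
    qed
    then have "?P 0 (\<lambda>_. \<zero>\<^bsub>B 0\<^esub>)" using rep_hom_zero[OF A.rep B.rep] by simp
    then show "\<exists>s. ?P 0 s" by blast
  next
    fix s n assume P: "?P n s"
    interpret Bn: module K "B (Suc n)" by (rule B.module)
    interpret Bn1: module K "B (Suc (Suc n))" by (rule B.module)
    let ?v = "\<lambda>x. f (Suc n) x \<ominus>\<^bsub>B (Suc n)\<^esub> w n (s x)"
    have ws: "(\<lambda>x. w n (s x)) \<in> rep_hom K D (A (Suc n)) (B (Suc n))"
      using P B.hom by (blast intro: rep_hom_compose)
    have "?v \<in> rep_hom K D (A (Suc n)) (B (Suc n))"
      by (rule rep_hom_minus[OF A.rep B.rep fh ws])
    then obtain s' where s': "s' \<in> rep_hom K D (A (Suc (Suc n))) (B (Suc n))"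
      "\<forall>x\<in>carrier (A (Suc n)). s' (u (Suc n) x) = ?v x"
      using injective_factor[OF A.rep A.rep B.injective A.hom, of ?v "Suc n" n] P by blast
    have "f (Suc (Suc n)) x \<ominus>\<^bsub>B (Suc (Suc n))\<^esub> w (Suc n) (s' x) = \<zero>\<^bsub>B (Suc (Suc n))\<^esub>"
      if x: "x \<in> carrier (A (Suc (Suc n)))" "u (Suc (Suc n)) x = \<zero>\<^bsub>A (Suc (Suc (Suc n)))\<^esub>" for x
    proof -
      from x obtain y where y: "y \<in> carrier (A (Suc n))" "x = u (Suc n) y" by (rule A.kernelE)
      have sy: "s y \<in> carrier (B n)" using P rep_hom_in y(1) by fastforce
      have fy: "f (Suc n) y \<in> carrier (B (Suc n))" by (rule rep_hom_in[OF fh y(1)])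
      have "w (Suc n) (s' x) = w (Suc n) (f (Suc n) y) \<ominus>\<^bsub>B (Suc (Suc n))\<^esub> w (Suc n) (w n (s y))"
        using s'(2) y fy B.u_closed[OF sy]
        by (simp add: lin_maps_minus[OF rep_homD(1)[OF B.hom] B.module B.module])
      also have "\<dots> = f (Suc (Suc n)) x"
        using fu[OF y(1)] y(2) B.u_closed[OF fy] by (simp add: B.u_u[OF sy] Bn1.M.minus_zero_right)
      finally show ?thesis
        using rep_hom_in[OF fh x(1)] by (simp add: Bn1.M.minus_eq_zero_iff)
    qed
    with s' show "\<exists>s'. ?P (Suc n) s' \<and> ?R n s s'" by blast
  qed
  then obtain s where s: "\<And>n. ?P n (s n) \<and> ?R n (s n) (s (Suc n))" by blast
  show ?thesis by (rule exI[of _ s]) (use s s[of 0] in blast)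
qed

end

lemma (in injective_resolution) augmented_complex:
  assumes W: "digroup_rep K D W"
  shows "injective_rep_complex K D (case_nat W I) (case_nat \<eta> \<delta>)"
proof -
  have I: "digroup_rep K D (I n)" for n
    using injective by (simp add: injective_rep_def)
  note m = digroup_rep.axioms(1)[OF I] digroup_rep.axioms(1)[OF W]
  show ?thesis
  proof (intro injective_rep_complex.intro acyclic_rep_complex.intro injective_rep_complex_axioms.intro)
    show "digroup_rep K D (case_nat W I n)" for n using I W by (cases n) auto
    show "case_nat \<eta> \<delta> n \<in> rep_hom K D (case_nat W I n) (case_nat W I (Suc n))" for n
      using aug_hom diff_hom by (cases n) auto
    show "x = \<zero>\<^bsub>case_nat W I 0\<^esub>"
      if "x \<in> carrier (case_nat W I 0)" "case_nat \<eta> \<delta> 0 x = \<zero>\<^bsub>case_nat W I 1\<^esub>" for x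
    proof -
      interpret W: module K W by (rule m(2))
      show ?thesis
        using that inj_onD[OF aug_inj, of x "\<zero>\<^bsub>W\<^esub>"] lin_maps_zero[OF rep_homD(1)[OF aug_hom] m(2) m(1)]
        by simp
    qed
    show "case_nat \<eta> \<delta> n ` carrier (case_nat W I n) = {x \<in> carrier (case_nat W I (Suc n)).
        case_nat \<eta> \<delta> (Suc n) x = \<zero>\<^bsub>case_nat W I (Suc (Suc n))\<^esub>}" for n
      using exact_aug exact by (cases n) (auto simp: a_kernel_def')
    show "injective_rep K D (case_nat W I (Suc n))" for n
      using injective by simp
  qed
qed

section \<open>Independence of Ext of the injective resolution\<close>

context injective_rep_complex
begin

lemma Hom_complex:
  assumes Q: "digroup_rep K D Q"
  shows "module K (rep_Hom K D Q (B (Suc n)))"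
    and "compose (carrier Q) (w (Suc n)) \<in>
      lin_maps K (rep_Hom K D Q (B (Suc n))) (rep_Hom K D Q (B (Suc (Suc n))))"
  by (rule module_rep_Hom[OF Q rep]) (rule compose_rep_Hom[OF Q rep rep hom])

lemma Hom_submodules:
  assumes Q: "digroup_rep K D Q"
  shows "submodule (cocycles (\<lambda>m. rep_Hom K D Q (B (Suc m))) (\<lambda>m. compose (carrier Q) (w (Suc m))) n)
      K (rep_Hom K D Q (B (Suc n)))"
    and "submodule (coboundaries (\<lambda>m. rep_Hom K D Q (B (Suc m))) (\<lambda>m. compose (carrier Q) (w (Suc m))) n)
      K (rep_Hom K D Q (B (Suc n)))"
  using submodule_cocycles[of K "\<lambda>m. rep_Hom K D Q (B (Suc m))", OF Hom_complex[OF Q]]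
    submodule_coboundaries[of K "\<lambda>m. rep_Hom K D Q (B (Suc m))", OF Hom_complex[OF Q]] .

text \<open>
  The difference of \<open>f\<close> and the identity has a null homotopy \<open>s\<close>. On a cocycle \<open>z\<close> the summand
  \<open>s \<circ> w \<circ> z\<close> vanishes, which leaves the coboundary \<open>w \<circ> (s \<circ> z)\<close>; in degree \<open>0\<close>, where the only coboundary
  is zero, the remaining summand vanishes because \<open>s 0 = 0\<close>.
\<close>

lemma chain_map_over_identity_homologous:
  assumes Q: "digroup_rep K D Q" and f: "rep_chain_map K D B w B w f"
    and f0: "\<And>x. x \<in> carrier (B 0) \<Longrightarrow> f 0 x = x"
    and z: "z \<in> cocycles (\<lambda>m. rep_Hom K D Q (B (Suc m))) (\<lambda>m. compose (carrier Q) (w (Suc m))) n"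
  shows "compose (carrier Q) (f (Suc n)) z \<ominus>\<^bsub>rep_Hom K D Q (B (Suc n))\<^esub> z
    \<in> coboundaries (\<lambda>m. rep_Hom K D Q (B (Suc m))) (\<lambda>m. compose (carrier Q) (w (Suc m))) n"
proof -
  let ?H = "\<lambda>m. rep_Hom K D Q (B (Suc m))"
  interpret comparison K D B w B w by unfold_locales
  interpret Hn: module K "?H n" by (rule Hom_complex(1)[OF Q])
  interpret Bn: module K "B (Suc n)" by (rule module)
  have fh: "f m \<in> rep_hom K D (B m) (B m)" for m using f by (simp add: rep_chain_map_def)
  have "rep_chain_map K D B w B w (\<lambda>m x. f m x \<ominus>\<^bsub>B m\<^esub> x)"
    unfolding rep_chain_map_def
  proof (intro allI conjI ballI)
    show "(\<lambda>x. f m x \<ominus>\<^bsub>B m\<^esub> x) \<in> rep_hom K D (B m) (B m)" for m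
      by (rule rep_hom_minus[OF rep rep fh rep_hom_id])
    show "f (Suc m) (w m x) \<ominus>\<^bsub>B (Suc m)\<^esub> w m x = w m (f m x \<ominus>\<^bsub>B m\<^esub> x)"
      if "x \<in> carrier (B m)" for m x
      using that f rep_hom_in[OF fh that]
      by (simp add: rep_chain_map_def lin_maps_minus[OF rep_homD(1)[OF hom] module module])
  qed
  moreover have "f 0 x \<ominus>\<^bsub>B 0\<^esub> x = \<zero>\<^bsub>B 0\<^esub>" if "x \<in> carrier (B 0)" for x
  proof -
    interpret B0: module K "B 0" by (rule module)
    show ?thesis using that f0 by (simp add: B0.M.minus_eq_zero_iff)
  qed
  ultimately have "\<exists>s. (\<forall>m. s m \<in> rep_hom K D (B (Suc m)) (B m)) \<and>
      (\<forall>x\<in>carrier (B 1). s 0 x = \<zero>\<^bsub>B 0\<^esub>) \<and>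
      (\<forall>m. \<forall>x\<in>carrier (B (Suc m)).
         s (Suc m) (w (Suc m) x) = (f (Suc m) x \<ominus>\<^bsub>B (Suc m)\<^esub> x) \<ominus>\<^bsub>B (Suc m)\<^esub> w m (s m x))"
    by (rule null_homotopy)
  then obtain s where s: "\<And>m. s m \<in> rep_hom K D (B (Suc m)) (B m)"
    and s0: "\<And>x. x \<in> carrier (B 1) \<Longrightarrow> s 0 x = \<zero>\<^bsub>B 0\<^esub>"
    and su: "\<And>m x. x \<in> carrier (B (Suc m)) \<Longrightarrow>
      s (Suc m) (w (Suc m) x) = (f (Suc m) x \<ominus>\<^bsub>B (Suc m)\<^esub> x) \<ominus>\<^bsub>B (Suc m)\<^esub> w m (s m x)"
    by blast
  have zc: "z \<in> carrier (?H n)"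
    using z by (simp add: cocycles_def a_kernel_def')
  then have zq: "z q \<in> carrier (B (Suc n))" if "q \<in> carrier Q" for q
    using that rep_hom_in by (fastforce simp: rep_Hom_def)
  have wz: "w (Suc n) (z q) = \<zero>\<^bsub>B (Suc (Suc n))\<^esub>" if "q \<in> carrier Q" for q
    using z that by (simp add: cocycles_def a_kernel_def' rep_Hom_def compose_def fun_eq_iff restrict_def)
      meson
  let ?x = "compose (carrier Q) (f (Suc n)) z \<ominus>\<^bsub>?H n\<^esub> z"
  have fz: "compose (carrier Q) (f (Suc n)) z \<in> carrier (?H n)"
    by (rule lin_maps_closed[OF compose_rep_Hom[OF Q rep rep fh] zc])
  have xc: "?x \<in> carrier (?H n)" using fz zc by simp
  then have xE: "?x \<in> carrier Q \<rightarrow>\<^sub>E carrier (B (Suc n))"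
    using rep_Hom_subset[OF Q rep] by (auto simp: rep_Hom_def)
  have xq: "?x q = w n (s n (z q))" if q: "q \<in> carrier Q" for q
  proof -
    have c: "f (Suc n) (z q) \<ominus>\<^bsub>B (Suc n)\<^esub> z q \<in> carrier (B (Suc n))"
      using rep_hom_in[OF fh zq[OF q]] zq[OF q] by simp
    have "(f (Suc n) (z q) \<ominus>\<^bsub>B (Suc n)\<^esub> z q) \<ominus>\<^bsub>B (Suc n)\<^esub> w n (s n (z q)) = \<zero>\<^bsub>B (Suc n)\<^esub>"
      using su[OF zq[OF q]] wz[OF q] lin_maps_zero[OF rep_homD(1)[OF s] module module, of "Suc n"] by simp
    then have "f (Suc n) (z q) \<ominus>\<^bsub>B (Suc n)\<^esub> z q = w n (s n (z q))"
      using c u_closed[OF rep_hom_in[OF s zq[OF q]]] by (simp add: Bn.M.minus_eq_zero_iff)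
    then show ?thesis
      using rep_Hom_minus[OF Q rep fz zc q] q by (simp add: compose_def)
  qed
  show ?thesis
  proof (cases n)
    case 0
    have "?x q = \<zero>\<^bsub>B 1\<^esub>" if "q \<in> carrier Q" for q
      using xq[OF that] s0 zq[OF that] lin_maps_zero[OF rep_homD(1)[OF hom] module module, of 0]
      by (simp add: 0)
    then have "?x = \<zero>\<^bsub>?H n\<^esub>"
      using xE by (auto simp: rep_Hom_def 0 fun_eq_iff)
    then show ?thesis by (simp add: coboundaries_def 0)
  next
    case (Suc m)
    have sz: "compose (carrier Q) (s n) z \<in> carrier (?H m)"
      using lin_maps_closed[OF compose_rep_Hom[OF Q rep rep s] zc] by (simp add: Suc)
    have "compose (carrier Q) (w (Suc m)) (compose (carrier Q) (s n) z) = ?x"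
      using xE xq by (auto simp: fun_eq_iff compose_def Suc)
    then show ?thesis
      using sz by (auto simp: coboundaries_def Suc intro!: rev_image_eqI[OF sz])
  qed
qed

end

lemma chain_map_on_cocycles:
  assumes Q: "digroup_rep K D Q"
    and A: "injective_rep_complex K D A u" and B: "injective_rep_complex K D B w"
    and f: "rep_chain_map K D A u B w f"
  shows "compose (carrier Q) (f (Suc n)) `
      cocycles (\<lambda>m. rep_Hom K D Q (A (Suc m))) (\<lambda>m. compose (carrier Q) (u (Suc m))) n
    \<subseteq> cocycles (\<lambda>m. rep_Hom K D Q (B (Suc m))) (\<lambda>m. compose (carrier Q) (w (Suc m))) n" (is ?Z)
    and "compose (carrier Q) (f (Suc n)) `
      coboundaries (\<lambda>m. rep_Hom K D Q (A (Suc m))) (\<lambda>m. compose (carrier Q) (u (Suc m))) n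
    \<subseteq> coboundaries (\<lambda>m. rep_Hom K D Q (B (Suc m))) (\<lambda>m. compose (carrier Q) (w (Suc m))) n" (is ?B)
proof -
  interpret A: injective_rep_complex K D A u by (rule A)
  interpret B: injective_rep_complex K D B w by (rule B)
  have fh: "f m \<in> rep_hom K D (A m) (B m)"
    and fu: "x \<in> carrier (A m) \<Longrightarrow> f (Suc m) (u m x) = w m (f m x)" for m x
    using f by (auto simp: rep_chain_map_def)
  have lin: "compose (carrier Q) (f (Suc m)) \<in>
      lin_maps K (rep_Hom K D Q (A (Suc m))) (rep_Hom K D Q (B (Suc m)))" for m
    by (rule compose_rep_Hom[OF Q A.rep B.rep fh])
  have cc: "c q \<in> carrier (A (Suc m))" if "c \<in> carrier (rep_Hom K D Q (A (Suc m)))" "q \<in> carrier Q" for c q m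
    using that rep_hom_in by (fastforce simp: rep_Hom_def)
  have comm: "compose (carrier Q) (w (Suc m)) (compose (carrier Q) (f (Suc m)) c) =
      compose (carrier Q) (f (Suc (Suc m))) (compose (carrier Q) (u (Suc m)) c)"
    if "c \<in> carrier (rep_Hom K D Q (A (Suc m)))" for c m
    using fu cc[OF that] by (auto simp: compose_def fun_eq_iff)
  note zero = lin_maps_zero[OF lin A.Hom_complex(1)[OF Q] B.Hom_complex(1)[OF Q]]
  show ?Z
    using lin_maps_closed[OF lin] comm zero by (auto simp: cocycles_def a_kernel_def')
  show ?B
    using lin_maps_closed[OF lin] zero
    by (cases n) (auto simp: coboundaries_def comm[symmetric])
qed

text \<open>
  The identity of the resolved object extends to chain maps in both directions, and both composites
  extend the identity.
\<close>

lemma Hom_cohomology_independent: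
  assumes Q: "digroup_rep K D Q"
    and A: "injective_rep_complex K D A u" and B: "injective_rep_complex K D B w"
    and start: "A 0 = B 0"
  shows "lin_iso K (cohomology (\<lambda>m. rep_Hom K D Q (A (Suc m))) (\<lambda>m. compose (carrier Q) (u (Suc m))) n)
     (cohomology (\<lambda>m. rep_Hom K D Q (B (Suc m))) (\<lambda>m. compose (carrier Q) (w (Suc m))) n)"
proof -
  interpret A: injective_rep_complex K D A u by (rule A)
  interpret B: injective_rep_complex K D B w by (rule B)
  interpret AB: comparison K D A u B w by unfold_locales
  interpret BA: comparison K D B w A u by unfold_locales
  obtain f where f0: "f 0 = (\<lambda>x. x)" and f: "rep_chain_map K D A u B w f"
    using AB.extend_chain_map[of "\<lambda>x. x"] rep_hom_id start by metis
  obtain g where g0: "g 0 = (\<lambda>x. x)" and g: "rep_chain_map K D B w A u g"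
    using BA.extend_chain_map[of "\<lambda>x. x"] rep_hom_id start by metis
  have fh: "f m \<in> rep_hom K D (A m) (B m)" and gh: "g m \<in> rep_hom K D (B m) (A m)" for m
    using f g by (auto simp: rep_chain_map_def)
  have gf: "rep_chain_map K D A u A u (\<lambda>m x. g m (f m x))"
    and fg: "rep_chain_map K D B w B w (\<lambda>m x. f m (g m x))"
    using f g rep_hom_in[OF fh] rep_hom_in[OF gh]
    by (auto simp: rep_chain_map_def intro: rep_hom_compose)
  have comp: "compose (carrier Q) h' (compose (carrier Q) h c) = compose (carrier Q) (\<lambda>x. h' (h x)) c"
    for h h' c
    by (auto simp: compose_def)
  show ?thesis
    unfolding cohomology_def
  proof (rule lin_iso_subquots[where F = "compose (carrier Q) (f (Suc n))"
        and G = "compose (carrier Q) (g (Suc n))"])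
  qed (simp_all add: comp A.Hom_complex[OF Q] B.Hom_complex[OF Q]
      A.Hom_submodules[OF Q] B.Hom_submodules[OF Q]
      chain_map_on_cocycles[OF Q A B f] chain_map_on_cocycles[OF Q B A g]
      compose_rep_Hom[OF Q A.rep B.rep fh] compose_rep_Hom[OF Q B.rep A.rep gh]
      A.chain_map_over_identity_homologous[OF Q gf] B.chain_map_over_identity_homologous[OF Q fg]
      f0 g0)
qed

lemma rep_Ext_independent:
  assumes Q: "digroup_rep K D Q" and W: "digroup_rep K D W"
    and I: "injective_resolution K D W I \<delta>I \<eta>I" and J: "injective_resolution K D W J \<delta>J \<eta>J"
  shows "lin_iso K (rep_Ext K D Q I \<delta>I n) (rep_Ext K D Q J \<delta>J n)"
  using Hom_cohomology_independent[OF Q injective_resolution.augmented_complex[OF I W]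
      injective_resolution.augmented_complex[OF J W]]
  by (simp add: rep_Ext_def)

section \<open>The complex of \<open>B\<^sub>E\<close>-linear maps\<close>

context digroup_of_action
begin

lemma compose_halo_Hom:
  assumes Q: "digroup_rep K D Q" and V: "digroup_rep K D V" and W: "digroup_rep K D W"
    and f: "f \<in> rep_hom K D V W"
  shows "compose (carrier Q) f \<in> lin_maps K (halo_Hom K G E Q V) (halo_Hom K G E Q W)"
    and "\<lbrakk>g \<in> carrier G; c \<in> carrier (halo_Hom K G E Q V)\<rbrakk> \<Longrightarrow>
      compose (carrier Q) f (gact (halo_Hom K G E Q V) g c) =
      gact (halo_Hom K G E Q W) g (compose (carrier Q) f c)"
proof -
  note lin = rep_homD(1)[OF f]
  have fl: "f (lact V (\<one>\<^bsub>G\<^esub>, \<alpha>) v) = lact W (\<one>\<^bsub>G\<^esub>, \<alpha>) (f v)" if "\<alpha> \<in> E" "v \<in> carrier V" for \<alpha> v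
    using rep_homD(2)[OF f] that by (simp add: D_simps)
  have frho: "f (rho E V g v) = rho E W g (f v)" if "g \<in> carrier G" "v \<in> carrier V" for g v
    using rep_homD(3)[OF f] that nonempty by (simp add: rho_def D_simps some_in_eq)
  have closed: "compose (carrier Q) f c \<in> halo_hom K G E Q W" if c: "c \<in> halo_hom K G E Q V" for c
    unfolding compose_def
    using lin_maps_compose[OF halo_homD(1)[OF Q V c] lin]
    by (rule halo_hom_restrict[OF Q W]) (simp add: halo_homD(2,3)[OF Q V c] fl)
  show "compose (carrier Q) f \<in> lin_maps K (halo_Hom K G E Q V) (halo_Hom K G E Q W)"
    using halo_homD(3)[OF Q V]
    by (intro lin_mapsI)
       (auto simp: halo_Hom_simps[OF Q V] halo_Hom_simps[OF Q W] closed[unfolded compose_def] compose_def fun_eq_iff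
          lin_maps_add[OF lin] lin_maps_smult[OF lin])
  show "compose (carrier Q) f (gact (halo_Hom K G E Q V) g c) =
      gact (halo_Hom K G E Q W) g (compose (carrier Q) f c)"
    if g: "g \<in> carrier G" and "c \<in> carrier (halo_Hom K G E Q V)"
  proof -
    have c: "c \<in> halo_hom K G E Q V" using that by (simp add: halo_Hom_simps[OF Q V])
    show ?thesis
      using g by (auto simp: halo_Hom_simps(5)[OF Q V] halo_Hom_simps(5)[OF Q W] inv_into_rho[OF Q]
          compose_def fun_eq_iff frho halo_homD(3)[OF Q V c] rho_closed[OF Q])
  qed
qed

lemma halo_Hom_complex:
  assumes K: "field K" "char_zero K" and fin: "finite (carrier G)"
    and Q: "digroup_rep K D Q" and I: "injective_resolution K D W I \<delta> \<eta>"
  shows "equivariant_complex K G (\<lambda>m. halo_Hom K G E Q (I m)) (\<lambda>m. compose (carrier Q) (\<delta> m))"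
proof -
  interpret I: injective_resolution K D W I \<delta> \<eta> by (rule I)
  have rep: "digroup_rep K D (I m)" for m
    using I.injective by (simp add: injective_rep_def)
  have "carrier G \<noteq> {}" using G.one_closed by blast
  then show ?thesis
    using compose_halo_Hom[OF Q rep rep I.diff_hom] halo_Hom_action[OF Q rep] K fin
    by (simp add: equivariant_complex_def finite_linear_action_def finite_index_def)
qed

text \<open>
  The edge isomorphism \<open>Ext\<^sup>n(Q, W) = H\<^sup>n(Hom\<^bsub>B\<^esub>(Q, I)\<^sup>G) \<cong> H\<^sup>n(Hom\<^bsub>B\<^esub>(Q, I))\<^sup>G\<close>.
\<close>

lemma lin_iso_rep_Ext_group_cohomology:
  assumes K: "field K" "char_zero K" and fin: "finite (carrier G)"
    and Q: "digroup_rep K D Q" and I: "injective_resolution K D W I \<delta> \<eta>"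
  shows "lin_iso K (rep_Ext K D Q I \<delta> n) (group_cohomology G (derived_halo_Hom K G E Q I \<delta> n) 0)"
proof -
  interpret I: injective_resolution K D W I \<delta> \<eta> by (rule I)
  have rep: "digroup_rep K D (I m)" for m
    using I.injective by (simp add: injective_rep_def)
  interpret equivariant_complex K G "\<lambda>m. halo_Hom K G E Q (I m)" "\<lambda>m. compose (carrier Q) (\<delta> m)"
    by (rule halo_Hom_complex[OF K fin Q I])
  show ?thesis
    unfolding rep_Ext_def derived_halo_Hom_def
    by (rule lin_iso_cohomology_fixed_points[OF module_rep_Hom[OF Q rep]])
       (simp_all add: fixed_points_halo_Hom[OF Q rep] rep_Hom_def
          halo_Hom_simps[OF Q rep] fun_eq_iff)
qed

end

section \<open>Degenerate spectral sequences\<close>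

text \<open>
  With zero differentials every page is isomorphic to its own cohomology, so one page can be repeated.
\<close>

lemma first_quadrant_ss_stationary:
  assumes mod: "\<And>p q. module K (E p q)"
    and quadrant: "\<And>p q. p < 0 \<or> q < 0 \<Longrightarrow> carrier (E p q) = {\<zero>\<^bsub>E p q\<^esub>}"
  shows "first_quadrant_ss K (\<lambda>r. E) (\<lambda>r p q _. \<zero>\<^bsub>E (p + int r) (q - int r + 1)\<^esub>)"
proof (rule first_quadrant_ss.intro)
  fix r :: nat and p q :: int
  interpret S: module K "E p q" by (rule mod)
  interpret T: module K "E (p + int r) (q - int r + 1)" by (rule mod)
  interpret S': module K "E (p - int r) (q + int r - 1)" by (rule mod)
  show "module K (E p q)" by (rule mod)
  show "carrier (E p q) = {\<zero>\<^bsub>E p q\<^esub>}" if "p < 0 \<or> q < 0" by (rule quadrant[OF that])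
  show "(\<lambda>_. \<zero>\<^bsub>E (p + int r) (q - int r + 1)\<^esub>) \<in> lin_maps K (E p q) (E (p + int r) (q - int r + 1))"
    by (rule lin_mapsI) auto
  have "a_kernel (E p q) (E (p + int r) (q - int r + 1)) (\<lambda>_. \<zero>\<^bsub>E (p + int r) (q - int r + 1)\<^esub>)
      = carrier (E p q)"
    by (simp add: a_kernel_def')
  moreover have "(\<lambda>_. \<zero>\<^bsub>E (p - int r + int r) (q + int r - 1 - int r + 1)\<^esub>) `
      carrier (E (p - int r) (q + int r - 1)) = {\<zero>\<^bsub>E p q\<^esub>}"
    using S'.M.zero_closed by (auto intro!: image_eqI)
  ultimately show "lin_iso K (E p q) (subquot (E p q)
      (a_kernel (E p q) (E (p + int r) (q - int r + 1)) (\<lambda>_. \<zero>\<^bsub>E (p + int r) (q - int r + 1)\<^esub>))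
      ((\<lambda>_. \<zero>\<^bsub>E (p - int r + int r) (q + int r - 1 - int r + 1)\<^esub>) `
        carrier (E (p - int r) (q + int r - 1))))"
    using lin_iso_sym[OF S.module_subquot[OF S.carrier_is_submodule S.trivial_submodule]
        lin_iso_subquot_carrier[OF mod]] by simp
qed simp

text \<open>
  If only the column \<open>p = 0\<close> is non-zero, the filtration of \<open>H n\<close> has the single step
  \<open>H n \<supseteq> 0\<close>.
\<close>

lemma ss_converges_one_column:
  fixes E :: "int \<Rightarrow> int \<Rightarrow> ('k, 'x) module"
  assumes mod: "\<And>p q. module K (E p q)"
    and trivial: "\<And>p q :: nat. p > 0 \<Longrightarrow> carrier (E (int p) (int q)) = {\<zero>\<^bsub>E (int p) (int q)\<^esub>}"
    and H: "\<And>n. module K (H n)" and iso: "\<And>q :: nat. lin_iso K (E 0 (int q)) (H q)"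
  shows "ss_converges K (\<lambda>r. E) H"
proof -
  define F where "F n p = (if p = 0 then carrier (H n) else {\<zero>\<^bsub>H n\<^esub>})" for n p :: nat
  have sub: "submodule (F n p) K (H n)" for n p
    using module.carrier_is_submodule[OF H] module.trivial_submodule[OF H] by (simp add: F_def)
  have "lin_iso K (E (int p) (int q)) (subquot (H (p + q)) (F (p + q) p) (F (p + q) (Suc p)))" for p q
  proof (cases "p = 0")
    case True
    have "lin_iso K (H q) (subquot (H q) (carrier (H q)) {\<zero>\<^bsub>H q\<^esub>})"
      by (rule lin_iso_sym[OF module.module_subquot[OF H module.carrier_is_submodule[OF H]
              module.trivial_submodule[OF H]] lin_iso_subquot_carrier[OF H]])
    then show ?thesis
      using lin_iso_trans[OF iso] True by (simp add: F_def)
  next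
    case False
    interpret module K "H (p + q)" by (rule H)
    have "{\<zero>\<^bsub>H (p + q)\<^esub>} +>\<^bsub>H (p + q)\<^esub> \<zero>\<^bsub>H (p + q)\<^esub> = {\<zero>\<^bsub>H (p + q)\<^esub>}"
      by (simp add: coset_eq_zero_iff[OF trivial_submodule])
    then show ?thesis
      using False trivial mod module_subquot[OF trivial_submodule trivial_submodule]
      by (intro lin_iso_trivial) (auto simp: F_def subquot_simps(1,2))
  qed
  moreover have "F n (Suc p) \<subseteq> F n p" for n p
    using module.submodule_zero[OF H module.carrier_is_submodule[OF H]] by (auto simp: F_def)
  moreover have "F n 0 = carrier (H n) \<and> F n (Suc n) = {\<zero>\<^bsub>H n\<^esub>}" for n by (simp add: F_def)
  ultimately show ?thesis
    unfolding ss_converges_def using sub by blast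
qed

text \<open>
  The terms outside the first quadrant. Every type has the element \<open>undefined\<close>, which serves as the zero.
\<close>

definition zero_module :: "('k, 'x) module" where
  "zero_module = \<lparr>carrier = {undefined}, mult = undefined, one = undefined, zero = undefined,
     add = (\<lambda>_ _. undefined), smult = (\<lambda>_ _. undefined)\<rparr>"

lemma module_zero_module: "cring K \<Longrightarrow> module K zero_module"
  by (intro moduleI abelian_groupI) (auto simp: zero_module_def)

theorem theorem56:
  fixes K :: "('k, 'a) ring_scheme"
    and G :: "('g, 'c) monoid_scheme"
    and E :: "'e set"
    and \<phi> :: "'g \<Rightarrow> 'e \<Rightarrow> 'e"
    and Q W :: "('k, 'v, 'g \<times> 'e) rep"
    and I J :: "nat \<Rightarrow> ('k, 'v, 'g \<times> 'e) rep"
    and \<delta>I \<delta>J :: "nat \<Rightarrow> 'v \<Rightarrow> 'v"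
    and \<eta>I \<eta>J :: "'v \<Rightarrow> 'v"
  defines "D \<equiv> action_digroup G E \<phi>"
  assumes "field K" and "char_zero K"
    and "group G" and "finite (carrier G)"
    and "group_action G E \<phi>" and "E \<noteq> {}"
    and "digroup_rep K D Q" and "digroup_rep K D W"
    and "injective_resolution K D W I \<delta>I \<eta>I"
    and "injective_resolution K D W J \<delta>J \<eta>J"
  shows "\<exists>(Er :: nat \<Rightarrow> int \<Rightarrow> int \<Rightarrow> ('k, ('g list \<Rightarrow> ('v \<Rightarrow> 'v) set) set) module) d.
    first_quadrant_ss K Er d \<and>
    (\<forall>p q :: nat. lin_iso K (Er 2 (int p) (int q))
       (group_cohomology G (derived_halo_Hom K G E Q I \<delta>I q) p)) \<and>
    ss_converges K Er (rep_Ext K D Q J \<delta>J)"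
proof -
  interpret digroup_of_action G E \<phi>
    by (intro digroup_of_action.intro digroup_of_action_axioms.intro assms)
  note K = \<open>field K\<close> \<open>char_zero K\<close> and fin = \<open>finite (carrier G)\<close>
  note Q = \<open>digroup_rep K D Q\<close>[unfolded D_def] and W = \<open>digroup_rep K D W\<close>[unfolded D_def]
  note I = \<open>injective_resolution K D W I \<delta>I \<eta>I\<close>[unfolded D_def]
  note J = \<open>injective_resolution K D W J \<delta>J \<eta>J\<close>[unfolded D_def]
  let ?R = "derived_halo_Hom K G E Q I \<delta>I"
  let ?Ext = "rep_Ext K (action_digroup G E \<phi>) Q"
  define E2 where "E2 p q = (if 0 \<le> p \<and> 0 \<le> q then group_cohomology G (?R (nat q)) (nat p)
    else zero_module)" for p q :: int
  interpret C: equivariant_complex K G "\<lambda>m. halo_Hom K G E Q (I m)" "\<lambda>m. compose (carrier Q) (\<delta>I m)"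
    by (rule halo_Hom_complex[OF K fin Q I])
  have R: "finite_linear_action K G (?R n)" for n
    unfolding derived_halo_Hom_def by (rule C.gcohomology_action)
  note R' = finite_linear_action.axioms(1)[OF R]
  have mod: "module K (E2 p q)" for p q
    using linear_action.module_group_cohomology[OF R'] fieldE(1)[OF K(1)]
    by (simp add: E2_def module_zero_module)
  have "first_quadrant_ss K (\<lambda>r. E2) (\<lambda>r p q _. \<zero>\<^bsub>E2 (p + int r) (q - int r + 1)\<^esub>)"
    by (rule first_quadrant_ss_stationary[OF mod]) (auto simp: E2_def zero_module_def)
  moreover have E2_nat: "E2 (int p) (int q) = group_cohomology G (?R q) p" for p q
    by (simp add: E2_def)
  moreover have "ss_converges K (\<lambda>r. E2) (?Ext J \<delta>J)"
  proof (rule ss_converges_one_column[OF mod])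
    show "carrier (E2 (int p) (int q)) = {\<zero>\<^bsub>E2 (int p) (int q)\<^esub>}" if "p > 0" for p q
      unfolding E2_nat using that finite_linear_action.group_cohomology_Suc_trivial[OF R]
      by (cases p) simp_all
    have Ext_module: "module K (?Ext I' \<delta>' n)" if I': "injective_resolution K (action_digroup G E \<phi>) W I' \<delta>' \<eta>'"
      for I' \<delta>' \<eta>' n
    proof -
      have "digroup_rep K (action_digroup G E \<phi>) (I' m)" for m
        using injective_resolution.injective[OF I'] by (simp add: injective_rep_def)
      then show ?thesis
        unfolding rep_Ext_def
        by (intro module_cohomology module_rep_Hom compose_rep_Hom Q injective_resolution.diff_hom[OF I'])
    qed
    show "module K (?Ext J \<delta>J n)" for n by (rule Ext_module[OF J])
    show "lin_iso K (E2 0 (int q)) (?Ext J \<delta>J q)" for q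
      using lin_iso_trans[OF lin_iso_sym[OF Ext_module[OF I] lin_iso_rep_Ext_group_cohomology[OF K fin Q I]]
          rep_Ext_independent[OF Q W I J]]
      using E2_nat[of 0 q] by simp
  qed
  ultimately show ?thesis
    unfolding D_def by (intro exI conjI allI) (simp_all add: lin_iso_refl)
qed

end
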